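(* Deductions in $\mathbf{INF}^{\iota}{}'$ can be brought into normal form: for every deduction in $\mathbf{INF}^{\iota}{}'$ of a formula $A$ from a set $\Gamma$ of open assumptions there is a deduction in $\mathbf{INF}^{\iota}{}'$ of $A$, all of whose open assumptions belong to $\Gamma$, which is in normal form.
   Context: **Language.** First-order language with parameters $a,b,\ldots$ (used as free variables, distinct in shape from the bound variables $x,y,z,\ldots$), constants, predicate letters, identity $=$, a one-place existence predicate $\exists!$, the connectives and quantifiers $\bot,\land,\lor,\rightarrow,\exists,\forall$, and the definite description operator $\iota$, which forms from a variable $x$ and a formula $F$ a term $\iota xF$ binding $x$; $\neg A$ is $A\rightarrow\bot$. Terms are parameters and constants (atomic terms) and $\iota$-terms (complex terms). $A_t^x$ is $A$ with $t$ replacing all free occurrences of $x$. Atomic formulas are formed by a predicate letter, $\exists!$ or $=$ from terms; they are prime if all these terms are atomic. **Rules of $\mathbf{INF}^{\iota}{}'$** (natural deduction trees, $[A]$ marks a class of assumptions discharged by the rule, vacuous discharge allowed). $(\land I)$: from $A$, $B$ infer $A\land B$. $(\land E)$: from $A\land B$ infer $A$; from $A\land B$ infer $B$. $(\rightarrow I)$: from a deduction of $B$ from $[A]$ infer $A\rightarrow B$. $(\rightarrow E)$: from $A\rightarrow B$ and $A$ infer $B$. $(\lor I)$: from $A$ infer $A\lor B$; from $B$ infer $A\lor B$. $(\lor E)$: from $A\lor B$, a deduction of $C$ from $[A]$ and a deduction of $C$ from $[B]$ infer $C$. $(\bot E)$: from $\bot$ infer $B$. $(\forall I)$: from a deduction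 $\Pi$ of $A_a^x$ from $[\exists!a]$ infer $\forall xA$, where $a$ does not occur in $\forall xA$ nor in undischarged assumptions of $\Pi$ except those in the class of $\exists!a$. $(\forall E)$: from $\forall xA$ and $\exists!t$ infer $A_t^x$, $t$ atomic. $(\exists I)$: from $A_t^x$ and $\exists!t$ infer $\exists xA$, $t$ atomic. $(\exists E)$: from $\exists xA$ and a deduction $\Pi$ of $C$ from $[A_a^x],[\exists!a]$ infer $C$, where $a$ does not occur in $C$, in $\exists xA$, nor in undischarged assumptions of $\Pi$ except those in the classes of $A_a^x$ and $\exists!a$. $(=I^{nG})$: from $\exists!t$ (major premise) and a deduction $\Pi$ of $C$ (minor premise) from $[a=t]$ infer $C$, where $a$ does not occur in $t$, $C$ nor in open assumptions of $\Pi$ other than those in the class of $a=t$. $(=E)$: from $t_1=t_2$ and $A_{t_1}^x$ infer $A_{t_2}^x$. $(AD)$: from $Rt_1\ldots t_n$ infer $\exists!t_i$ ($1\le i\le n$), where $R$ is a predicate letter (not $\exists!$) or $=$. $(\iota I)$: from $\exists!t$, a deduction $\Xi$ of $F_a^x$ from $[a=t]$ and a deduction $\Pi$ of $a=t$ from $[F_a^x],[\exists!a]$ infer $\iota xF=t$, where $t$ is atomic and $a$ does not occur in $\iota xF$, in $t$, nor in undischarged assumptions except those in the classes of $a=t$ in $\Xi$ and of $F_a^x$, $\exists!a$ in $\Pi$. $(\iota E_1)$: from $\iota xF=t$ and $u=t$ infer $F_u^x$, $t,u$ atomic. $(\iota E_2)$: from $\iota xF=t$, $F_u^x$ and $\exists!u$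 infer $u=t$, $t,u$ atomic. $(\iota E_3)$: from $\iota xF=t$ infer $\exists!t$. (An inference from the conclusion $\iota xF=t$ of $(\iota I)$ to $\exists!t$ counts as $(\iota E_3)$; one to $\exists!\,\iota xF$ counts as $(AD)$.) Rules labelled with $I$ are introduction rules, rules labelled with $E$ are elimination rules. **Standing conventions.** Applications of $(=E)$ have atomic conclusions and applications of $(\bot E)$ have prime conclusions. In any application of a rule with a restriction on a parameter, the parameter is used solely for that application and occurs nowhere else in the deduction. Vacuous applications of $(=E)$ (major premise $t=t$) are assumed to be always removed. The major premise of an elimination rule is the formula that displays the connective or $\iota$ in the general statement of the rule, here always the leftmost premise; all other premises are minor. **Segments and normal form.** A *segment* is a sequence of formula occurrences $C_1,\ldots,C_n$ such that $C_1$ is not the conclusion, and $C_n$ not a minor premise, of $(\lor E)$, $(\exists E)$ or $(=I^{nG})$, and if $n>1$ then for all $i<n$, $C_i$ is a minor premise of $(\lor E)$, $(\exists E)$ or $(=I^{nG})$ and $C_{i+1}$ the conclusion; $n$ is its length. A segment is said to be a premise (conclusion, discharged assumption) of a rule according to whether its last or first formula is. The following are maximal segments. (1) A segment whose last formula is the major premise of an elimination rule and which, if its length is $1$, is the conclusion of an introduction rule. (2) A *maximal $=$-segment*: either (i) a segment of formulas $t=t$ such that one of them is the minor premise of $(=I^{nG})$ and the last is the premise of $(AD)$ or $(\iota E_3)$, or (ii) a segment of formulas $a=t$ such that the first is discharged by $(=I^{nG})$ and the last is the premise of $(AD)$ or $(\iota E_3)$ with conclusion $\exists!t$ (if $\exists!a$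 is concluded, this is not counted as maximal). (3) A *maximal $\exists!$-segment*: a segment that is concluded by $(AD)$ or $(\iota E_3)$ and is the major premise of an application of $(=I^{nG})$ with conclusion $t=t$. (4) A *maximal $(=E)$-segment*: an $(=E)$-segment is a sequence of segments $\sigma_1,\ldots,\sigma_n$ such that $\sigma_1$ is the minor premise but not the conclusion of $(=E)$, $\sigma_n$ is the conclusion but not the minor premise of $(=E)$, and each $\sigma_i$ with $1<i<n$ is the conclusion of $(=E)$ and the minor premise of $(=E)$ (consecutive segments being minor premise and conclusion of the same application); it is maximal if its last segment is the premise of $(AD)$ (where $(\iota E_3)$ is applied instead of $(AD)$, this makes no difference, the rule is just renamed) or if all formulas on it are formed from $\exists!$ and a term. A deduction is in *normal form* if it contains no maximal segments. *)

theory Defs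
  imports Main
begin

section \<open>Language\<close>

type_synonym var = nat
type_synonym param = nat

text \<open>
  The datatypes are those of terms and formulas possibly containing free occurrences of the
  bound variables; the terms and formulas proper are the ones satisfying \<open>is_formula\<close> below
  (no free \<open>Var\<close>, arities respected).  Parameters are the free variables of the language.
  \<open>Ext t\<close> is the existence predicate applied to \<open>t\<close>.  Negation is \<open>Imp A Bot\<close>.
\<close>

datatype ('c, 'p) trm =
    Var var
  | Par param
  | Cst 'c
  | Iota var "('c, 'p) fm"
and ('c, 'p) fm =
    Bot
  | Pred 'p "('c, 'p) trm list"
  | Eq "('c, 'p) trm" "('c, 'p) trm"
  | Ext "('c, 'p) trm"
  | Con "('c, 'p) fm" "('c, 'p) fm"
  | Dis "('c, 'p) fm" "('c, 'p) fm"
  | Imp "('c, 'p) fm" "('c, 'p) fm"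
  | All var "('c, 'p) fm"
  | Exi var "('c, 'p) fm"

primrec fvt :: "('c, 'p) trm \<Rightarrow> var set" and fvf :: "('c, 'p) fm \<Rightarrow> var set" where
  "fvt (Var x) = {x}"
| "fvt (Par a) = {}"
| "fvt (Cst c) = {}"
| "fvt (Iota x F) = fvf F - {x}"
| "fvf Bot = {}"
| "fvf (Pred R ts) = \<Union> (set (map fvt ts))"
| "fvf (Eq s t) = fvt s \<union> fvt t"
| "fvf (Ext t) = fvt t"
| "fvf (Con A B) = fvf A \<union> fvf B"
| "fvf (Dis A B) = fvf A \<union> fvf B"
| "fvf (Imp A B) = fvf A \<union> fvf B"
| "fvf (All x A) = fvf A - {x}"
| "fvf (Exi x A) = fvf A - {x}"

primrec part :: "('c, 'p) trm \<Rightarrow> param set" and parf :: "('c, 'p) fm \<Rightarrow> param set" where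
  "part (Var x) = {}"
| "part (Par a) = {a}"
| "part (Cst c) = {}"
| "part (Iota x F) = parf F"
| "parf Bot = {}"
| "parf (Pred R ts) = \<Union> (set (map part ts))"
| "parf (Eq s t) = part s \<union> part t"
| "parf (Ext t) = part t"
| "parf (Con A B) = parf A \<union> parf B"
| "parf (Dis A B) = parf A \<union> parf B"
| "parf (Imp A B) = parf A \<union> parf B"
| "parf (All x A) = parf A"
| "parf (Exi x A) = parf A"

text \<open>
  \<open>substf x t A\<close> is \<open>A\<close> with \<open>t\<close> replacing all free occurrences of \<open>x\<close>.  There is no renaming of
  bound variables: the substituted terms have no free \<open>Var\<close>, so nothing can be captured.
\<close>

primrec substt :: "var \<Rightarrow> ('c, 'p) trm \<Rightarrow> ('c, 'p) trm \<Rightarrow> ('c, 'p) trm"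
  and substf :: "var \<Rightarrow> ('c, 'p) trm \<Rightarrow> ('c, 'p) fm \<Rightarrow> ('c, 'p) fm" where
  "substt x t (Var y) = (if y = x then t else Var y)"
| "substt x t (Par a) = Par a"
| "substt x t (Cst c) = Cst c"
| "substt x t (Iota y F) = Iota y (if y = x then F else substf x t F)"
| "substf x t Bot = Bot"
| "substf x t (Pred R ts) = Pred R (map (substt x t) ts)"
| "substf x t (Eq s u) = Eq (substt x t s) (substt x t u)"
| "substf x t (Ext s) = Ext (substt x t s)"
| "substf x t (Con A B) = Con (substf x t A) (substf x t B)"
| "substf x t (Dis A B) = Dis (substf x t A) (substf x t B)"
| "substf x t (Imp A B) = Imp (substf x t A) (substf x t B)"
| "substf x t (All y A) = All y (if y = x then A else substf x t A)"
| "substf x t (Exi y A) = Exi y (if y = x then A else substf x t A)"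

primrec arityt :: "('p \<Rightarrow> nat) \<Rightarrow> ('c, 'p) trm \<Rightarrow> bool"
  and arityf :: "('p \<Rightarrow> nat) \<Rightarrow> ('c, 'p) fm \<Rightarrow> bool" where
  "arityt ar (Var x) = True"
| "arityt ar (Par a) = True"
| "arityt ar (Cst c) = True"
| "arityt ar (Iota x F) = arityf ar F"
| "arityf ar Bot = True"
| "arityf ar (Pred R ts) = (length ts = ar R \<and> list_all id (map (arityt ar) ts))"
| "arityf ar (Eq s t) = (arityt ar s \<and> arityt ar t)"
| "arityf ar (Ext t) = arityt ar t"
| "arityf ar (Con A B) = (arityf ar A \<and> arityf ar B)"
| "arityf ar (Dis A B) = (arityf ar A \<and> arityf ar B)"
| "arityf ar (Imp A B) = (arityf ar A \<and> arityf ar B)"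
| "arityf ar (All x A) = arityf ar A"
| "arityf ar (Exi x A) = arityf ar A"

definition is_formula :: "('p \<Rightarrow> nat) \<Rightarrow> ('c, 'p) fm \<Rightarrow> bool" where
  "is_formula ar A \<longleftrightarrow> arityf ar A \<and> fvf A = {}"

definition atomic_trm :: "('c, 'p) trm \<Rightarrow> bool" where
  "atomic_trm t \<longleftrightarrow> (\<exists>a. t = Par a) \<or> (\<exists>c. t = Cst c)"

fun atomic_fm :: "('c, 'p) fm \<Rightarrow> bool" where
  "atomic_fm (Pred R ts) = True"
| "atomic_fm (Eq s t) = True"
| "atomic_fm (Ext t) = True"
| "atomic_fm _ = False"

fun prime_fm :: "('c, 'p) fm \<Rightarrow> bool" where
  "prime_fm (Pred R ts) = (\<forall>t\<in>set ts. atomic_trm t)"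
| "prime_fm (Eq s t) = (atomic_trm s \<and> atomic_trm t)"
| "prime_fm (Ext t) = atomic_trm t"
| "prime_fm _ = False"


section \<open>Deductions\<close>

text \<open>
  An assumption class is a pair of a label and a formula: it consists of the leaves carrying that
  label and that formula.  An inference records, for each premise, the classes it discharges in
  the deduction of that premise.  A leaf is discharged by the nearest inference below it that
  discharges its class in the premise above which the leaf lies, and is open if there is none.
\<close>

type_synonym ('c, 'p) assm = "nat \<times> ('c, 'p) fm"

text \<open>The rules with a restriction on a parameter carry that parameter.\<close>

datatype rl =
    ConI | ConE | ImpI | ImpE | DisI | DisE | BotE
  | AllI param | AllE | ExiI | ExiE param
  | EqI param | EqE | AD
  | IotaI param | IotaE1 | IotaE2 | IotaE3

datatype ('c, 'p) ded =
    Assm "('c, 'p) assm"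
  | Infer rl "('c, 'p) fm" "(('c, 'p) assm list \<times> ('c, 'p) ded) list"

fun concl :: "('c, 'p) ded \<Rightarrow> ('c, 'p) fm" where
  "concl (Assm l) = snd l"
| "concl (Infer r C Ds) = C"

text \<open>
  Formula occurrences in a deduction are addressed by paths from the root: \<open>[]\<close> is the end
  formula and \<open>p @ [i]\<close> is the \<open>i\<close>-th premise, counted from the left starting with \<open>0\<close>, of the
  inference with conclusion \<open>p\<close>.
\<close>

type_synonym pos = "nat list"

fun subded :: "('c, 'p) ded \<Rightarrow> pos \<Rightarrow> ('c, 'p) ded option" where
  "subded D [] = Some D"
| "subded (Assm l) (i # p) = None"
| "subded (Infer r C Ds) (i # p) = (if i < length Ds then subded (snd (Ds ! i)) p else None)"

fun open_at :: "('c, 'p) ded \<Rightarrow> pos \<Rightarrow> ('c, 'p) assm \<Rightarrow> bool" where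
  "open_at (Assm l) [] m \<longleftrightarrow> l = m"
| "open_at (Infer r C Ds) (i # p) m \<longleftrightarrow>
     i < length Ds \<and> m \<notin> set (fst (Ds ! i)) \<and> open_at (snd (Ds ! i)) p m"
| "open_at _ _ m \<longleftrightarrow> False"

definition open_assms :: "('c, 'p) ded \<Rightarrow> ('c, 'p) assm set" where
  "open_assms D = {m. \<exists>p. open_at D p m}"

definition fresh :: "param \<Rightarrow> ('c, 'p) assm set \<Rightarrow> bool" where
  "fresh a \<Gamma> \<longleftrightarrow> (\<forall>(n, B)\<in>\<Gamma>. a \<notin> parf B)"

text \<open>
  \<open>inference r Ps C\<close>: the formula \<open>C\<close> follows by the rule \<open>r\<close>.  Each premise is a triple
  \<open>(\<Delta>, \<Gamma>, B)\<close> of the classes \<open>\<Delta>\<close> discharged in the deduction of \<open>B\<close>, the assumptions \<open>\<Gamma>\<close> of that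
  deduction which remain undischarged, and the formula \<open>B\<close> itself.
\<close>

inductive inference ::
  "rl \<Rightarrow> (('c, 'p) assm list \<times> ('c, 'p) assm set \<times> ('c, 'p) fm) list \<Rightarrow> ('c, 'p) fm \<Rightarrow> bool" where
  ConI: "inference ConI [([], \<Gamma>\<^sub>1, A), ([], \<Gamma>\<^sub>2, B)] (Con A B)"
| ConE1: "inference ConE [([], \<Gamma>, Con A B)] A"
| ConE2: "inference ConE [([], \<Gamma>, Con A B)] B"
| ImpI: "inference ImpI [([(n, A)], \<Gamma>, B)] (Imp A B)"
| ImpE: "inference ImpE [([], \<Gamma>\<^sub>1, Imp A B), ([], \<Gamma>\<^sub>2, A)] B"
| DisI1: "inference DisI [([], \<Gamma>, A)] (Dis A B)"
| DisI2: "inference DisI [([], \<Gamma>, B)] (Dis A B)"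
| DisE: "inference DisE [([], \<Gamma>\<^sub>1, Dis A B), ([(m, A)], \<Gamma>\<^sub>2, C), ([(n, B)], \<Gamma>\<^sub>3, C)] C"
| BotE: "inference BotE [([], \<Gamma>, Bot)] B"
| AllI: "a \<notin> parf (All x A) \<Longrightarrow> fresh a \<Gamma> \<Longrightarrow>
    inference (AllI a) [([(n, Ext (Par a))], \<Gamma>, substf x (Par a) A)] (All x A)"
| AllE: "atomic_trm t \<Longrightarrow>
    inference AllE [([], \<Gamma>\<^sub>1, All x A), ([], \<Gamma>\<^sub>2, Ext t)] (substf x t A)"
| ExiI: "atomic_trm t \<Longrightarrow>
    inference ExiI [([], \<Gamma>\<^sub>1, substf x t A), ([], \<Gamma>\<^sub>2, Ext t)] (Exi x A)"
| ExiE: "a \<notin> parf C \<Longrightarrow> a \<notin> parf (Exi x A) \<Longrightarrow> fresh a \<Gamma>\<^sub>2 \<Longrightarrow>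
    inference (ExiE a)
      [([], \<Gamma>\<^sub>1, Exi x A), ([(m, substf x (Par a) A), (n, Ext (Par a))], \<Gamma>\<^sub>2, C)] C"
| EqI: "a \<notin> part t \<Longrightarrow> a \<notin> parf C \<Longrightarrow> fresh a \<Gamma>\<^sub>2 \<Longrightarrow>
    inference (EqI a) [([], \<Gamma>\<^sub>1, Ext t), ([(n, Eq (Par a) t)], \<Gamma>\<^sub>2, C)] C"
| EqE: "inference EqE
      [([], \<Gamma>\<^sub>1, Eq t\<^sub>1 t\<^sub>2), ([], \<Gamma>\<^sub>2, substf x t\<^sub>1 A)] (substf x t\<^sub>2 A)"
| AD_Pred: "t \<in> set ts \<Longrightarrow> inference AD [([], \<Gamma>, Pred R ts)] (Ext t)"
| AD_Eq1: "inference AD [([], \<Gamma>, Eq t\<^sub>1 t\<^sub>2)] (Ext t\<^sub>1)"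
| AD_Eq2: "inference AD [([], \<Gamma>, Eq t\<^sub>1 t\<^sub>2)] (Ext t\<^sub>2)"
| IotaI: "atomic_trm t \<Longrightarrow> a \<notin> part (Iota x F) \<Longrightarrow> a \<notin> part t \<Longrightarrow> fresh a (\<Gamma>\<^sub>2 \<union> \<Gamma>\<^sub>3) \<Longrightarrow>
    inference (IotaI a)
      [([], \<Gamma>\<^sub>1, Ext t),
       ([(k, Eq (Par a) t)], \<Gamma>\<^sub>2, substf x (Par a) F),
       ([(m, substf x (Par a) F), (n, Ext (Par a))], \<Gamma>\<^sub>3, Eq (Par a) t)]
      (Eq (Iota x F) t)"
| IotaE1: "atomic_trm t \<Longrightarrow> atomic_trm u \<Longrightarrow>
    inference IotaE1 [([], \<Gamma>\<^sub>1, Eq (Iota x F) t), ([], \<Gamma>\<^sub>2, Eq u t)] (substf x u F)"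
| IotaE2: "atomic_trm t \<Longrightarrow> atomic_trm u \<Longrightarrow>
    inference IotaE2
      [([], \<Gamma>\<^sub>1, Eq (Iota x F) t), ([], \<Gamma>\<^sub>2, substf x u F), ([], \<Gamma>\<^sub>3, Ext u)] (Eq u t)"
| IotaE3: "inference IotaE3 [([], \<Gamma>, Eq (Iota x F) t)] (Ext t)"

inductive by_rules :: "('p \<Rightarrow> nat) \<Rightarrow> ('c, 'p) ded \<Rightarrow> bool" for ar where
  "is_formula ar B \<Longrightarrow> by_rules ar (Assm (n, B))"
| "is_formula ar C \<Longrightarrow> \<forall>(\<Delta>, E)\<in>set Ds. by_rules ar E \<Longrightarrow>
    inference r (map (\<lambda>(\<Delta>, E). (\<Delta>, open_assms E - set \<Delta>, concl E)) Ds) C \<Longrightarrow>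
    by_rules ar (Infer r C Ds)"

fun eigen :: "rl \<Rightarrow> param option" where
  "eigen (AllI a) = Some a"
| "eigen (ExiE a) = Some a"
| "eigen (EqI a) = Some a"
| "eigen (IotaI a) = Some a"
| "eigen _ = None"

text \<open>
  The parameter of an inference may occur only in the deductions of those premises in which the
  rule mentions it, which are exactly the premises with discharged classes, and it is the
  parameter of no other inference.
\<close>

definition pure_parameters :: "('c, 'p) ded \<Rightarrow> bool" where
  "pure_parameters D \<longleftrightarrow>
     (\<forall>p r C Ds a. subded D p = Some (Infer r C Ds) \<longrightarrow> eigen r = Some a \<longrightarrow>
        (\<forall>q E. subded D q = Some E \<longrightarrow> a \<in> parf (concl E) \<longrightarrow>
           (\<exists>i q'. q = p @ i # q' \<and> fst (Ds ! i) \<noteq> [])) \<and>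
        (\<forall>q r' C' Ds'. subded D q = Some (Infer r' C' Ds') \<longrightarrow> eigen r' = Some a \<longrightarrow> q = p))"

definition standing_conventions :: "('c, 'p) ded \<Rightarrow> bool" where
  "standing_conventions D \<longleftrightarrow>
     (\<forall>p C Ds. subded D p = Some (Infer EqE C Ds) \<longrightarrow>
        atomic_fm C \<and> (\<nexists>t. concl (snd (Ds ! 0)) = Eq t t)) \<and>
     (\<forall>p C Ds. subded D p = Some (Infer BotE C Ds) \<longrightarrow> prime_fm C) \<and>
     pure_parameters D"

text \<open>\<open>deduction ar D \<Gamma> A\<close>: \<open>D\<close> is a deduction of \<open>A\<close> all of whose open assumptions are in \<open>\<Gamma>\<close>.\<close>

definition deduction :: "('p \<Rightarrow> nat) \<Rightarrow> ('c, 'p) ded \<Rightarrow> ('c, 'p) fm set \<Rightarrow> ('c, 'p) fm \<Rightarrow> bool" where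
  "deduction ar D \<Gamma> A \<longleftrightarrow>
     by_rules ar D \<and> standing_conventions D \<and> concl D = A \<and> snd ` open_assms D \<subseteq> \<Gamma>"


section \<open>Segments and normal form\<close>

definition is_pos :: "('c, 'p) ded \<Rightarrow> pos \<Rightarrow> bool" where
  "is_pos D p \<longleftrightarrow> subded D p \<noteq> None"

definition fm_at :: "('c, 'p) ded \<Rightarrow> pos \<Rightarrow> ('c, 'p) fm" where
  "fm_at D p = concl (the (subded D p))"

definition concl_of :: "('c, 'p) ded \<Rightarrow> pos \<Rightarrow> rl \<Rightarrow> bool" where
  "concl_of D p r \<longleftrightarrow> (\<exists>C Ds. subded D p = Some (Infer r C Ds))"

text \<open>\<open>premise_of D p i q r\<close>: \<open>p\<close> is the \<open>i\<close>-th premise of the application of \<open>r\<close> concluding \<open>q\<close>.\<close>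

definition premise_of :: "('c, 'p) ded \<Rightarrow> pos \<Rightarrow> nat \<Rightarrow> pos \<Rightarrow> rl \<Rightarrow> bool" where
  "premise_of D p i q r \<longleftrightarrow> is_pos D p \<and> p = q @ [i] \<and> concl_of D q r"

definition discharged_by :: "('c, 'p) ded \<Rightarrow> pos \<Rightarrow> rl \<Rightarrow> bool" where
  "discharged_by D p r \<longleftrightarrow>
     (\<exists>q C Ds i p' l. subded D q = Some (Infer r C Ds) \<and> p = q @ i # p' \<and> i < length Ds \<and>
        l \<in> set (fst (Ds ! i)) \<and> open_at (snd (Ds ! i)) p' l)"

fun intro_rl :: "rl \<Rightarrow> bool" where
  "intro_rl ConI = True" | "intro_rl ImpI = True" | "intro_rl DisI = True"
| "intro_rl (AllI a) = True" | "intro_rl ExiI = True" | "intro_rl (EqI a) = True"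
| "intro_rl (IotaI a) = True" | "intro_rl _ = False"

fun elim_rl :: "rl \<Rightarrow> bool" where
  "elim_rl ConE = True" | "elim_rl ImpE = True" | "elim_rl DisE = True" | "elim_rl BotE = True"
| "elim_rl AllE = True" | "elim_rl (ExiE a) = True" | "elim_rl EqE = True"
| "elim_rl IotaE1 = True" | "elim_rl IotaE2 = True" | "elim_rl IotaE3 = True"
| "elim_rl _ = False"

fun segment_rl :: "rl \<Rightarrow> bool" where
  "segment_rl DisE = True" | "segment_rl (ExiE a) = True" | "segment_rl (EqI a) = True"
| "segment_rl _ = False"

definition segment :: "('c, 'p) ded \<Rightarrow> pos list \<Rightarrow> bool" where
  "segment D ps \<longleftrightarrow> ps \<noteq> [] \<and> (\<forall>p\<in>set ps. is_pos D p) \<and>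
     (\<nexists>r. segment_rl r \<and> concl_of D (hd ps) r) \<and>
     (\<nexists>r i q. segment_rl r \<and> i > 0 \<and> premise_of D (last ps) i q r) \<and>
     (\<forall>k. Suc k < length ps \<longrightarrow>
        (\<exists>r i. segment_rl r \<and> i > 0 \<and> premise_of D (ps ! k) i (ps ! Suc k) r))"

text \<open>
  The second disjunct: a step from the conclusion of \<open>IotaI\<close> to the existence of its right-hand
  term counts as an application of \<open>IotaE3\<close>, even if it is labelled \<open>AD\<close>.
\<close>

definition maximal_intro_elim_segment :: "('c, 'p) ded \<Rightarrow> pos list \<Rightarrow> bool" where
  "maximal_intro_elim_segment D ps \<longleftrightarrow> segment D ps \<and>
     (\<exists>q r. premise_of D (last ps) 0 q r \<and>
        (elim_rl r \<or>
         r = AD \<and> (\<exists>a. concl_of D (hd ps) (IotaI a)) \<and>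
           (\<exists>x F t. fm_at D (last ps) = Eq (Iota x F) t \<and> fm_at D q = Ext t))) \<and>
     (length ps = 1 \<longrightarrow> (\<exists>r. intro_rl r \<and> concl_of D (hd ps) r))"

definition maximal_eq_segment :: "('c, 'p) ded \<Rightarrow> pos list \<Rightarrow> bool" where
  "maximal_eq_segment D ps \<longleftrightarrow> segment D ps \<and>
     (\<exists>q r. premise_of D (last ps) 0 q r \<and> r \<in> {AD, IotaE3} \<and>
        ((\<exists>t. (\<forall>p\<in>set ps. fm_at D p = Eq t t) \<and>
              (\<exists>p\<in>set ps. \<exists>q' a. premise_of D p 1 q' (EqI a))) \<or>
         (\<exists>a t. (\<forall>p\<in>set ps. fm_at D p = Eq (Par a) t) \<and>
              (\<exists>b. discharged_by D (hd ps) (EqI b)) \<and> fm_at D q = Ext t)))"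

definition maximal_ext_segment :: "('c, 'p) ded \<Rightarrow> pos list \<Rightarrow> bool" where
  "maximal_ext_segment D ps \<longleftrightarrow> segment D ps \<and>
     (concl_of D (hd ps) AD \<or> concl_of D (hd ps) IotaE3) \<and>
     (\<exists>q a t. premise_of D (last ps) 0 q (EqI a) \<and>
        fm_at D (last ps) = Ext t \<and> fm_at D q = Eq t t)"

definition eqE_segment :: "('c, 'p) ded \<Rightarrow> pos list list \<Rightarrow> bool" where
  "eqE_segment D \<sigma>s \<longleftrightarrow> \<sigma>s \<noteq> [] \<and> (\<forall>\<sigma>\<in>set \<sigma>s. segment D \<sigma>) \<and>
     (\<exists>q. premise_of D (last (hd \<sigma>s)) 1 q EqE) \<and> \<not> concl_of D (hd (hd \<sigma>s)) EqE \<and>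
     concl_of D (hd (last \<sigma>s)) EqE \<and> (\<nexists>q. premise_of D (last (last \<sigma>s)) 1 q EqE) \<and>
     (\<forall>k. Suc k < length \<sigma>s \<longrightarrow>
        premise_of D (last (\<sigma>s ! k)) 1 (hd (\<sigma>s ! Suc k)) EqE)"

definition maximal_eqE_segment :: "('c, 'p) ded \<Rightarrow> pos list list \<Rightarrow> bool" where
  "maximal_eqE_segment D \<sigma>s \<longleftrightarrow> eqE_segment D \<sigma>s \<and>
     ((\<exists>q r. premise_of D (last (last \<sigma>s)) 0 q r \<and> r \<in> {AD, IotaE3}) \<or>
      (\<forall>\<sigma>\<in>set \<sigma>s. \<forall>p\<in>set \<sigma>. \<exists>t. fm_at D p = Ext t))"

definition normal :: "('c, 'p) ded \<Rightarrow> bool" where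
  "normal D \<longleftrightarrow>
     (\<nexists>ps. maximal_intro_elim_segment D ps) \<and> (\<nexists>ps. maximal_eq_segment D ps) \<and>
     (\<nexists>ps. maximal_ext_segment D ps) \<and> (\<nexists>\<sigma>s. maximal_eqE_segment D \<sigma>s)"

end

theory Submission
  imports Defs
begin

text \<open>
  Normalisation by evaluation.  A world is a pair of a finite set of parameters and a context, and a
  formula is interpreted at worlds by Kripke-style clauses, with disjunction, existence and
  atomic formulas closed under covers, i.e. under case distinctions by \<open>DisE\<close>, \<open>ExiE\<close> and \<open>EqI\<close>
  over neutral or normal premises.  All rules are sound for this interpretation.  By a
  simultaneous induction on formulas and terms, formulas with a neutral deduction are true (reflection)
  and true formulas have a normal deduction (reification); applied to the open
  assumptions and to the conclusion of the given deduction, this yields the normal one.  Normality is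
  guaranteed by conditions on single inferences: \<open>IotaE3\<close> is avoided, \<open>EqE\<close> is not applied to formulas
  \<open>\<exists>!t\<close>, and \<open>AD\<close> is not applied to conclusions of \<open>EqE\<close>.  For instance, \<open>\<exists>!\<iota>xF(t)\<close>
  follows from \<open>\<exists>!\<iota>xF(s)\<close> and \<open>s = t\<close> by rebuilding \<open>\<iota>xF(t) = a\<close> with \<open>IotaI\<close>.
\<close>

section \<open>Subdeductions\<close>

text \<open>Only the existence of a normal deduction is claimed, so no reductions are performed and
  no measure has to decrease under several interacting kinds of them. Individuals of the
  interpretation are atomic terms, since \<open>AllE\<close>, \<open>ExiI\<close>,
  \<open>IotaE1\<close> and \<open>IotaE2\<close> accept no others. A complex term \<open>t\<close>
  takes part only through a name, a fresh parameter \<open>a\<close> with the assumption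
  \<open>a = t\<close> of an \<open>EqI\<close>. From it \<open>AD\<close> may conclude that
  \<open>a\<close> exists, but not that \<open>t\<close> does, and \<open>AD\<close> may not follow
  \<open>EqE\<close>. Yet reflection for predicates and identities begins with \<open>AD\<close>, to
  learn that the terms exist. This forces two grades of neutral deductions: reflection starts from
  \<open>strong\<close> ones, while merely neutral ones serve as major premises. The second obstacle
  is reflexivity: symmetry and reading back of identities need \<open>t = t\<close>, and its direct
  derivation by \<open>EqI\<close> from the existence of \<open>t\<close> is what a maximal
  existence segment forbids. It is recovered by a detour before covers are introduced, since pasting
  a cover together needs it too.\<close>

definition subs :: "('c, 'p) ded \<Rightarrow> ('c, 'p) ded set" where
  "subs D = {E. \<exists>p. subded D p = Some E}"

lemma subs_Assm [simp]: "subs (Assm l) = {Assm l}"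
proof -
  have "subded (Assm l) p = Some E \<longleftrightarrow> p = [] \<and> E = Assm l" for p E
    by (cases p) auto
  then show ?thesis
    by (auto simp: subs_def)
qed

lemma subs_Infer [simp]: "subs (Infer r C Ds) = insert (Infer r C Ds) (\<Union>x\<in>set Ds. subs (snd x))"
proof (intro set_eqI iffI)
  fix E assume "E \<in> subs (Infer r C Ds)"
  then obtain p where p: "subded (Infer r C Ds) p = Some E"
    by (auto simp: subs_def)
  show "E \<in> insert (Infer r C Ds) (\<Union>x\<in>set Ds. subs (snd x))"
  proof (cases p)
    case Nil
    then show ?thesis using p by simp
  next
    case (Cons i q)
    then have "i < length Ds" "subded (snd (Ds ! i)) q = Some E"
      using p by (auto split: if_splits)
    then have "Ds ! i \<in> set Ds" "E \<in> subs (snd (Ds ! i))"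
      by (auto simp: subs_def)
    then show ?thesis by blast
  qed
next
  fix E assume "E \<in> insert (Infer r C Ds) (\<Union>x\<in>set Ds. subs (snd x))"
  then consider "E = Infer r C Ds" | x where "x \<in> set Ds" "E \<in> subs (snd x)"
    by auto
  then show "E \<in> subs (Infer r C Ds)"
  proof cases
    case 1
    then show ?thesis
      unfolding subs_def by (auto intro: exI[of _ "[]"])
  next
    case 2
    then obtain i p where "i < length Ds" "Ds ! i = x" "subded (snd x) p = Some E"
      by (auto simp: subs_def in_set_conv_nth)
    then have "subded (Infer r C Ds) (i # p) = Some E"
      by simp
    then show ?thesis
      unfolding subs_def by blast
  qed
qed

lemma subs_self [simp]: "D \<in> subs D"
  by (cases D) auto

lemma finite_subs [simp]: "finite (subs D)"
proof (induction D)
  case (Infer r C Ds)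
  have "finite (subs (snd x))" if "x \<in> set Ds" for x
    using Infer that by (cases x) (force simp: snds.simps)
  then show ?case by simp
qed simp

definition eigs :: "('c, 'p) ded \<Rightarrow> param set" where
  "eigs D = {a. \<exists>r C Ds. Infer r C Ds \<in> subs D \<and> eigen r = Some a}"

definition pars :: "('c, 'p) ded \<Rightarrow> param set" where
  "pars D = (\<Union>E\<in>subs D. parf (concl E))"

lemma eigs_Assm [simp]: "eigs (Assm l) = {}"
  by (simp add: eigs_def)

lemma eigs_Infer [simp]:
  "eigs (Infer r C Ds) = set_option (eigen r) \<union> (\<Union>x\<in>set Ds. eigs (snd x))"
  by (auto simp: eigs_def)

lemma pars_Assm [simp]: "pars (Assm l) = parf (snd l)"
  by (simp add: pars_def)

lemma pars_Infer [simp]: "pars (Infer r C Ds) = parf C \<union> (\<Union>x\<in>set Ds. pars (snd x))"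
  by (auto simp: pars_def)

lemma parf_concl_pars: "parf (concl D) \<subseteq> pars D"
  using subs_self unfolding pars_def by blast

lemma finite_eigs [simp]: "finite (eigs D)"
proof -
  let ?e = "\<lambda>D. case D of Assm l \<Rightarrow> {} | Infer r C Ds \<Rightarrow> set_option (eigen r)"
  have "eigs D \<subseteq> (\<Union>E\<in>subs D. ?e E)"
    by (force simp: eigs_def split: ded.split)
  moreover have "finite (\<Union>E\<in>subs D. ?e E)"
    by (auto split: ded.split)
  ultimately show ?thesis
    by (rule finite_subset)
qed

lemma open_assms_Assm [simp]: "open_assms (Assm l) = {l}"
proof -
  have "open_at (Assm l) p m \<longleftrightarrow> p = [] \<and> l = m" for p m
    by (cases p) auto
  then show ?thesis
    by (auto simp: open_assms_def)
qed

lemma open_assms_Infer [simp]: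
  "open_assms (Infer r C Ds) = (\<Union>x\<in>set Ds. open_assms (snd x) - set (fst x))"
proof (intro set_eqI iffI)
  fix m assume "m \<in> open_assms (Infer r C Ds)"
  then obtain p where p: "open_at (Infer r C Ds) p m"
    by (auto simp: open_assms_def)
  then obtain i q where "p = i # q"
    by (cases p) auto
  then have "i < length Ds" "m \<in> open_assms (snd (Ds ! i)) - set (fst (Ds ! i))"
    using p by (auto simp: open_assms_def)
  then show "m \<in> (\<Union>x\<in>set Ds. open_assms (snd x) - set (fst x))"
    using nth_mem by blast
next
  fix m assume "m \<in> (\<Union>x\<in>set Ds. open_assms (snd x) - set (fst x))"
  then obtain i q where "i < length Ds" "m \<notin> set (fst (Ds ! i))" "open_at (snd (Ds ! i)) q m"
    by (auto simp: open_assms_def in_set_conv_nth)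
  then have "open_at (Infer r C Ds) (i # q) m"
    by simp
  then show "m \<in> open_assms (Infer r C Ds)"
    unfolding open_assms_def by blast
qed

lemma finite_open_assms: "finite (open_assms D)"
proof (induction D)
  case (Infer r C Ds)
  have "finite (open_assms (snd x))" if "x \<in> set Ds" for x
    using Infer that by (cases x) (force simp: snds.simps)
  then show ?case by simp
qed simp

lemma subded_subs: "subded D p = Some E \<Longrightarrow> E \<in> subs D"
  by (auto simp: subs_def)

lemma subded_append:
  "subded D (p @ q) = (case subded D p of None \<Rightarrow> None | Some E \<Rightarrow> subded E q)"
  by (induction D p rule: subded.induct) auto

lemma pure_parameters_Assm: "pure_parameters (Assm l)"
proof -
  have "subded (Assm l) p = Some E \<Longrightarrow> E = Assm l" for p and E :: "('a, 'b) ded"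
    by (cases p) auto
  then show ?thesis
    unfolding pure_parameters_def by blast
qed

text \<open>Purity speaks about positions in the whole deduction. It is inherited from the premises
  because no eigenparameter of one premise occurs, in any role, in another premise or in the
  conclusion. The last hypothesis concerns only premises without discharged classes, as these are
  the ones from which the rule bars its own parameter.\<close>

lemma pure_parameters_Infer:
  assumes pure: "\<And>i. i < length Ds \<Longrightarrow> pure_parameters (snd (Ds ! i))"
    and pars: "\<And>i j. i < length Ds \<Longrightarrow> j < length Ds \<Longrightarrow> i \<noteq> j \<Longrightarrow>
      eigs (snd (Ds ! i)) \<inter> (eigs (snd (Ds ! j)) \<union> pars (snd (Ds ! j))) = {}"
    and C: "\<And>i. i < length Ds \<Longrightarrow> eigs (snd (Ds ! i)) \<inter> parf C = {}"
    and a: "\<And>a. eigen r = Some a \<Longrightarrow> a \<notin> parf C"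
      "\<And>a i. eigen r = Some a \<Longrightarrow> i < length Ds \<Longrightarrow> a \<notin> eigs (snd (Ds ! i))"
      "\<And>a i. eigen r = Some a \<Longrightarrow> i < length Ds \<Longrightarrow> fst (Ds ! i) = [] \<Longrightarrow> a \<notin> pars (snd (Ds ! i))"
  shows "pure_parameters (Infer r C Ds)"
  unfolding pure_parameters_def
proof (intro allI impI)
  fix p s B Es b
  assume p: "subded (Infer r C Ds) p = Some (Infer s B Es)" and b: "eigen s = Some b"
  show "(\<forall>q E. subded (Infer r C Ds) q = Some E \<longrightarrow> b \<in> parf (concl E) \<longrightarrow>
           (\<exists>i q'. q = p @ i # q' \<and> fst (Es ! i) \<noteq> [])) \<and>
        (\<forall>q r' C' Ds'. subded (Infer r C Ds) q = Some (Infer r' C' Ds') \<longrightarrow>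
           eigen r' = Some b \<longrightarrow> q = p)"
  proof (cases p)
    case Nil
    then have [simp]: "s = r" "B = C" "Es = Ds"
      using p by auto
    show ?thesis
    proof (intro conjI allI impI)
      fix q E assume q: "subded (Infer r C Ds) q = Some E" "b \<in> parf (concl E)"
      then obtain i q' where iq: "q = i # q'" "i < length Ds" "subded (snd (Ds ! i)) q' = Some E"
        using a(1) b by (cases q) (auto split: if_splits)
      then have "b \<in> pars (snd (Ds ! i))"
        using q(2) by (auto simp: pars_def dest: subded_subs)
      then show "\<exists>i q'. q = p @ i # q' \<and> fst (Es ! i) \<noteq> []"
        using a(3) b iq Nil by auto
    next
      fix q r' C' Ds' assume q: "subded (Infer r C Ds) q = Some (Infer r' C' Ds')" "eigen r' = Some b"
      show "q = p"
      proof (cases q)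
        case (Cons i q')
        then have "i < length Ds" "b \<in> eigs (snd (Ds ! i))"
          using q by (auto simp: eigs_def split: if_splits dest: subded_subs)
        then show ?thesis using a(2) b by auto
      qed (use Nil in simp)
    qed
  next
    case (Cons i p')
    then have i: "i < length Ds" and p': "subded (snd (Ds ! i)) p' = Some (Infer s B Es)"
      using p by (auto split: if_splits)
    have bi: "b \<in> eigs (snd (Ds ! i))"
      using b p' by (auto simp: eigs_def dest: subded_subs)
    have P: "subded (snd (Ds ! i)) q = Some E \<Longrightarrow> b \<in> parf (concl E) \<Longrightarrow>
           (\<exists>i q'. q = p' @ i # q' \<and> fst (Es ! i) \<noteq> [])"
      and Q: "subded (snd (Ds ! i)) q = Some (Infer r' C' Ds') \<Longrightarrow> eigen r' = Some b \<Longrightarrow> q = p'"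
      for q E r' C' Ds'
      using pure[OF i] p' b unfolding pure_parameters_def by metis+
    show ?thesis
    proof (intro conjI allI impI)
      fix q E assume q: "subded (Infer r C Ds) q = Some E" "b \<in> parf (concl E)"
      then obtain j q' where jq: "q = j # q'" "j < length Ds" "subded (snd (Ds ! j)) q' = Some E"
        using C[OF i] bi by (cases q) (auto split: if_splits)
      then have "b \<in> pars (snd (Ds ! j))"
        using q(2) by (auto simp: pars_def dest: subded_subs)
      then have "j = i"
        using pars[OF i jq(2)] bi by blast
      then show "\<exists>i q'. q = p @ i # q' \<and> fst (Es ! i) \<noteq> []"
        using P[of q' E] jq q(2) Cons by auto
    next
      fix q r' C' Ds' assume q: "subded (Infer r C Ds) q = Some (Infer r' C' Ds')" "eigen r' = Some b"
      show "q = p"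
      proof (cases q)
        case Nil
        then show ?thesis using q a(2) i bi by auto
      next
        case (Cons j q')
        then have jq: "j < length Ds" "subded (snd (Ds ! j)) q' = Some (Infer r' C' Ds')"
          using q by (auto split: if_splits)
        then have "b \<in> eigs (snd (Ds ! j))"
          using q by (auto simp: eigs_def dest: subded_subs)
        then have "j = i"
          using pars[OF i jq(1)] bi by blast
        then show ?thesis
          using Q jq q Cons \<open>p = i # p'\<close> by auto
      qed
    qed
  qed
qed

section \<open>Local conditions for normality\<close>

text \<open>
  A neutral deduction is a segment of length 1 that is not introduced, hence a harmless major
  premise.  The label of an assumption records whether it is to be discharged by \<open>EqI\<close> (label 1);
  strong deductions are the neutral ones to which \<open>AD\<close> may be applied without restriction.
\<close>

fun root :: "('c, 'p) ded \<Rightarrow> rl option" where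
  "root (Assm l) = None"
| "root (Infer r C Ds) = Some r"

definition neutral :: "('c, 'p) ded \<Rightarrow> bool" where
  "neutral D \<longleftrightarrow> (\<forall>r. root D = Some r \<longrightarrow> \<not> intro_rl r \<and> \<not> segment_rl r)"

definition strong :: "('c, 'p) ded \<Rightarrow> bool" where
  "strong D \<longleftrightarrow> neutral D \<and> root D \<noteq> Some EqE \<and> (\<forall>l. D = Assm l \<longrightarrow> fst l = 0)"

text \<open>The second case is the exception in the definition of maximal identity segments: from a
  discharged \<open>a = t\<close> the existence of \<open>a\<close> itself may be inferred. The
  third is the step from \<open>IotaI\<close> to the existence of the description, which counts as
  \<open>AD\<close>; the inequality separates it from the step to the existence of \<open>t\<close>,
  which counts as \<open>IotaE3\<close>.\<close>

definition ad_ok :: "('c, 'p) fm \<Rightarrow> ('c, 'p) ded \<Rightarrow> bool" where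
  "ad_ok C D \<longleftrightarrow> strong D \<or>
     (\<exists>a t. D = Assm (1, Eq (Par a) t) \<and> t \<noteq> Par a \<and> C = Ext (Par a)) \<or>
     (\<exists>a x F t Ds. D = Infer (IotaI a) (Eq (Iota x F) t) Ds \<and> t \<noteq> Iota x F \<and> C = Ext (Iota x F))"

text \<open>Stronger than normality: \<open>EqI\<close> never concludes \<open>t = t\<close> from
  the existence of \<open>t\<close>, however that was derived, and \<open>EqE\<close> never
  concludes an existence formula. The label clause fixes that exactly \<open>EqI\<close> discharges
  label 1. \<open>AD\<close> can do the work of \<open>IotaE3\<close>, so the latter is
  banned.\<close>

definition step_ok :: "rl \<Rightarrow> ('c, 'p) fm \<Rightarrow> (('c, 'p) assm list \<times> ('c, 'p) ded) list \<Rightarrow> bool" where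
  "step_ok r C Ds \<longleftrightarrow>
     (elim_rl r \<longrightarrow> neutral (snd (Ds ! 0))) \<and>
     (r = EqE \<longrightarrow> ((\<exists>s t. C = Eq s t) \<or> (\<exists>R ts. C = Pred R ts)) \<and>
        (\<nexists>t. concl (snd (Ds ! 0)) = Eq t t)) \<and>
     (r = BotE \<longrightarrow> prime_fm C) \<and>
     (r = AD \<longrightarrow> ad_ok C (snd (Ds ! 0))) \<and>
     (\<forall>a t. r = EqI a \<longrightarrow> concl (snd (Ds ! 0)) = Ext t \<longrightarrow> C \<noteq> Eq t t) \<and>
     (\<forall>x\<in>set Ds. \<forall>l\<in>set (fst x). fst l = (if \<exists>a. r = EqI a then 1 else 0)) \<and>
     r \<noteq> IotaE3"

definition locally_normal :: "('c, 'p) ded \<Rightarrow> bool" where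
  "locally_normal D \<longleftrightarrow> (\<forall>r C Ds. Infer r C Ds \<in> subs D \<longrightarrow> step_ok r C Ds)"

lemma locally_normal_Assm [simp]: "locally_normal (Assm l)"
  by (simp add: locally_normal_def)

lemma locally_normal_Infer [simp]:
  "locally_normal (Infer r C Ds) \<longleftrightarrow> step_ok r C Ds \<and> (\<forall>x\<in>set Ds. locally_normal (snd x))"
  by (auto simp: locally_normal_def)

lemma standing_conventions:
  assumes "locally_normal D" "pure_parameters D"
  shows "standing_conventions D"
proof -
  have "subded D p = Some (Infer r C Ds) \<Longrightarrow> step_ok r C Ds" for p r C Ds
    using assms(1) by (auto simp: locally_normal_def dest: subded_subs)
  then show ?thesis
    using assms(2) unfolding standing_conventions_def step_ok_def
    by (metis atomic_fm.simps(1,2))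
qed

text \<open>Every member of a segment but the first is the conclusion of \<open>DisE\<close>,
  \<open>ExiE\<close> or \<open>EqI\<close>; if the last one is not, it is the first.\<close>

lemma segment_singleton:
  assumes "segment D ps" "\<not> (\<exists>r. segment_rl r \<and> concl_of D (last ps) r)"
  shows "ps = [last ps]"
proof (rule ccontr)
  assume ne: "ps \<noteq> [last ps]"
  have "ps \<noteq> []"
    using assms(1) by (simp add: segment_def)
  then obtain k where k: "length ps = Suc (Suc k)"
    using ne by (metis One_nat_def Suc_pred append_Nil append_butlast_last_id length_butlast
        length_greater_0_conv not0_implies_Suc)
  then have "ps ! Suc k = last ps"
    using \<open>ps \<noteq> []\<close> by (simp add: last_conv_nth)
  moreover have "Suc k < length ps"
    using k by simp
  then obtain r i where "segment_rl r" "premise_of D (ps ! k) i (ps ! Suc k) r"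
    using assms(1) unfolding segment_def by blast
  ultimately show False
    using assms(2) by (auto simp: premise_of_def)
qed

lemma premise_ofE:
  assumes "premise_of D p i q r"
  obtains C Ds where "subded D q = Some (Infer r C Ds)" "p = q @ [i]" "i < length Ds"
    "subded D p = Some (snd (Ds ! i))"
proof -
  obtain C Ds where q: "subded D q = Some (Infer r C Ds)" and p: "p = q @ [i]"
    using assms by (auto simp: premise_of_def concl_of_def)
  then have "i < length Ds"
    using assms by (auto simp: premise_of_def is_pos_def subded_append split: if_splits)
  then show thesis
    using that q p by (simp add: subded_append)
qed

text \<open>This is the purpose of the labels: a leaf shows by itself whether an \<open>EqI\<close>
  further down may discharge it.\<close>

lemma discharged_by_label:
  assumes "locally_normal D" "discharged_by D p (EqI a)"
  obtains l where "subded D p = Some (Assm l)" "fst l = 1"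
proof -
  obtain q C Ds i p' l where *: "subded D q = Some (Infer (EqI a) C Ds)" "p = q @ i # p'"
    "i < length Ds" "l \<in> set (fst (Ds ! i))" "open_at (snd (Ds ! i)) p' l"
    using assms(2) unfolding discharged_by_def by blast
  have leaf: "open_at E p' l \<Longrightarrow> subded E p' = Some (Assm l)" for E :: "('a, 'b) ded"
    by (induction E p' l rule: open_at.induct) auto
  have "step_ok (EqI a) C Ds"
    using assms(1) *(1) by (auto simp: locally_normal_def dest: subded_subs)
  then have "fst l = 1"
    using *(3,4) by (auto simp: step_ok_def)
  moreover have "subded D p = Some (Assm l)"
    using * leaf[OF *(5)] by (simp add: subded_append)
  ultimately show thesis using that by blast
qed

lemma concl_of_root: "subded D p = Some E \<Longrightarrow> concl_of D p r \<longleftrightarrow> root E = Some r"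
  by (cases E) (auto simp: concl_of_def)

lemma ad_ok_not_segment: "ad_ok C D \<Longrightarrow> root D = Some r \<Longrightarrow> \<not> segment_rl r \<and> r \<noteq> EqE"
  by (auto simp: ad_ok_def strong_def neutral_def)

text \<open>Neutral major premises and premises of \<open>AD\<close> are not concluded by segment
  rules, so the segments ending in them have length 1 and their maximality is decided by a single
  inference. Existence segments and chains of \<open>EqE\<close> are excluded directly by the
  clauses of \<open>step_ok\<close> on the conclusions of \<open>EqI\<close> and
  \<open>EqE\<close>.\<close>

lemma normal_of_locally_normal:
  assumes "locally_normal D"
  shows "normal D"
proof -
  have step: "subded D q = Some (Infer r C Ds) \<Longrightarrow> step_ok r C Ds" for q r C Ds
    using assms by (auto simp: locally_normal_def dest: subded_subs)
  \<comment> \<open>The case \<open>IotaE3\<close> is vacuous, as \<open>step_ok\<close> excludes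
    that rule.\<close>
  have AD_prem: "(\<exists>E C. subded D p = Some E \<and> fm_at D q = C \<and> ad_ok C E) \<and>
      (segment D ps \<and> last ps = p \<longrightarrow> ps = [p])"
    if "premise_of D p i q r" "r \<in> {AD, IotaE3}" "i = 0" for p i q r ps
  proof -
    from that(1) obtain C Ds where *: "subded D q = Some (Infer r C Ds)" "i < length Ds"
      "subded D p = Some (snd (Ds ! i))"
      by (rule premise_ofE)
    then have "ad_ok C (snd (Ds ! 0))"
      using step[OF *(1)] that by (auto simp: step_ok_def)
    moreover have "fm_at D q = C"
      using * by (simp add: fm_at_def)
    moreover have "ps = [p]" if "segment D ps" "last ps = p"
      using segment_singleton[OF that(1)] that(2) ad_ok_not_segment[OF calculation(1)]
        concl_of_root[OF *(3)] \<open>i = 0\<close> by metis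
    ultimately show ?thesis
      using *(3) \<open>i = 0\<close> by blast
  qed
  have "\<not> maximal_intro_elim_segment D ps" for ps
  proof
    assume m: "maximal_intro_elim_segment D ps"
    then obtain q r where pr: "premise_of D (last ps) 0 q r" and
      r: "elim_rl r \<or> r = AD \<and> (\<exists>a. concl_of D (hd ps) (IotaI a)) \<and>
           (\<exists>x F t. fm_at D (last ps) = Eq (Iota x F) t \<and> fm_at D q = Ext t)"
      unfolding maximal_intro_elim_segment_def by blast
    have seg: "segment D ps"
      using m by (simp add: maximal_intro_elim_segment_def)
    from r show False
    proof
      assume "elim_rl r"
      from pr obtain C Ds where *: "subded D q = Some (Infer r C Ds)"
        "subded D (last ps) = Some (snd (Ds ! 0))"
        by (rule premise_ofE)
      have n: "neutral (snd (Ds ! 0))"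
        using step[OF *(1)] \<open>elim_rl r\<close> by (simp add: step_ok_def)
      then have ps: "ps = [last ps]"
        using segment_singleton[OF seg] concl_of_root[OF *(2)] by (auto simp: neutral_def)
      then have "length ps = 1"
        by (metis length_Cons list.size(3) One_nat_def)
      moreover have "hd ps = last ps"
        using ps by (metis list.sel(1))
      ultimately show False
        using m n concl_of_root[OF *(2)]
        unfolding maximal_intro_elim_segment_def neutral_def by metis
    next
      assume r: "r = AD \<and> (\<exists>a. concl_of D (hd ps) (IotaI a)) \<and>
           (\<exists>x F t. fm_at D (last ps) = Eq (Iota x F) t \<and> fm_at D q = Ext t)"
      then obtain E where E: "subded D (last ps) = Some E" "ad_ok (fm_at D q) E"
        and ps: "ps = [last ps]"
        using AD_prem[OF pr] seg by blast
      then have "hd ps = last ps"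
        by (metis list.sel(1))
      then obtain a where a: "root E = Some (IotaI a)"
        using r concl_of_root[OF E(1)] by auto
      \<comment> \<open>A deduction ending with \<open>IotaI\<close> satisfies \<open>ad_ok\<close>
        only for the existence of the description, which differs from the right-hand term.\<close>
      have "fm_at D (last ps) = concl E"
        using E by (simp add: fm_at_def)
      then show False
        using E(2) a r unfolding ad_ok_def strong_def neutral_def by auto
    qed
  qed
  moreover have "\<not> maximal_eq_segment D ps" for ps
  proof
    assume m: "maximal_eq_segment D ps"
    then obtain q r where pr: "premise_of D (last ps) 0 q r" "r \<in> {AD, IotaE3}" and
      r: "(\<exists>p\<in>set ps. \<exists>q' a. premise_of D p 1 q' (EqI a)) \<or>
         (\<exists>a t. (\<forall>p\<in>set ps. fm_at D p = Eq (Par a) t) \<and>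
              (\<exists>b. discharged_by D (hd ps) (EqI b)) \<and> fm_at D q = Ext t)"
      unfolding maximal_eq_segment_def by blast
    have "segment D ps"
      using m by (simp add: maximal_eq_segment_def)
    then obtain E where E: "subded D (last ps) = Some E" "ad_ok (fm_at D q) E"
      and ps: "ps = [last ps]"
      using AD_prem[OF pr] by blast
    then have hd: "hd ps = last ps" and set: "set ps = {last ps}"
      by (metis list.sel(1), metis list.simps(15) empty_set)
    from r show False
    proof
      \<comment> \<open>The only position on the segment is the leftmost premise of its inference,
        so it cannot be the minor premise of \<open>EqI\<close>.\<close>
      assume "\<exists>p\<in>set ps. \<exists>q' a. premise_of D p 1 q' (EqI a)"
      then show False
        using set pr(1) by (auto simp: premise_of_def)
    next
      assume "\<exists>a t. (\<forall>p\<in>set ps. fm_at D p = Eq (Par a) t) \<and>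
              (\<exists>b. discharged_by D (hd ps) (EqI b)) \<and> fm_at D q = Ext t"
      then obtain a t b where *: "fm_at D (last ps) = Eq (Par a) t"
        "discharged_by D (last ps) (EqI b)" "fm_at D q = Ext t"
        using set hd by auto
      from discharged_by_label[OF assms *(2)] obtain l where l: "E = Assm l" "fst l = 1"
        using E(1) by auto
      have "concl E = Eq (Par a) t"
        using *(1) E(1) by (simp add: fm_at_def)
      then show False
        using E(2) l *(3) by (auto simp: ad_ok_def strong_def)
    qed
  qed
  moreover have "\<not> maximal_ext_segment D ps" for ps
  proof
    assume "maximal_ext_segment D ps"
    then obtain q a t where pr: "premise_of D (last ps) 0 q (EqI a)"
      and f: "fm_at D (last ps) = Ext t" "fm_at D q = Eq t t"
      unfolding maximal_ext_segment_def by blast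
    from pr obtain C Ds where *: "subded D q = Some (Infer (EqI a) C Ds)"
        "subded D (last ps) = Some (snd (Ds ! 0))"
      by (rule premise_ofE)
    then show False
      using step[OF *(1)] f by (auto simp: fm_at_def step_ok_def)
  qed
  moreover have "\<not> maximal_eqE_segment D ss" for ss
  proof
    assume m: "maximal_eqE_segment D ss"
    then have e: "concl_of D (hd (last ss)) EqE" and seg: "segment D (last ss)" and "ss \<noteq> []"
      unfolding maximal_eqE_segment_def eqE_segment_def by auto
    have "(\<exists>q r. premise_of D (last (last ss)) 0 q r \<and> r \<in> {AD, IotaE3}) \<or>
      (\<forall>\<sigma>\<in>set ss. \<forall>p\<in>set \<sigma>. \<exists>t. fm_at D p = Ext t)"
      using m by (simp add: maximal_eqE_segment_def)
    then show False
    proof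
      assume "\<exists>q r. premise_of D (last (last ss)) 0 q r \<and> r \<in> {AD, IotaE3}"
      then obtain q r where pr: "premise_of D (last (last ss)) 0 q r" "r \<in> {AD, IotaE3}"
        by blast
      obtain E where E: "subded D (last (last ss)) = Some E" "ad_ok (fm_at D q) E"
        and ps: "last ss = [last (last ss)]"
        using AD_prem[OF pr] seg by blast
      then have "root E = Some EqE"
        using e concl_of_root[OF E(1)] by (metis list.sel(1))
      then show False
        using ad_ok_not_segment[OF E(2)] by blast
    next
      assume ext: "\<forall>\<sigma>\<in>set ss. \<forall>p\<in>set \<sigma>. \<exists>t. fm_at D p = Ext t"
      have "last ss \<in> set ss" "hd (last ss) \<in> set (last ss)"
        using \<open>ss \<noteq> []\<close> seg by (auto simp: segment_def)
      then obtain t where "fm_at D (hd (last ss)) = Ext t"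
        using ext by blast
      moreover obtain C Ds where C: "subded D (hd (last ss)) = Some (Infer EqE C Ds)"
        using e by (auto simp: concl_of_def)
      ultimately show False
        using step[OF C] by (auto simp: step_ok_def fm_at_def)
    qed
  qed
  ultimately show ?thesis
    unfolding normal_def by blast
qed

section \<open>Substitution and instantiation\<close>

lemma subst_closed:
  shows "x \<notin> fvt s \<Longrightarrow> substt x t s = s" and "x \<notin> fvf A \<Longrightarrow> substf x t A = A"
  by (induction s and A) (auto simp: map_idI)

lemma fv_subst:
  assumes "fvt t = {}"
  shows "fvt (substt x t s) = fvt s - {x}" and "fvf (substf x t A) = fvf A - {x}"
  using assms by (induction s and A) auto

lemma par_subst:
  shows "part (substt x t s) \<subseteq> part s \<union> part t" and "parf (substf x t A) \<subseteq> parf A \<union> part t"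
  by (induction s and A) (simp_all, blast+)

lemma arity_subst:
  assumes "arityt ar t"
  shows "arityt ar s \<Longrightarrow> arityt ar (substt x t s)" and "arityf ar A \<Longrightarrow> arityf ar (substf x t A)"
  using assms by (induction s and A) (auto simp: list.pred_set list_all_iff)

lemma atomic_trm_simps:
  assumes "atomic_trm t"
  shows "fvt t = {}" "arityt ar t"
  using assms by (auto simp: atomic_trm_def)

lemma is_formula_subst:
  assumes "atomic_trm t" "arityf ar A" "fvf A \<subseteq> {x}"
  shows "is_formula ar (substf x t A)"
  using assms fv_subst(2) arity_subst(2) atomic_trm_simps unfolding is_formula_def
  by (metis Diff_eq_empty_iff)

lemma finite_par:
  fixes t :: "('c, 'd) trm" and A :: "('c, 'd) fm"
  shows "finite (part t)" and "finite (parf A)"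
  by (induction t and A) auto

text \<open>The syntactic counterpart of an environment: parameters are replaced according to
  \<open>\<rho>\<close> and free variables according to \<open>e\<close> at the same time. A binder
  resets its variable to itself. The function \<open>instt\<close> is mapped unapplied in the
  \<open>Pred\<close> clause to keep the recursion primitive.\<close>

primrec instt :: "('c, 'p) trm \<Rightarrow> (param \<Rightarrow> ('c, 'p) trm) \<Rightarrow> (var \<Rightarrow> ('c, 'p) trm) \<Rightarrow> ('c, 'p) trm"
  and instf :: "('c, 'p) fm \<Rightarrow> (param \<Rightarrow> ('c, 'p) trm) \<Rightarrow> (var \<Rightarrow> ('c, 'p) trm) \<Rightarrow> ('c, 'p) fm" where
  "instt (Var x) \<rho> e = e x"
| "instt (Par a) \<rho> e = \<rho> a"
| "instt (Cst c) \<rho> e = Cst c"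
| "instt (Iota x F) \<rho> e = Iota x (instf F \<rho> (e(x := Var x)))"
| "instf Bot \<rho> e = Bot"
| "instf (Pred R ts) \<rho> e = Pred R (map (\<lambda>d. d \<rho> e) (map instt ts))"
| "instf (Eq s t) \<rho> e = Eq (instt s \<rho> e) (instt t \<rho> e)"
| "instf (Ext t) \<rho> e = Ext (instt t \<rho> e)"
| "instf (Con A B) \<rho> e = Con (instf A \<rho> e) (instf B \<rho> e)"
| "instf (Dis A B) \<rho> e = Dis (instf A \<rho> e) (instf B \<rho> e)"
| "instf (Imp A B) \<rho> e = Imp (instf A \<rho> e) (instf B \<rho> e)"
| "instf (All x A) \<rho> e = All x (instf A \<rho> (e(x := Var x)))"
| "instf (Exi x A) \<rho> e = Exi x (instf A \<rho> (e(x := Var x)))"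

lemma inst_id:
  shows "(\<And>x. x \<in> fvt t \<Longrightarrow> e x = Var x) \<Longrightarrow> (\<And>a. a \<in> part t \<Longrightarrow> \<rho> a = Par a) \<Longrightarrow> instt t \<rho> e = t"
    and "(\<And>x. x \<in> fvf A \<Longrightarrow> e x = Var x) \<Longrightarrow> (\<And>a. a \<in> parf A \<Longrightarrow> \<rho> a = Par a) \<Longrightarrow> instf A \<rho> e = A"
proof (induction t and A arbitrary: e and e)
  case (Pred R ts)
  have "instt t \<rho> e = t" if "t \<in> set ts" for t
    using that Pred.prems by (intro Pred.IH) auto
  then show ?case by (simp add: map_idI)
qed auto

text \<open>The body under a binder is instantiated with \<open>e(x := Var x)\<close>; substituting
  for \<open>x\<close> afterwards amounts to updating the environment, because no other value
  contains \<open>x\<close>. This connects the formulas in the quantifier and description rules with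
  the semantic clauses.\<close>

lemma subst_inst:
  assumes "\<And>a. x \<notin> fvt (\<rho> a)"
  shows "(\<And>y. y \<noteq> x \<Longrightarrow> x \<notin> fvt (e y)) \<Longrightarrow>
      substt x u (instt t \<rho> (e(x := Var x))) = instt t \<rho> (e(x := u))"
    and "(\<And>y. y \<noteq> x \<Longrightarrow> x \<notin> fvt (e y)) \<Longrightarrow>
      substf x u (instf A \<rho> (e(x := Var x))) = instf A \<rho> (e(x := u))"
proof (induction t and A arbitrary: e and e)
  case (Iota y F)
  have "substf x u (instf F \<rho> (e(y := Var y, x := Var x))) = instf F \<rho> (e(y := Var y, x := u))" if "y \<noteq> x"
    using that Iota.prems by (intro Iota.IH) auto
  then show ?case by (cases "y = x") (simp_all add: fun_upd_twist[of y x] del: fun_upd_apply)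
next
  case (All y F)
  have "substf x u (instf F \<rho> (e(y := Var y, x := Var x))) = instf F \<rho> (e(y := Var y, x := u))" if "y \<noteq> x"
    using that All.prems by (intro All.IH) auto
  then show ?case by (cases "y = x") (simp_all add: fun_upd_twist[of y x] del: fun_upd_apply)
next
  case (Exi y F)
  have "substf x u (instf F \<rho> (e(y := Var y, x := Var x))) = instf F \<rho> (e(y := Var y, x := u))" if "y \<noteq> x"
    using that Exi.prems by (intro Exi.IH) auto
  then show ?case by (cases "y = x") (simp_all add: fun_upd_twist[of y x] del: fun_upd_apply)
qed (use assms in \<open>auto simp: subst_closed\<close>)

text \<open>The common step of the binder cases below: under the updated environment
  \<open>y\<close> contributes only itself.\<close>

lemma UN_fvt_upd:
  assumes "V \<subseteq> (\<Union>x\<in>S. fvt ((e(y := Var y)) x))"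
  shows "V - {y} \<subseteq> (\<Union>x\<in>S - {y}. fvt (e x))"
proof
  fix z assume z: "z \<in> V - {y}"
  then obtain x where x: "x \<in> S" "z \<in> fvt ((e(y := Var y)) x)"
    using assms by blast
  moreover from this z have "x \<noteq> y"
    by auto
  ultimately show "z \<in> (\<Union>x\<in>S - {y}. fvt (e x))"
    by auto
qed

lemma fv_inst:
  assumes "\<And>a. fvt (\<rho> a) = {}"
  shows "fvt (instt t \<rho> e) \<subseteq> (\<Union>x\<in>fvt t. fvt (e x))"
    and "fvf (instf A \<rho> e) \<subseteq> (\<Union>x\<in>fvf A. fvt (e x))"
proof (induction t and A arbitrary: e and e)
  case (Iota y F)
  show ?case using UN_fvt_upd[OF Iota[of "e(y := Var y)"]] by (simp del: fun_upd_apply)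
next
  case (All y F)
  show ?case using UN_fvt_upd[OF All[of "e(y := Var y)"]] by (simp del: fun_upd_apply)
next
  case (Exi y F)
  show ?case using UN_fvt_upd[OF Exi[of "e(y := Var y)"]] by (simp del: fun_upd_apply)
next
  case (Pred R ts)
  have "fvt (instt t \<rho> e) \<subseteq> (\<Union>x\<in>fvf (Pred R ts). fvt (e x))" if "t \<in> set ts" for t
    by (rule order_trans[OF Pred[OF that]], rule UN_mono) (use that in auto)
  then show ?case by (simp add: UN_subset_iff)
next
  case (Eq s t)
  show ?case using Eq[of e] by auto
next
  case (Con A B)
  show ?case using Con[of e] by auto
next
  case (Dis A B)
  show ?case using Dis[of e] by auto
next
  case (Imp A B)
  show ?case using Imp[of e] by auto
qed (use assms in auto)

lemma par_inst:
  assumes "\<And>a. part (\<rho> a) \<subseteq> V"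
  shows "(\<And>x. part (e x) \<subseteq> V) \<Longrightarrow> part (instt t \<rho> e) \<subseteq> V"
    and "(\<And>x. part (e x) \<subseteq> V) \<Longrightarrow> parf (instf A \<rho> e) \<subseteq> V"
  using assms by (induction t and A arbitrary: e and e) (simp_all, blast+)

lemma arity_inst:
  assumes "\<And>a. arityt ar (\<rho> a)"
  shows "(\<And>x. arityt ar (e x)) \<Longrightarrow> arityt ar t \<Longrightarrow> arityt ar (instt t \<rho> e)"
    and "(\<And>x. arityt ar (e x)) \<Longrightarrow> arityf ar A \<Longrightarrow> arityf ar (instf A \<rho> e)"
  using assms by (induction t and A arbitrary: e and e) (auto simp: list.pred_set list_all_iff)

section \<open>Normal derivability\<close>

text \<open>The eigenparameters of each chosen deduction are added to the set that the remaining
  ones have to avoid.\<close>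

lemma choose_deductions:
  assumes "\<forall>x\<in>set Ps. \<forall>S. finite S \<longrightarrow> (\<exists>D. Q x D \<and> eigs D \<inter> S = {})" "finite S"
  shows "\<exists>Ds. list_all2 Q Ps Ds \<and> (\<forall>D\<in>set Ds. eigs D \<inter> S = {}) \<and>
    (\<forall>i<length Ds. \<forall>j<length Ds. i \<noteq> j \<longrightarrow> eigs (Ds ! i) \<inter> eigs (Ds ! j) = {})"
  using assms
proof (induction Ps arbitrary: S)
  case (Cons P Ps)
  then obtain D where D: "Q P D" "eigs D \<inter> S = {}"
    by auto
  then obtain Ds where Ds: "list_all2 Q Ps Ds" "\<forall>E\<in>set Ds. eigs E \<inter> (S \<union> eigs D) = {}"
    "\<forall>i<length Ds. \<forall>j<length Ds. i \<noteq> j \<longrightarrow> eigs (Ds ! i) \<inter> eigs (Ds ! j) = {}"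
    using Cons.IH[of "S \<union> eigs D"] Cons.prems by auto
  have "eigs ((D # Ds) ! i) \<inter> eigs ((D # Ds) ! j) = {}"
    if "i < length (D # Ds)" "j < length (D # Ds)" "i \<noteq> j" for i j
    using that Ds(2,3) by (cases i; cases j) (fastforce simp: nth_mem)+
  then show ?case
    using D Ds by (intro exI[of _ "D # Ds"]) auto
qed simp

type_synonym ('c, 'p) world = "param set \<times> ('c, 'p) assm set"

locale language =
  fixes ar :: "'p \<Rightarrow> nat"
begin

text \<open>Finiteness guarantees fresh parameters. Nonemptiness guarantees an individual at every
  world, so that terms can be given a denotation where \<open>Bot\<close> is derivable.\<close>

definition wf_world :: "('c, 'p) world \<Rightarrow> bool" where
  "wf_world w \<longleftrightarrow> finite (fst w) \<and> fst w \<noteq> {} \<and> (\<forall>(n, B)\<in>snd w. is_formula ar B \<and> parf B \<subseteq> fst w)"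

text \<open>\<open>K\<close> restricts the shape of the deduction, in practice its last inference.
  By the last conjunct every parameter belongs to the world or is an eigenparameter, so control over
  the eigenparameters is control over all foreign parameters.\<close>

definition proof_of where
  "proof_of K w C D \<longleftrightarrow> K D \<and> by_rules ar D \<and> locally_normal D \<and> pure_parameters D \<and>
     concl D = C \<and> open_assms D \<subseteq> snd w \<and> pars D \<subseteq> fst w \<union> eigs D"

text \<open>
  The eigenparameters can be made to avoid any finite set, so deductions of several premises can be
  combined in accordance with the convention on parameters without renaming.
\<close>

definition derivable :: "(('c, 'p) ded \<Rightarrow> bool) \<Rightarrow> ('c, 'p) world \<Rightarrow> ('c, 'p) fm \<Rightarrow> bool" where
  "derivable K w C \<longleftrightarrow> (\<forall>S. finite S \<longrightarrow> (\<exists>D. proof_of K w C D \<and> eigs D \<inter> S = {}))"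

abbreviation "nf \<equiv> derivable (\<lambda>_. True)"
abbreviation "ne \<equiv> derivable neutral"
abbreviation "ne0 \<equiv> derivable strong"

definition add :: "('c, 'p) world \<Rightarrow> ('c, 'p) assm list \<Rightarrow> ('c, 'p) world" where
  "add w ls = (fst w, set ls \<union> snd w)"

definition new :: "('c, 'p) world \<Rightarrow> param \<Rightarrow> ('c, 'p) assm list \<Rightarrow> ('c, 'p) world" where
  "new w a ls = (insert a (fst w), set ls \<union> snd w)"

lemma by_rules_formula: "by_rules ar D \<Longrightarrow> is_formula ar (concl D)"
  by (induction rule: by_rules.induct) auto

text \<open>A parameter of \<open>C\<close> outside the world would be an eigenparameter of every
  deduction of \<open>C\<close>, but some deduction has eigenparameters disjoint from the finite set
  \<open>parf C\<close>.\<close>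

lemma derivable_formula:
  assumes "derivable K w C" "finite (fst w)"
  shows "is_formula ar C" "parf C \<subseteq> fst w"
proof -
  obtain D where D: "proof_of K w C D"
    using assms unfolding derivable_def by blast
  then have "concl D = C" "pars D \<subseteq> fst w \<union> eigs D"
    by (auto simp: proof_of_def)
  then have *: "parf C \<subseteq> fst w \<union> eigs D"
    using parf_concl_pars by blast
  then have "finite (parf C)"
    using assms(2) by (meson finite_UnI finite_eigs finite_subset)
  then obtain E where E: "proof_of K w C E" "eigs E \<inter> parf C = {}"
    using assms unfolding derivable_def by blast
  then show "parf C \<subseteq> fst w"
    using parf_concl_pars by (fastforce simp: proof_of_def)
  show "is_formula ar C"
    using D by_rules_formula by (auto simp: proof_of_def)
qed

lemma derivable_mono_world:
  assumes "derivable K w C" "fst w \<subseteq> fst w'" "snd w \<subseteq> snd w'"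
  shows "derivable K w' C"
proof -
  have "proof_of K w' C D" if "proof_of K w C D" for D
    using that assms(2,3) unfolding proof_of_def by auto
  then show ?thesis
    using assms(1) unfolding derivable_def by meson
qed

lemma derivable_weaken: "derivable K w C \<Longrightarrow> (\<And>D. K D \<Longrightarrow> K' D) \<Longrightarrow> derivable K' w C"
  unfolding derivable_def proof_of_def by meson

lemma nf_ne: "ne w C \<Longrightarrow> nf w C"
  by (erule derivable_weaken) simp

lemma ne_ne0: "ne0 w C \<Longrightarrow> ne w C"
  by (erule derivable_weaken) (simp add: strong_def)

text \<open>The common part of all rules below. The premises are given as a function of the
  eigenparameter \<open>a\<close>, because \<open>a\<close> can be fixed only after the set
  \<open>S\<close> to be avoided is known. Each premise lists its discharged classes, the required
  shape, its world and its formula; only premises with discharged classes may be deduced in a world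
  containing \<open>a\<close>.\<close>

lemma derivable_Infer:
  assumes wf_world: "wf_world w"
    and prems: "\<And>a. a \<notin> fst w \<Longrightarrow> \<forall>(\<Delta>, K, w', B)\<in>set (Ps a). derivable K w' B \<and>
      fst w' \<subseteq> (if \<Delta> = [] \<or> eigen (r a) = None then fst w else insert a (fst w)) \<and>
      snd w' \<subseteq> set \<Delta> \<union> snd w"
    and C: "is_formula ar C" "parf C \<subseteq> fst w"
    and eig: "\<And>a. eigen (r a) = None \<or> eigen (r a) = Some a"
    and step: "\<And>a Ds. a \<notin> fst w \<Longrightarrow>
       list_all2 (\<lambda>(\<Delta>, K, w', B) (\<Delta>', E). \<Delta>' = \<Delta> \<and> K E \<and> concl E = B \<and>
          open_assms E - set \<Delta> \<subseteq> snd w) (Ps a) Ds \<Longrightarrow>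
       inference (r a) (map (\<lambda>(\<Delta>, E). (\<Delta>, open_assms E - set \<Delta>, concl E)) Ds) C \<and>
       step_ok (r a) C Ds \<and> K0 (Infer (r a) C Ds)"
  shows "derivable K0 w C"
  unfolding derivable_def
proof (intro allI impI)
  fix S :: "param set" assume S: "finite S"
  have fin: "finite (fst w)"
    using wf_world by (simp add: wf_world_def)
  obtain a where a: "a \<notin> S \<union> fst w"
    using S fin by (metis ex_new_if_finite finite_UnI infinite_UNIV_nat)
  then have aw: "a \<notin> fst w" by simp
  let ?Q = "\<lambda>(\<Delta>, K, w', B) D. proof_of K w' B D"
  \<comment> \<open>Avoiding \<open>a\<close> keeps it the parameter of one inference only; avoiding
    \<open>fst w\<close> keeps the eigenparameters out of the conclusion and out of the other
    premises.\<close>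
  obtain Es where Es: "list_all2 ?Q (Ps a) Es" "\<forall>D\<in>set Es. eigs D \<inter> insert a (S \<union> fst w) = {}"
    "\<forall>i<length Es. \<forall>j<length Es. i \<noteq> j \<longrightarrow> eigs (Es ! i) \<inter> eigs (Es ! j) = {}"
    using choose_deductions[of "Ps a" ?Q "insert a (S \<union> fst w)"] prems[OF aw] S fin
    unfolding derivable_def by force
  define Ds where "Ds = zip (map fst (Ps a)) Es"
  have len: "length Es = length (Ps a)" "length Ds = length (Ps a)"
    using Es(1) by (auto simp: Ds_def dest: list_all2_lengthD)
  have nth: "fst (Ds ! i) = fst (Ps a ! i)" "snd (Ds ! i) = Es ! i" if "i < length (Ps a)" for i
    using that len by (auto simp: Ds_def)
  have Ps: "case Ps a ! i of (\<Delta>, K, w', B) \<Rightarrow> proof_of K w' B (Es ! i) \<and>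
      fst w' \<subseteq> (if \<Delta> = [] \<or> eigen (r a) = None then fst w else insert a (fst w)) \<and>
      snd w' \<subseteq> set \<Delta> \<union> snd w" if "i < length (Ps a)" for i
    using that list_all2_nthD[OF Es(1) that] prems[OF aw] nth_mem[OF that] by fastforce
  have good: "by_rules ar (Es ! i)" "locally_normal (Es ! i)" "pure_parameters (Es ! i)"
    "open_assms (Es ! i) - set (fst (Ds ! i)) \<subseteq> snd w"
    "pars (Es ! i) \<subseteq> (if fst (Ds ! i) = [] \<or> eigen (r a) = None then fst w else insert a (fst w)) \<union> eigs (Es ! i)"
    if "i < length (Ps a)" for i
    using Ps[OF that] nth[OF that] unfolding proof_of_def by (auto split: if_splits)
  have all: "list_all2 (\<lambda>(\<Delta>, K, w', B) (\<Delta>', E). \<Delta>' = \<Delta> \<and> K E \<and> concl E = B \<and>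
          open_assms E - set \<Delta> \<subseteq> snd w) (Ps a) Ds"
  proof (rule list_all2_all_nthI)
    fix i assume i: "i < length (Ps a)"
    then show "(\<lambda>(\<Delta>, K, w', B) (\<Delta>', E). \<Delta>' = \<Delta> \<and> K E \<and> concl E = B \<and>
          open_assms E - set \<Delta> \<subseteq> snd w) (Ps a ! i) (Ds ! i)"
      using Ps[OF i] nth[OF i] good(4)[OF i] unfolding proof_of_def
      by (cases "Ps a ! i"; cases "Ds ! i") auto
  qed (simp add: len)
  note st = step[OF aw all]
  let ?D = "Infer (r a) C Ds"
  have setD: "\<exists>i<length (Ps a). x = Ds ! i" if "x \<in> set Ds" for x
    using that len by (auto simp: in_set_conv_nth)
  have prem: "by_rules ar (snd x) \<and> locally_normal (snd x) \<and> open_assms (snd x) - set (fst x) \<subseteq> snd w"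
    if x: "x \<in> set Ds" for x
  proof -
    obtain i where "i < length (Ps a)" "x = Ds ! i"
      using setD[OF x] by blast
    then show ?thesis
      using good(1,2,4)[of i] nth[of i] by simp
  qed
  have "by_rules ar ?D"
    using st C(1) prem by (intro by_rules.intros) auto
  moreover have "locally_normal ?D"
    using st prem by simp
  moreover have disj: "eigs (Es ! i) \<inter> insert a (S \<union> fst w) = {}" if "i < length (Ps a)" for i
    using Es(2) that len by auto
  have "pure_parameters ?D"
  proof (rule pure_parameters_Infer)
    fix i j assume ij: "i < length Ds" "j < length Ds" "i \<noteq> j"
    have i: "i < length (Ps a)" and j: "j < length (Ps a)"
      using ij len by auto
    have "eigs (Es ! i) \<inter> eigs (Es ! j) = {}"
      using Es(3) i j ij(3) len by metis
    then show "eigs (snd (Ds ! i)) \<inter> (eigs (snd (Ds ! j)) \<union> pars (snd (Ds ! j))) = {}"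
      using good(5)[OF j] disj[OF i] nth[OF i] nth[OF j] by (auto split: if_splits)
  next
    fix b i assume "eigen (r a) = Some b" "i < length Ds" "fst (Ds ! i) = []"
    then have "b = a" "i < length (Ps a)"
      using eig[of a] len by auto
    then show "b \<notin> pars (snd (Ds ! i))"
      using good(5)[of i] disj[of i] nth[of i] aw \<open>fst (Ds ! i) = []\<close> by auto
  next
    fix i assume "i < length Ds"
    then have i: "i < length (Ps a)" using len by simp
    show "pure_parameters (snd (Ds ! i))"
      using good(3) i nth by simp
    show "eigs (snd (Ds ! i)) \<inter> parf C = {}"
      using disj[OF i] nth[OF i] C(2) by auto
    show "b \<notin> eigs (snd (Ds ! i))" if "eigen (r a) = Some b" for b
      using disj[OF i] nth[OF i] that eig[of a] by auto
  qed (use C(2) eig[of a] aw in auto)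
  moreover have "open_assms ?D \<subseteq> snd w"
    using prem by (simp add: UN_subset_iff)
  moreover have "pars ?D \<subseteq> fst w \<union> eigs ?D"
  proof -
    have "pars (snd x) \<subseteq> fst w \<union> eigs ?D" if x: "x \<in> set Ds" for x
    proof -
      obtain i where i: "i < length (Ps a)" "x = Ds ! i"
        using setD[OF x] by blast
      have "eigs (snd x) \<subseteq> eigs ?D" using x by auto
      moreover have "eigen (r a) \<noteq> None \<Longrightarrow> a \<in> eigs ?D" using eig[of a] by auto
      ultimately show ?thesis
        using good(5)[OF i(1)] nth[OF i(1)] i(2) by (auto split: if_splits)
    qed
    then show ?thesis using C(2) by auto
  qed
  moreover have "eigs ?D \<inter> S = {}"
  proof -
    have "eigs (snd x) \<inter> S = {}" if x: "x \<in> set Ds" for x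
      using setD[OF x] disj nth by fastforce
    then show ?thesis
      using eig[of a] a by auto
  qed
  ultimately show "\<exists>D. proof_of K0 w C D \<and> eigs D \<inter> S = {}"
    using st unfolding proof_of_def by (intro exI[of _ ?D]) auto
qed

lemma wf_fresh: "wf_world w \<Longrightarrow> a \<notin> fst w \<Longrightarrow> G \<subseteq> snd w \<Longrightarrow> fresh a G"
  unfolding wf_world_def fresh_def by fastforce

lemma atomic_not_Iota: "atomic_trm t \<Longrightarrow> t \<noteq> Iota x F"
  by (auto simp: atomic_trm_def)

lemma ne_Assm:
  assumes "wf_world w" "l \<in> snd w"
  shows "ne w (snd l)"
  unfolding derivable_def
proof (intro allI impI)
  fix S :: "param set"
  have "proof_of neutral w (snd l) (Assm l)"
    using assms by (cases l)
      (auto simp: proof_of_def neutral_def wf_world_def pure_parameters_Assm intro!: by_rules.intros)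
  then show "\<exists>D. proof_of neutral w (snd l) D \<and> eigs D \<inter> S = {}"
    by (intro exI[of _ "Assm l"]) simp
qed

lemma ne0_Assm:
  assumes "wf_world w" "(0, B) \<in> snd w"
  shows "ne0 w B"
  unfolding derivable_def
proof (intro allI impI)
  fix S :: "param set"
  have "proof_of strong w B (Assm (0, B))"
    using assms
      by (auto simp: proof_of_def neutral_def strong_def wf_world_def pure_parameters_Assm intro!: by_rules.intros)
  then show "\<exists>D. proof_of strong w B D \<and> eigs D \<inter> S = {}"
    by (intro exI[of _ "Assm (0, B)"]) simp
qed

section \<open>The rules as closure properties of normal and neutral derivability\<close>

lemmas rule_simps = list_all2_Cons1 step_ok_def neutral_def strong_def ad_ok_def is_formula_def

lemma wf_finite: "wf_world w \<Longrightarrow> finite (fst w)"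
  by (simp add: wf_world_def)

lemmas derivable_is_formula = derivable_formula[OF _ wf_finite]

lemma nf_ConI:
  assumes "wf_world w" "nf w A" "nf w B"
  shows "nf w (Con A B)"
  by (rule derivable_Infer[where r="\<lambda>_. ConI" and Ps="\<lambda>_. [([], \<lambda>_. True, w, A), ([], \<lambda>_. True, w, B)]"])
    (use assms derivable_is_formula[OF assms(2,1)] derivable_is_formula[OF assms(3,1)]
      in \<open>auto simp: rule_simps intro: inference.ConI\<close>)

lemma ne0_ConE:
  assumes "wf_world w" "ne w (Con A B)"
  shows "ne0 w A" "ne0 w B"
  by (rule derivable_Infer[where r="\<lambda>_. ConE" and Ps="\<lambda>_. [([], neutral, w, Con A B)]"],
    use assms derivable_is_formula[OF assms(2,1)]
      in \<open>auto simp: rule_simps intro: inference.ConE1 inference.ConE2\<close>)+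

lemma nf_ImpI:
  assumes "wf_world w" "nf (add w [(0, A)]) B" "is_formula ar A" "parf A \<subseteq> fst w"
  shows "nf w (Imp A B)"
proof -
  have "finite (fst (add w [(0, A)]))"
    using assms(1) by (simp add: add_def wf_world_def)
  note f = derivable_formula[OF assms(2) this]
  show ?thesis
  by (rule derivable_Infer[where r="\<lambda>_. ImpI" and Ps="\<lambda>_. [([(0, A)], \<lambda>_. True, add w [(0, A)], B)]"])
    (use assms f in \<open>auto simp: rule_simps add_def intro: inference.ImpI\<close>)
qed

lemma ne0_ImpE:
  assumes "wf_world w" "ne w (Imp A B)" "nf w A"
  shows "ne0 w B"
  by (rule derivable_Infer[where r="\<lambda>_. ImpE" and Ps="\<lambda>_. [([], neutral, w, Imp A B), ([], \<lambda>_. True, w, A)]"])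
    (use assms derivable_is_formula[OF assms(2,1)] in \<open>auto simp: rule_simps intro: inference.ImpE\<close>)

lemma nf_DisI1:
  assumes "wf_world w" "nf w A" "is_formula ar B" "parf B \<subseteq> fst w"
  shows "nf w (Dis A B)"
  by (rule derivable_Infer[where r="\<lambda>_. DisI" and Ps="\<lambda>_. [([], \<lambda>_. True, w, A)]"])
    (use assms derivable_is_formula[OF assms(2,1)] in \<open>auto simp: rule_simps intro: inference.DisI1\<close>)

lemma nf_DisI2:
  assumes "wf_world w" "nf w B" "is_formula ar A" "parf A \<subseteq> fst w"
  shows "nf w (Dis A B)"
  by (rule derivable_Infer[where r="\<lambda>_. DisI" and Ps="\<lambda>_. [([], \<lambda>_. True, w, B)]"])
    (use assms derivable_is_formula[OF assms(2,1)] in \<open>auto simp: rule_simps intro: inference.DisI2\<close>)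

lemma nf_DisE:
  assumes "wf_world w" "ne w (Dis A B)" "nf (add w [(0, A)]) C" "nf (add w [(0, B)]) C"
  shows "nf w C"
proof -
  have "finite (fst (add w [(0, A)]))"
    using assms(1) by (simp add: add_def wf_world_def)
  note f = derivable_formula[OF assms(3) this]
  show ?thesis
  by (rule derivable_Infer[where r="\<lambda>_. DisE" and Ps="\<lambda>_. [([], neutral, w, Dis A B),
        ([(0, A)], \<lambda>_. True, add w [(0, A)], C), ([(0, B)], \<lambda>_. True, add w [(0, B)], C)]"])
    (use assms f in \<open>auto simp: rule_simps add_def intro: inference.DisE\<close>)
qed

lemma ne0_BotE:
  assumes "wf_world w" "ne w Bot" "prime_fm C" "is_formula ar C" "parf C \<subseteq> fst w"
  shows "ne0 w C"
  by (rule derivable_Infer[where r="\<lambda>_. BotE" and Ps="\<lambda>_. [([], neutral, w, Bot)]"])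
    (use assms in \<open>auto simp: rule_simps intro: inference.BotE\<close>)

lemma nf_AllI:
  assumes "wf_world w" "\<And>a. a \<notin> fst w \<Longrightarrow> nf (new w a [(0, Ext (Par a))]) (substf x (Par a) A)"
    "is_formula ar (All x A)" "parf A \<subseteq> fst w"
  shows "nf w (All x A)"
  by (rule derivable_Infer[where r="\<lambda>a. AllI a" and
        Ps="\<lambda>a. [([(0, Ext (Par a))], \<lambda>_. True, new w a [(0, Ext (Par a))], substf x (Par a) A)]"])
    (use assms wf_fresh[OF assms(1)] assms(4)[THEN contra_subsetD] in \<open>auto simp: rule_simps new_def intro!: inference.AllI\<close>)

lemma ne0_AllE:
  assumes "wf_world w" "ne w (All x A)" "nf w (Ext t)" "atomic_trm t"
    "is_formula ar (substf x t A)" "parf (substf x t A) \<subseteq> fst w"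
  shows "ne0 w (substf x t A)"
  by (rule derivable_Infer[where r="\<lambda>_. AllE" and Ps="\<lambda>_. [([], neutral, w, All x A), ([], \<lambda>_. True, w, Ext t)]"])
    (use assms in \<open>auto simp: rule_simps intro: inference.AllE\<close>)

lemma nf_ExiI:
  assumes "wf_world w" "nf w (substf x t A)" "nf w (Ext t)" "atomic_trm t"
    "is_formula ar (Exi x A)" "parf A \<subseteq> fst w"
  shows "nf w (Exi x A)"
  by (rule derivable_Infer[where r="\<lambda>_. ExiI" and Ps="\<lambda>_. [([], \<lambda>_. True, w, substf x t A), ([], \<lambda>_. True, w, Ext t)]"])
    (use assms in \<open>auto simp: rule_simps intro: inference.ExiI\<close>)

lemma nf_ExiE:
  assumes "wf_world w" "ne w (Exi x A)" "is_formula ar C" "parf C \<subseteq> fst w"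
    "\<And>a. a \<notin> fst w \<Longrightarrow> nf (new w a [(0, substf x (Par a) A), (0, Ext (Par a))]) C"
  shows "nf w C"
  by (rule derivable_Infer[where r="\<lambda>a. ExiE a" and
        Ps="\<lambda>a. [([], neutral, w, Exi x A), ([(0, substf x (Par a) A), (0, Ext (Par a))], \<lambda>_. True,
           new w a [(0, substf x (Par a) A), (0, Ext (Par a))], C)]"])
    (use assms wf_fresh[OF assms(1)] derivable_is_formula[OF assms(2,1)] derivable_is_formula(2)[OF assms(2,1), THEN contra_subsetD]
        assms(4)[THEN contra_subsetD]
      in \<open>auto simp: rule_simps new_def intro!: inference.ExiE\<close>)

lemma nf_EqI:
  assumes "wf_world w" "nf w (Ext t)" "is_formula ar C" "parf C \<subseteq> fst w" "C \<noteq> Eq t t"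
    "\<And>a. a \<notin> fst w \<Longrightarrow> nf (new w a [(1, Eq (Par a) t)]) C"
  shows "nf w C"
  by (rule derivable_Infer[where r="\<lambda>a. EqI a" and
        Ps="\<lambda>a. [([], \<lambda>_. True, w, Ext t), ([(1, Eq (Par a) t)], \<lambda>_. True,
           new w a [(1, Eq (Par a) t)], C)]"])
    (use assms wf_fresh[OF assms(1)] derivable_is_formula[OF assms(2,1)] derivable_is_formula(2)[OF assms(2,1), THEN contra_subsetD]
        assms(4)[THEN contra_subsetD]
      in \<open>auto simp: rule_simps new_def intro!: inference.EqI\<close>)

lemma ne_EqE:
  assumes "wf_world w" "ne w (Eq s t)" "s \<noteq> t" "nf w (substf x s A)" "C = substf x t A"
    "is_formula ar C" "parf C \<subseteq> fst w" "(\<exists>s t. C = Eq s t) \<or> (\<exists>R ts. C = Pred R ts)"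
  shows "ne w C"
  by (rule derivable_Infer[where r="\<lambda>_. EqE" and
        Ps="\<lambda>a. [([], neutral, w, Eq s t), ([], \<lambda>_. True, w, substf x s A)]"])
    (use assms inference.EqE[where t\<^sub>1=s and t\<^sub>2=t and x=x and A=A]
      in \<open>auto simp: rule_simps\<close>)

lemma nf_AD_Pred:
  assumes "wf_world w" "ne0 w (Pred R ts)" "t \<in> set ts"
  shows "nf w (Ext t)"
  by (rule derivable_Infer[where r="\<lambda>_. AD" and Ps="\<lambda>a. [([], strong, w, Pred R ts)]"])
    (use assms derivable_is_formula[OF assms(2,1)] in \<open>auto simp: list.pred_set list_all_iff rule_simps intro: inference.AD_Pred\<close>)

lemma nf_AD_Eq:
  assumes "wf_world w" "ne0 w (Eq s t)"
  shows "nf w (Ext s)" "nf w (Ext t)"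
  by (rule derivable_Infer[where r="\<lambda>_. AD" and Ps="\<lambda>a. [([], strong, w, Eq s t)]"],
    use assms derivable_is_formula[OF assms(2,1)]
      in \<open>auto simp: rule_simps intro: inference.AD_Eq1 inference.AD_Eq2\<close>)+

text \<open>\<open>EqI\<close> assumptions are not strong, so the shape \<open>?K\<close> pins the
  premise of \<open>AD\<close> down to the assumption itself, which the second case of
  \<open>ad_ok\<close> admits.\<close>

lemma nf_AD_witness:
  assumes "wf_world w" "(1, Eq (Par a) t) \<in> snd w" "t \<noteq> Par a"
  shows "nf w (Ext (Par a))"
proof -
  let ?K = "\<lambda>D. D = Assm (1, Eq (Par a) t)"
  have f: "is_formula ar (Eq (Par a) t)" "parf (Eq (Par a) t) \<subseteq> fst w"
    using assms unfolding wf_world_def by fastforce+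
  have "derivable ?K w (Eq (Par a) t)"
    unfolding derivable_def proof_of_def using assms(2) f
    by (auto simp: pure_parameters_Assm intro!: by_rules.intros)
  then show ?thesis
  by (intro derivable_Infer[where r="\<lambda>_. AD" and Ps="\<lambda>_. [([], ?K, w, Eq (Par a) t)]"])
    (use assms f in \<open>auto simp: rule_simps intro: inference.AD_Eq1\<close>)
qed

text \<open>\<open>IotaI\<close> followed at once by \<open>AD\<close>. Since \<open>IotaI\<close>
  is an introduction rule its conclusion is not neutral, hence the explicit shape \<open>?K\<close>,
  matching the third case of \<open>ad_ok\<close>.\<close>

lemma nf_Ext_Iota:
  assumes "wf_world w" "atomic_trm t" "nf w (Ext t)"
    "\<And>a. a \<notin> fst w \<Longrightarrow> nf (new w a [(0, Eq (Par a) t)]) (substf x (Par a) F)"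
    "\<And>a. a \<notin> fst w \<Longrightarrow>
      nf (new w a [(0, substf x (Par a) F), (0, Ext (Par a))]) (Eq (Par a) t)"
    "is_formula ar (Ext (Iota x F))" "parf F \<subseteq> fst w"
  shows "nf w (Ext (Iota x F))"
proof -
  let ?K = "\<lambda>D. \<exists>a Ds. D = Infer (IotaI a) (Eq (Iota x F) t) Ds"
  have f: "fvt t = {}" "part t \<subseteq> fst w"
    using derivable_is_formula[OF assms(3,1)] by (auto simp: is_formula_def)
  have "derivable ?K w (Eq (Iota x F) t)"
    by (rule derivable_Infer[where r="\<lambda>a. IotaI a" and
        Ps="\<lambda>a. [([], \<lambda>_. True, w, Ext t),
          ([(0, Eq (Par a) t)], \<lambda>_. True, new w a [(0, Eq (Par a) t)], substf x (Par a) F),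
          ([(0, substf x (Par a) F), (0, Ext (Par a))], \<lambda>_. True,
            new w a [(0, substf x (Par a) F), (0, Ext (Par a))], Eq (Par a) t)]"])
     (use assms f wf_fresh[OF assms(1)] derivable_is_formula[OF assms(3,1)] f(2)[THEN contra_subsetD]
        assms(7)[THEN contra_subsetD]
      in \<open>auto simp: rule_simps new_def intro!: inference.IotaI\<close>)
  then show ?thesis
  by (intro derivable_Infer[where r="\<lambda>_. AD" and Ps="\<lambda>_. [([], ?K, w, Eq (Iota x F) t)]"])
    (use assms atomic_not_Iota[OF assms(2)] in \<open>auto simp: rule_simps intro: inference.AD_Eq1\<close>)
qed

lemma ne0_IotaE1:
  assumes "wf_world w" "ne w (Eq (Iota x F) t)" "nf w (Eq u t)" "atomic_trm t" "atomic_trm u"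
    "is_formula ar (substf x u F)" "parf (substf x u F) \<subseteq> fst w"
  shows "ne0 w (substf x u F)"
  by (rule derivable_Infer[where r="\<lambda>_. IotaE1" and
        Ps="\<lambda>_. [([], neutral, w, Eq (Iota x F) t), ([], \<lambda>_. True, w, Eq u t)]"])
    (use assms in \<open>auto simp: rule_simps intro: inference.IotaE1\<close>)

lemma ne0_IotaE2:
  assumes "wf_world w" "ne w (Eq (Iota x F) t)" "nf w (substf x u F)" "nf w (Ext u)"
    "atomic_trm t" "atomic_trm u"
  shows "ne0 w (Eq u t)"
  by (rule derivable_Infer[where r="\<lambda>_. IotaE2" and
        Ps="\<lambda>_. [([], neutral, w, Eq (Iota x F) t), ([], \<lambda>_. True, w, substf x u F),
          ([], \<lambda>_. True, w, Ext u)]"])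
    (use assms derivable_is_formula[OF assms(2,1)] derivable_is_formula[OF assms(4,1)] in \<open>auto simp: rule_simps intro: inference.IotaE2\<close>)

section \<open>Worlds and covers\<close>

definition wle :: "('c, 'p) world \<Rightarrow> ('c, 'p) world \<Rightarrow> bool"  (infix "\<preceq>" 50) where
  "w \<preceq> w' \<longleftrightarrow> fst w \<subseteq> fst w' \<and> snd w \<subseteq> snd w' \<and> wf_world w'"

lemma wle_wf: "w \<preceq> w' \<Longrightarrow> wf_world w'"
  by (simp add: wle_def)

lemma wle_refl [simp]: "wf_world w \<Longrightarrow> w \<preceq> w"
  by (simp add: wle_def)

lemma wle_trans [trans]: "w \<preceq> w' \<Longrightarrow> w' \<preceq> w'' \<Longrightarrow> w \<preceq> w''"
  by (auto simp: wle_def)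

lemma derivable_wle: "derivable K w C \<Longrightarrow> w \<preceq> w' \<Longrightarrow> derivable K w' C"
  by (auto simp: wle_def intro: derivable_mono_world)

lemma wle_add:
  assumes "wf_world w" "is_formula ar A" "parf A \<subseteq> fst w"
  shows "w \<preceq> add w [(n, A)]"
  using assms by (auto simp: wle_def wf_world_def add_def)

lemma wle_new:
  assumes "wf_world w" "\<And>l. l \<in> set ls \<Longrightarrow> is_formula ar (snd l) \<and> parf (snd l) \<subseteq> insert a (fst w)"
  shows "w \<preceq> new w a ls"
  using assms unfolding wle_def wf_world_def new_def by fastforce

lemma add_mono: "w \<preceq> w' \<Longrightarrow> is_formula ar A \<Longrightarrow> parf A \<subseteq> fst w \<Longrightarrow> add w [(n, A)] \<preceq> add w' [(n, A)]"
  by (auto simp: wle_def add_def wf_world_def)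

lemma wf_assm:
  assumes "wf_world w" "l \<in> snd w"
  shows "is_formula ar (snd l) \<and> parf (snd l) \<subseteq> fst w"
proof -
  have "case l of (n, B) \<Rightarrow> is_formula ar B \<and> parf B \<subseteq> fst w"
    using assms unfolding wf_world_def by blast
  then show ?thesis
    by (simp add: split_beta)
qed

lemma new_mono: "w \<preceq> w' \<Longrightarrow> w \<preceq> new w a ls \<Longrightarrow> new w a ls \<preceq> new w' a ls"
proof -
  assume w: "w \<preceq> w'" "w \<preceq> new w a ls"
  have "is_formula ar (snd l) \<and> parf (snd l) \<subseteq> insert a (fst w)" if "l \<in> set ls" for l
    using wf_assm[OF wle_wf[OF w(2)], of l] that by (simp add: new_def)
  then have "w' \<preceq> new w' a ls"
    using w(1) by (intro wle_new) (auto simp: wle_def)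
  then show ?thesis
    using w by (auto simp: wle_def new_def)
qed

lemma ne_EqE_left:
  assumes "wf_world w" "ne w (Eq s t)" "nf w (Eq s r)" "s \<noteq> t"
  shows "ne w (Eq t r)"
\<comment> \<open>\<open>Var 0\<close> marks the argument to be replaced; \<open>r\<close> is
  closed, so substitution touches nothing else.\<close>
proof (rule ne_EqE[where A="Eq (Var 0) r" and x=0, OF assms(1,2,4)])
  have "fvt r = {}"
    using derivable_is_formula(1)[OF assms(3,1)] by (simp add: is_formula_def)
  then have "substt 0 u r = r" for u
    by (simp add: subst_closed)
  then show "nf w (substf 0 s (Eq (Var 0) r))" "Eq t r = substf 0 t (Eq (Var 0) r)"
    using assms(3) by auto
qed (use derivable_is_formula[OF assms(2,1)] derivable_is_formula[OF assms(3,1)] in \<open>auto simp: is_formula_def\<close>)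

lemma ne_EqE_right:
  assumes "wf_world w" "ne w (Eq s t)" "nf w (Eq r s)" "s \<noteq> t"
  shows "ne w (Eq r t)"
proof (rule ne_EqE[where A="Eq r (Var 0)" and x=0, OF assms(1,2,4)])
  have "fvt r = {}"
    using derivable_is_formula(1)[OF assms(3,1)] by (simp add: is_formula_def)
  then have "substt 0 u r = r" for u
    by (simp add: subst_closed)
  then show "nf w (substf 0 s (Eq r (Var 0)))" "Eq r t = substf 0 t (Eq r (Var 0))"
    using assms(3) by auto
qed (use derivable_is_formula[OF assms(2,1)] derivable_is_formula[OF assms(3,1)] in \<open>auto simp: is_formula_def\<close>)

text \<open>What becomes available when an \<open>EqI\<close> names \<open>t\<close> by a fresh
  \<open>a\<close>. Freshness makes \<open>a\<close> and \<open>t\<close> distinct, which both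
  \<open>AD\<close> on \<open>a = t\<close> and later non-vacuous uses of \<open>EqE\<close>
  require.\<close>

lemma witness:
  assumes "wf_world w" "nf w (Ext t)" "a \<notin> fst w" and [simp]: "w1 = new w a [(1, Eq (Par a) t)]"
  shows "w \<preceq> w1" "ne w1 (Eq (Par a) t)" "nf w1 (Ext (Par a))" "t \<noteq> Par a" "a \<in> fst w1"
proof -
  show "w \<preceq> w1"
    using assms(1) derivable_is_formula[OF assms(2,1)] by (auto simp: is_formula_def intro!: wle_new)
  then have wf_world: "wf_world w1"
    by (rule wle_wf)
  show "t \<noteq> Par a"
    using derivable_is_formula(2)[OF assms(2,1)] assms(3) by auto
  then show "nf w1 (Ext (Par a))"
    using wf_world by (intro nf_AD_witness[of _ a t]) (auto simp: new_def)
  show "ne w1 (Eq (Par a) t)"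
    using ne_Assm[OF wf_world, of "(1, Eq (Par a) t)"] by (simp add: new_def)
  show "a \<in> fst w1"
    by (simp add: new_def)
qed

text \<open>Above an \<open>EqI\<close> the assumption \<open>a = s\<close>, used as both premises
  of \<open>EqE\<close>, yields \<open>s = s\<close>. Only the conclusion of that \<open>EqI\<close>
  is restricted, so \<open>s = s\<close> may be used for any other goal.\<close>

lemma nf_using_refl:
  assumes "wf_world w" "nf w (Ext s)" "is_formula ar C" "parf C \<subseteq> fst w" "C \<noteq> Eq s s"
    "\<And>w'. w \<preceq> w' \<Longrightarrow> nf w' (Eq s s) \<Longrightarrow> nf w' C"
  shows "nf w C"
proof (rule nf_EqI[OF assms(1-5)])
  fix a assume a: "a \<notin> fst w"
  note w = witness[OF assms(1,2) a refl]
  have "ne (new w a [(1, Eq (Par a) s)]) (Eq s s)"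
    using ne_EqE_left[OF wle_wf[OF w(1)] w(2) nf_ne[OF w(2)]] w(4) by metis
  then show "nf (new w a [(1, Eq (Par a) s)]) C"
    using assms(6) w(1) nf_ne by blast
qed

text \<open>
  Inferring \<open>t = t\<close> from \<open>\<exists>!t\<close> by \<open>EqI\<close> would create a maximal \<open>Ext\<close>-segment.  The way around is to
  apply \<open>EqI\<close> to the existence of the different term \<open>\<iota>y (y = t)\<close>.
\<close>

lemma nf_refl:
  assumes "wf_world w" "nf w (Ext t)"
  shows "nf w (Eq t t)"
proof -
  let ?F = "Eq (Var 0) t" let ?s = "Iota 0 ?F"
  have t: "fvt t = {}" "arityt ar t" "part t \<subseteq> fst w"
    using derivable_is_formula[OF assms(2,1)] by (auto simp: is_formula_def)
  have F: "substf 0 u ?F = Eq u t" for u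
    using t by (simp add: subst_closed)
  \<comment> \<open>The detour term properly contains \<open>t\<close>; this is what permits
    \<open>EqI\<close> on the existence of \<open>?s\<close> with conclusion
    \<open>t = t\<close>.\<close>
  have st: "?s \<noteq> t"
  proof
    assume "?s = t"
    then have "size ?s = size t" by simp
    then show False by simp
  qed
  have ext: "nf w (Ext ?s)"
  proof (rule nf_EqI[OF assms])
    fix a assume a: "a \<notin> fst w"
    let ?w1 = "new w a [(1, Eq (Par a) t)]"
    note w1 = witness[OF assms a refl]
    note wf1 = wle_wf[OF w1(1)]
    have t1: "part t \<subseteq> fst ?w1"
      using t by (auto simp: new_def)
    show "nf ?w1 (Ext ?s)"
    proof (rule nf_Ext_Iota[of _ "Par a", OF wf1 _ w1(3)])
      fix b assume b: "b \<notin> fst ?w1"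
      let ?w2 = "new ?w1 b [(0, Eq (Par b) (Par a))]"
      have w2: "?w1 \<preceq> ?w2"
        using wf1 w1(5) by (intro wle_new) (auto simp: is_formula_def)
      have "nf ?w2 (Eq (Par b) (Par a))"
        using ne_Assm[OF wle_wf[OF w2], of "(0, Eq (Par b) (Par a))"] nf_ne by (simp add: new_def)
      then show "nf ?w2 (substf 0 (Par b) ?F)"
        using ne_EqE_right[OF wle_wf[OF w2] derivable_wle[OF w1(2) w2]] w1(4) nf_ne F by metis
      let ?w3 = "new ?w1 b [(0, substf 0 (Par b) ?F), (0, Ext (Par b))]"
      have w3: "?w1 \<preceq> ?w3"
        using wf1 t t1 by (intro wle_new) (auto simp: is_formula_def subst_closed)
      note wf3 = wle_wf[OF w3]
      show "nf ?w3 (Eq (Par b) (Par a))"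
      \<comment> \<open>To turn \<open>a = t\<close> into \<open>t = a\<close> one needs
        \<open>a = a\<close>; it is available here because the goal \<open>b = a\<close> is a
        different formula, \<open>b\<close> being fresh.\<close>
      proof (rule nf_using_refl[OF wf3 derivable_wle[OF w1(3) w3]])
        fix w' assume w': "?w3 \<preceq> w'" and aa: "nf w' (Eq (Par a) (Par a))"
        note wf' = wle_wf[OF w']
        note le = wle_trans[OF w3 w']
        have ta: "ne w' (Eq t (Par a))"
          using ne_EqE_left[OF wf' derivable_wle[OF w1(2) le] aa] w1(4) by metis
        have "ne ?w3 (substf 0 (Par b) ?F)"
          using ne_Assm[OF wf3, of "(0, substf 0 (Par b) ?F)"] by (simp add: new_def)
        then have "nf w' (Eq (Par b) t)"
          using derivable_wle[OF nf_ne w'] F by simp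
        then show "nf w' (Eq (Par b) (Par a))"
          using ne_EqE_right[OF wf' ta] w1(4) nf_ne by metis
      qed (use b w1(5) in \<open>auto simp: is_formula_def new_def\<close>)
    qed (use t t1 in \<open>auto simp: is_formula_def atomic_trm_def\<close>)
  qed (use t in \<open>auto simp: is_formula_def\<close>)
  show ?thesis
  proof (rule nf_EqI[OF assms(1) ext])
    fix c assume c: "c \<notin> fst w"
    let ?w1 = "new w c [(1, Eq (Par c) ?s)]"
    note w1 = witness[OF assms(1) ext c refl]
    note wf1 = wle_wf[OF w1(1)]
    have ct: "Par c \<noteq> t"
      using c t by auto
    show "nf ?w1 (Eq t t)"
    proof (rule nf_using_refl[OF wf1 w1(3)])
      fix w' assume w': "?w1 \<preceq> w'" and cc: "nf w' (Eq (Par c) (Par c))"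
      note wf' = wle_wf[OF w']
      have "ne w' (Eq ?s (Par c))"
        using ne_EqE_left[OF wf' derivable_wle[OF w1(2) w'] cc] by simp
      \<comment> \<open>With \<open>?s = c\<close> and \<open>c = c\<close> as premises,
        \<open>IotaE1\<close> returns the describing condition of \<open>c\<close>, that is
        \<open>c = t\<close>; used as both premises of \<open>EqE\<close> this gives
        \<open>t = t\<close>.\<close>
      then have "ne0 w' (substf 0 (Par c) ?F)"
        using cc t w' w1(1,5) by (intro ne0_IotaE1[OF wf'])
          (auto simp: atomic_trm_def subst_closed is_formula_def wle_def)
      then have "ne w' (Eq (Par c) t)"
        using F ne_ne0 by simp
      then show "nf w' (Eq t t)"
        using ne_EqE_left[OF wf'] ct nf_ne by metis
    qed (use t w1(1) ct in \<open>auto simp: is_formula_def wle_def\<close>)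
  qed (use t st in \<open>auto simp: is_formula_def\<close>)
qed

text \<open>A Beth-style covering relation generated by the three segment rules. \<open>DisE\<close>
  and \<open>ExiE\<close> are eliminations and need neutral major premises, whereas
  \<open>EqI\<close> is an introduction rule and is restricted only in its conclusion, so a normal
  premise is enough there.\<close>

inductive cover :: "(('c, 'p) world \<Rightarrow> bool) \<Rightarrow> ('c, 'p) world \<Rightarrow> bool" for P where
  cover_ret: "P w \<Longrightarrow> cover P w"
| cover_dis: "ne w (Dis A B) \<Longrightarrow> cover P (add w [(0, A)]) \<Longrightarrow> cover P (add w [(0, B)]) \<Longrightarrow> cover P w"
| cover_exi: "ne w (Exi x A) \<Longrightarrow>
    (\<And>a. a \<notin> fst w \<Longrightarrow> cover P (new w a [(0, substf x (Par a) A), (0, Ext (Par a))])) \<Longrightarrow> cover P w"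
| cover_eq: "nf w (Ext t) \<Longrightarrow> (\<And>a. a \<notin> fst w \<Longrightarrow> cover P (new w a [(1, Eq (Par a) t)])) \<Longrightarrow> cover P w"

lemma wle_dis:
  assumes "wf_world w" "ne w (Dis A B)"
  shows "w \<preceq> add w [(n, A)]" "w \<preceq> add w [(n, B)]"
  using assms derivable_is_formula[OF assms(2,1)] by (auto simp: is_formula_def intro: wle_add)

lemma wle_exi:
  assumes "wf_world w" "ne w (Exi x A)"
  shows "w \<preceq> new w a [(0, substf x (Par a) A), (0, Ext (Par a))]"
proof (rule wle_new[OF assms(1)])
  have "arityf ar A" "fvf A \<subseteq> {x}" "parf A \<subseteq> fst w"
    using derivable_is_formula[OF assms(2,1)] by (auto simp: is_formula_def)
  then have "is_formula ar (substf x (Par a) A)" "parf (substf x (Par a) A) \<subseteq> insert a (fst w)"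
    using is_formula_subst[of "Par a" ar A x] par_subst(2)[of x "Par a" A]
    by (auto simp: atomic_trm_def)
  then show "is_formula ar (snd l) \<and> parf (snd l) \<subseteq> insert a (fst w)"
    if "l \<in> set [(0, substf x (Par a) A), (0, Ext (Par a))]" for l
    using that by (auto simp: is_formula_def)
qed

text \<open>Parameters fresh for the larger world are fresh for the smaller one; for this reason the
  cover clauses range over all fresh parameters rather than a chosen one.\<close>

lemma cover_mono_world:
  assumes "cover P w" "w \<preceq> w'" "wf_world w" "\<And>v v'. P v \<Longrightarrow> wf_world v \<Longrightarrow> v \<preceq> v' \<Longrightarrow> P v'"
  shows "cover P w'"
  using assms(1-3)
proof (induction arbitrary: w')
  case (cover_ret w)
  then show ?case using assms(4) cover.cover_ret by blast
next
  case (cover_dis w A B)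
  note le = wle_dis[OF cover_dis.prems(2) cover_dis.hyps(1)]
  have "add w [(0, A)] \<preceq> add w' [(0, A)]" "add w [(0, B)] \<preceq> add w' [(0, B)]"
    using derivable_is_formula[OF cover_dis.hyps(1) cover_dis.prems(2)] cover_dis.prems(1)
    by (auto simp: is_formula_def intro: add_mono)
  then show ?case
    using cover_dis.IH le wle_wf derivable_wle[OF cover_dis.hyps(1) cover_dis.prems(1)] cover.cover_dis by blast
next
  case (cover_exi w x A)
  note n = derivable_wle[OF cover_exi.hyps(1) cover_exi.prems(1)]
  show ?case
  proof (rule cover.cover_exi[OF n])
    fix a assume "a \<notin> fst w'"
    then have "a \<notin> fst w"
      using cover_exi.prems(1) by (auto simp: wle_def)
    then show "cover P (new w' a [(0, substf x (Par a) A), (0, Ext (Par a))])"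
      using cover_exi.IH wle_exi[OF cover_exi.prems(2) cover_exi.hyps(1)] new_mono[OF cover_exi.prems(1)] wle_wf
      by blast
  qed
next
  case (cover_eq w t)
  note n = derivable_wle[OF cover_eq.hyps(1) cover_eq.prems(1)]
  show ?case
  proof (rule cover.cover_eq[OF n])
    fix a assume "a \<notin> fst w'"
    then have "a \<notin> fst w"
      using cover_eq.prems(1) by (auto simp: wle_def)
    then show "cover P (new w' a [(1, Eq (Par a) t)])"
      using cover_eq.IH witness(1)[OF cover_eq.prems(2) cover_eq.hyps(1) _ refl] new_mono[OF cover_eq.prems(1)] wle_wf
      by blast
  qed
qed

lemma cover_bind:
  assumes "cover P w" "wf_world w" "\<And>w'. w \<preceq> w' \<Longrightarrow> P w' \<Longrightarrow> cover Q w'"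
  shows "cover Q w"
  using assms
proof induction
  case (cover_ret w)
  then show ?case by simp
next
  case (cover_dis w A B)
  note le = wle_dis[OF cover_dis.prems(1) cover_dis.hyps(1)]
  show ?case
    using cover_dis.IH le wle_wf wle_trans cover_dis.prems(2) cover.cover_dis[OF cover_dis.hyps(1)] by meson
next
  case (cover_exi w x A)
  note le = wle_exi[OF cover_exi.prems(1) cover_exi.hyps(1)]
  show ?case
    using cover_exi.IH le wle_wf wle_trans cover_exi.prems(2) cover.cover_exi[OF cover_exi.hyps(1)] by meson
next
  case (cover_eq w t)
  note le = witness(1)[OF cover_eq.prems(1) cover_eq.hyps(1) _ refl]
  show ?case
    using cover_eq.IH le wle_wf wle_trans cover_eq.prems(2) cover.cover_eq[OF cover_eq.hyps(1)] by meson
qed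

lemma cover_map:
  assumes "cover P w" "wf_world w" "\<And>w'. w \<preceq> w' \<Longrightarrow> P w' \<Longrightarrow> Q w'"
  shows "cover Q w"
  using assms cover_bind cover_ret by metis

text \<open>A cover is the skeleton of nested applications of \<open>DisE\<close>,
  \<open>ExiE\<close> and \<open>EqI\<close>, with deductions of \<open>C\<close> placed at its
  leaves.\<close>

lemma nf_cover:
  assumes "cover (\<lambda>w. nf w C) w" "wf_world w" "is_formula ar C" "parf C \<subseteq> fst w"
  shows "nf w C"
  using assms
proof induction
  case (cover_dis w A B)
  note le = wle_dis[OF cover_dis.prems(1) cover_dis.hyps(1)]
  have "parf C \<subseteq> fst (add w [(n, B)])" for n B
    using cover_dis.prems by (simp add: add_def)
  then show ?case
    using cover_dis le wle_wf nf_DisE by blast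
next
  case (cover_exi w x A)
  have "parf C \<subseteq> fst (new w a ls)" for a ls
    using cover_exi.prems by (auto simp: new_def)
  then show ?case
    using cover_exi.prems cover_exi.IH wle_wf[OF wle_exi[OF cover_exi.prems(1) cover_exi.hyps(1)]]
    by (intro nf_ExiE[OF _ cover_exi.hyps(1)]) auto
next
  \<comment> \<open>If \<open>C\<close> is \<open>t = t\<close>, then \<open>EqI\<close> is not
    allowed and \<open>nf_refl\<close> derives \<open>C\<close> from the existence of
    \<open>t\<close> instead.\<close>
  case (cover_eq w t)
  have "parf C \<subseteq> fst (new w a ls)" for a ls
    using cover_eq.prems by (auto simp: new_def)
  then show ?case
    using cover_eq.prems cover_eq.IH witness(1)[OF cover_eq.prems(1) cover_eq.hyps(1) _ refl] wle_wf
      nf_refl[OF _ cover_eq.hyps(1)] nf_EqI[OF _ cover_eq.hyps(1)] by metis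
qed

lemma nf_cover_bind:
  assumes "cover P w" "wf_world w" "is_formula ar C" "parf C \<subseteq> fst w" "\<And>w'. w \<preceq> w' \<Longrightarrow> P w' \<Longrightarrow> nf w' C"
  shows "nf w C"
  using assms cover_map[of P w "\<lambda>w. nf w C"] nf_cover by blast

section \<open>Interpretation\<close>

definition atom_in :: "('c, 'p) world \<Rightarrow> ('c, 'p) trm \<Rightarrow> bool" where
  "atom_in w u \<longleftrightarrow> atomic_trm u \<and> part u \<subseteq> fst w"

definition exists_at :: "('c, 'p) world \<Rightarrow> ('c, 'p) trm \<Rightarrow> bool" where
  "exists_at w u \<longleftrightarrow> cover (\<lambda>w. nf w (Ext u)) w"

text \<open>Transporting along an identity takes a neutral major premise of \<open>EqE\<close>, but
  \<open>nf_refl\<close> provides only a normal \<open>t = t\<close>. Syntactic equality is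
  therefore a separate case, in which nothing has to be transported.\<close>

definition eq_or_ne :: "('c, 'p) world \<Rightarrow> ('c, 'p) trm \<Rightarrow> ('c, 'p) trm \<Rightarrow> bool" where
  "eq_or_ne w s t \<longleftrightarrow> s = t \<or> ne w (Eq s t)"

text \<open>Identity has existential import, as \<open>AD\<close> demands:
  \<open>equal_at w u u\<close> amounts to the existence of \<open>u\<close>.\<close>

definition equal_at :: "('c, 'p) world \<Rightarrow> ('c, 'p) trm \<Rightarrow> ('c, 'p) trm \<Rightarrow> bool" where
  "equal_at w u v \<longleftrightarrow> exists_at w u \<and> exists_at w v \<and> cover (\<lambda>w. eq_or_ne w u v) w"

text \<open>
  \<open>den t \<rho> e w u\<close> says that \<open>t\<close> denotes the atomic term \<open>u\<close>; for complex terms this is Russell's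
  clause.  \<open>Bot\<close> is interpreted by worlds with a neutral deduction of \<open>Bot\<close> instead of a cover by no
  world at all, so that \<open>nf_cover\<close> does not need \<open>BotE\<close>, whose conclusions have to be prime.
\<close>

primrec den :: "('c, 'p) trm \<Rightarrow> (param \<Rightarrow> ('c, 'p) trm) \<Rightarrow> (var \<Rightarrow> ('c, 'p) trm) \<Rightarrow>
      ('c, 'p) world \<Rightarrow> ('c, 'p) trm \<Rightarrow> bool"
  and sem :: "('c, 'p) fm \<Rightarrow> (param \<Rightarrow> ('c, 'p) trm) \<Rightarrow> (var \<Rightarrow> ('c, 'p) trm) \<Rightarrow>
      ('c, 'p) world \<Rightarrow> bool" where
  "den (Var x) \<rho> e w u = equal_at w (e x) u"
| "den (Par a) \<rho> e w u = equal_at w (\<rho> a) u"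
| "den (Cst c) \<rho> e w u = equal_at w (Cst c) u"
| "den (Iota x F) \<rho> e w u = (exists_at w u \<and> (\<forall>w' v. w \<preceq> w' \<longrightarrow> atom_in w' v \<longrightarrow>
     (equal_at w' v u \<longleftrightarrow> exists_at w' v \<and> sem F \<rho> (e(x := v)) w')))"
| "sem Bot \<rho> e w = cover (\<lambda>w. ne w Bot) w"
| "sem (Pred R ts) \<rho> e w =
     cover (\<lambda>w. \<exists>us. list_all2 (\<lambda>d u. atom_in w u \<and> d \<rho> e w u) (map den ts) us \<and> nf w (Pred R us)) w"
| "sem (Eq s t) \<rho> e w = cover (\<lambda>w. \<exists>u. atom_in w u \<and> den s \<rho> e w u \<and> den t \<rho> e w u) w"
| "sem (Ext t) \<rho> e w = cover (\<lambda>w. \<exists>u. atom_in w u \<and> den t \<rho> e w u) w"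
| "sem (Con A B) \<rho> e w = (sem A \<rho> e w \<and> sem B \<rho> e w)"
| "sem (Dis A B) \<rho> e w = cover (\<lambda>w. sem A \<rho> e w \<or> sem B \<rho> e w) w"
| "sem (Imp A B) \<rho> e w = (\<forall>w'. w \<preceq> w' \<longrightarrow> sem A \<rho> e w' \<longrightarrow> sem B \<rho> e w')"
| "sem (All x A) \<rho> e w =
     (\<forall>w' u. w \<preceq> w' \<longrightarrow> atom_in w' u \<longrightarrow> exists_at w' u \<longrightarrow> sem A \<rho> (e(x := u)) w')"
| "sem (Exi x A) \<rho> e w = cover (\<lambda>w. \<exists>u. atom_in w u \<and> exists_at w u \<and> sem A \<rho> (e(x := u)) w) w"

lemma sem_Pred:
  "sem (Pred R ts) \<rho> e w =
    cover (\<lambda>w. \<exists>us. list_all2 (\<lambda>t u. atom_in w u \<and> den t \<rho> e w u) ts us \<and> nf w (Pred R us)) w"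
  by (simp add: list_all2_map1)

declare sem.simps(2) [simp del] sem_Pred [simp] split_paired_All [simp del] split_paired_Ex [simp del]

lemma atom_in_mono: "atom_in w u \<Longrightarrow> w \<preceq> w' \<Longrightarrow> atom_in w' u"
  by (auto simp: atom_in_def wle_def)

lemma eq_or_ne_mono: "eq_or_ne w s t \<Longrightarrow> w \<preceq> w' \<Longrightarrow> eq_or_ne w' s t"
  by (auto simp: eq_or_ne_def dest: derivable_wle)

lemma exists_at_mono: "exists_at w u \<Longrightarrow> wf_world w \<Longrightarrow> w \<preceq> w' \<Longrightarrow> exists_at w' u"
  unfolding exists_at_def by (rule cover_mono_world) (auto dest: derivable_wle)

lemma equal_at_mono: "equal_at w u v \<Longrightarrow> wf_world w \<Longrightarrow> w \<preceq> w' \<Longrightarrow> equal_at w' u v"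
  unfolding equal_at_def using exists_at_mono cover_mono_world[of "\<lambda>w. eq_or_ne w u v"] eq_or_ne_mono by blast

lemma sem_mono:
  shows "den t \<rho> e w u \<Longrightarrow> wf_world w \<Longrightarrow> w \<preceq> w' \<Longrightarrow> den t \<rho> e w' u"
    and "sem A \<rho> e w \<Longrightarrow> wf_world w \<Longrightarrow> w \<preceq> w' \<Longrightarrow> sem A \<rho> e w'"
proof (induction t and A arbitrary: e w w' u and e w w')
  case (Iota x F)
  then show ?case by (auto intro: exists_at_mono dest: wle_trans)
next
  case Bot
  then show ?case by (auto elim!: cover_mono_world dest: derivable_wle)
next
  case (Pred R ts)
  let ?P = "\<lambda>us w. list_all2 (\<lambda>t u. atom_in w u \<and> den t \<rho> e w u) ts us \<and> nf w (Pred R us)"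
  have "?P us v'" if "?P us v" "wf_world v" "v \<preceq> v'" for us v v'
  proof
    have "list_all2 (\<lambda>t u. atom_in v u \<and> den t \<rho> e v u) ts us"
      using that by blast
    then show "list_all2 (\<lambda>t u. atom_in v' u \<and> den t \<rho> e v' u) ts us"
      by (rule list.rel_mono_strong) (use that Pred.IH atom_in_mono in blast)
    show "nf v' (Pred R us)"
      using that derivable_wle by blast
  qed
  then show ?case
    using Pred.prems unfolding sem_Pred by (elim cover_mono_world) blast+
next
  case (Eq s t)
  then show ?case
    unfolding sem.simps by (elim cover_mono_world) (blast intro: atom_in_mono)+
next
  case (Ext t)
  then show ?case
    unfolding sem.simps by (elim cover_mono_world) (blast intro: atom_in_mono)+
next
  case (Dis A B)
  then show ?case
    unfolding sem.simps by (elim cover_mono_world) blast+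
next
  case (Exi x A)
  then show ?case
    unfolding sem.simps by (elim cover_mono_world) (blast intro: atom_in_mono exists_at_mono)+
qed (auto intro: equal_at_mono dest: wle_trans)

lemma exists_at_cover: "cover (\<lambda>w. exists_at w u) w \<Longrightarrow> wf_world w \<Longrightarrow> exists_at w u"
  unfolding exists_at_def by (rule cover_bind)

lemma equal_at_cover:
  assumes "cover (\<lambda>w. equal_at w u v) w" "wf_world w"
  shows "equal_at w u v"
  unfolding equal_at_def
proof (intro conjI)
  show "exists_at w u" "exists_at w v"
    by (rule exists_at_cover[OF cover_map[OF assms] assms(2)], simp add: equal_at_def)+
  show "cover (\<lambda>w. eq_or_ne w u v) w"
    by (rule cover_bind[OF assms]) (simp add: equal_at_def)
qed

lemma sem_cover_mono: "cover (\<lambda>w. sem A \<rho> e w) w \<Longrightarrow> wf_world w \<Longrightarrow> w \<preceq> w' \<Longrightarrow> cover (\<lambda>w. sem A \<rho> e w) w'"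
  by (erule cover_mono_world) (auto intro: sem_mono(2))

text \<open>The gluing property. Clauses that are covers absorb a further cover by
  \<open>cover_bind\<close>; clauses about later worlds carry the cover over to the later world and
  glue there by induction.\<close>

lemma sem_cover:
  shows "cover (\<lambda>w. den t \<rho> e w u) w \<Longrightarrow> wf_world w \<Longrightarrow> den t \<rho> e w u"
    and "cover (\<lambda>w. sem A \<rho> e w) w \<Longrightarrow> wf_world w \<Longrightarrow> sem A \<rho> e w"
proof (induction t and A arbitrary: e w u and e w)
  case (Iota x F)
  let ?I = "\<lambda>w. den (Iota x F) \<rho> e w u"
  have "exists_at w u"
    by (rule exists_at_cover[OF cover_map[OF Iota.prems] Iota.prems(2)]) simp
  moreover have "equal_at w' v u \<longleftrightarrow> exists_at w' v \<and> sem F \<rho> (e(x := v)) w'" if w': "w \<preceq> w'" "atom_in w' v" for w' v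
  proof -
    \<comment> \<open>At each world of this cover Russell's biconditional holds; each of its sides
      is persistent and can be glued, so it holds at \<open>w'\<close>.\<close>
    have cover: "cover ?I w'"
      using cover_mono_world[OF Iota.prems(1) w'(1) Iota.prems(2)] sem_mono(1) by blast
    have I: "equal_at w'' v u \<longleftrightarrow> exists_at w'' v \<and> sem F \<rho> (e(x := v)) w''" if "w' \<preceq> w''" "?I w''" for w''
      using that(2) atom_in_mono[OF w'(2) that(1)] wle_refl[OF wle_wf[OF that(1)]]
      unfolding den.simps by blast
    have wf_world: "wf_world w'"
      using w'(1) by (rule wle_wf)
    show ?thesis
    proof
      assume e: "equal_at w' v u"
      have "cover (\<lambda>w. sem F \<rho> (e(x := v)) w) w'"
        using I equal_at_mono[OF e wf_world] by (intro cover_map[OF cover wf_world]) blast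
      then show "exists_at w' v \<and> sem F \<rho> (e(x := v)) w'"
        using e Iota.IH[OF _ wf_world] by (simp add: equal_at_def)
    next
      assume e: "exists_at w' v \<and> sem F \<rho> (e(x := v)) w'"
      have "cover (\<lambda>w. equal_at w v u) w'"
        using I exists_at_mono[OF _ wf_world] sem_mono(2)[OF _ wf_world] e by (intro cover_map[OF cover wf_world]) blast
      then show "equal_at w' v u"
        using equal_at_cover wf_world by blast
    qed
  qed
  ultimately show ?case by simp
next
  case (Con A B)
  then show ?case
    using cover_map[of "\<lambda>w. sem (Con A B) \<rho> e w" w] by simp
next
  case (Imp A B)
  have "sem B \<rho> e w'" if w': "w \<preceq> w'" "sem A \<rho> e w'" for w'
  proof -
    have "cover (\<lambda>w. sem B \<rho> e w) w'"
      using sem_mono(2)[OF w'(2)] wle_wf w'(1) wle_refl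
      by (intro cover_map[OF sem_cover_mono[OF Imp.prems w'(1)] wle_wf[OF w'(1)]]) fastforce
    then show ?thesis
      using Imp.IH w' wle_wf by blast
  qed
  then show ?case by simp
next
  case (All x A)
  have "sem A \<rho> (e(x := u)) w'" if w': "w \<preceq> w'" "atom_in w' u" "exists_at w' u" for w' u
  proof -
    have "cover (\<lambda>w. sem A \<rho> (e(x := u)) w) w'"
      using atom_in_mono[OF w'(2)] exists_at_mono[OF w'(3)] wle_wf w'(1) wle_refl
      by (intro cover_map[OF sem_cover_mono[OF All.prems w'(1)] wle_wf[OF w'(1)]]) fastforce
    then show ?thesis
      using All.IH w' wle_wf by blast
  qed
  then show ?case by simp
qed (auto intro: equal_at_cover cover_bind)

lemma sem_cover_bind:
  assumes "cover P w" "wf_world w" "\<And>w'. w \<preceq> w' \<Longrightarrow> P w' \<Longrightarrow> sem A \<rho> e w'"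
  shows "sem A \<rho> e w"
  using sem_cover(2)[OF cover_map[OF assms(1,2)] assms(2)] assms(3) by blast

section \<open>Existence and identity of individuals\<close>

lemma exists_at_nf:
  assumes "exists_at w u" "atom_in w u" "wf_world w"
  shows "nf w (Ext u)"
  using assms nf_cover[of "Ext u" w] atomic_trm_simps[of u]
  by (auto simp: exists_at_def atom_in_def is_formula_def)

lemma nf_exists_at: "nf w (Ext u) \<Longrightarrow> exists_at w u"
  by (simp add: exists_at_def cover_ret)

lemma equal_at_refl: "exists_at w u \<Longrightarrow> equal_at w u u"
  by (simp add: equal_at_def eq_or_ne_def cover_ret)

text \<open>\<open>EqE\<close> with major premise \<open>s = t\<close> turns \<open>s = s\<close>
  into \<open>t = s\<close>; the existence of \<open>s\<close> is what yields
  \<open>s = s\<close>.\<close>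

lemma eq_or_ne_sym:
  assumes "eq_or_ne w s t" "nf w (Ext s)" "wf_world w"
  shows "eq_or_ne w t s"
  using assms ne_EqE_left[of w s t s] nf_refl[of w s] by (auto simp: eq_or_ne_def)

lemma eq_or_ne_trans:
  assumes "eq_or_ne w r s" "eq_or_ne w s t" "wf_world w"
  shows "eq_or_ne w r t"
  using assms ne_EqE_right[of w s t r] nf_ne[of w "Eq r s"] by (auto simp: eq_or_ne_def)

lemma cover_eq_or_ne_sym:
  assumes "cover (\<lambda>w. eq_or_ne w s t) w" "exists_at w s" "wf_world w"
  shows "cover (\<lambda>w. eq_or_ne w t s) w"
proof (rule cover_bind)
  show "cover (\<lambda>w. nf w (Ext s)) w"
    using assms by (simp add: exists_at_def)
  fix w' assume w': "w \<preceq> w'" "nf w' (Ext s)"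
  have "cover (\<lambda>w. eq_or_ne w s t) w'"
    using cover_mono_world[OF assms(1) w'(1) assms(3)] eq_or_ne_mono by blast
  then show "cover (\<lambda>w. eq_or_ne w t s) w'"
    using w' by (elim cover_map) (auto intro: wle_wf eq_or_ne_sym derivable_wle)
qed (rule assms)

lemma cover_eq_or_ne_trans:
  assumes "cover (\<lambda>w. eq_or_ne w r s) w" "cover (\<lambda>w. eq_or_ne w s t) w" "wf_world w"
  shows "cover (\<lambda>w. eq_or_ne w r t) w"
proof (rule cover_bind[OF assms(1,3)])
  fix w' assume w': "w \<preceq> w'" "eq_or_ne w' r s"
  have "cover (\<lambda>w. eq_or_ne w s t) w'"
    using cover_mono_world[OF assms(2) w'(1) assms(3)] eq_or_ne_mono by blast
  then show "cover (\<lambda>w. eq_or_ne w r t) w'"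
    using w' by (elim cover_map) (auto intro: wle_wf eq_or_ne_trans eq_or_ne_mono)
qed

lemma equal_at_sym: "equal_at w u v \<Longrightarrow> wf_world w \<Longrightarrow> equal_at w v u"
  by (simp add: equal_at_def cover_eq_or_ne_sym)

lemma equal_at_trans: "equal_at w u v \<Longrightarrow> equal_at w v z \<Longrightarrow> wf_world w \<Longrightarrow> equal_at w u z"
  unfolding equal_at_def using cover_eq_or_ne_trans by blast

lemma den_exists_at: "den t \<rho> e w u \<Longrightarrow> exists_at w u"
  by (cases t) (auto simp: equal_at_def)

lemma den_equal_at:
  assumes "den t \<rho> e w u" "equal_at w u v" "wf_world w"
  shows "den t \<rho> e w v"
proof (cases t)
  case (Iota x F)
  have "equal_at w' z u \<longleftrightarrow> equal_at w' z v" if "w \<preceq> w'" for w' z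
    using that equal_at_mono[OF assms(2,3)] equal_at_trans equal_at_sym wle_wf by metis
  then show ?thesis
    using assms Iota by (auto simp: equal_at_def)
qed (use assms in \<open>auto intro: equal_at_trans\<close>)

text \<open>For a description both Russell clauses are applied to \<open>u\<close> at
  \<open>w\<close> itself: the clause of \<open>u\<close> shows that \<open>u\<close> satisfies the
  description, and the clause of \<open>v\<close> then makes it equal to \<open>v\<close>.\<close>

lemma den_unique:
  assumes "den t \<rho> e w u" "den t \<rho> e w v" "atom_in w u" "wf_world w"
  shows "equal_at w u v"
proof (cases t)
  case (Iota x F)
  then show ?thesis
    using assms equal_at_refl[of w u] wle_refl by simp
qed (use assms in \<open>auto intro: equal_at_trans equal_at_sym\<close>)

lemma cover_cong:
  assumes "wf_world w" "\<And>w'. w \<preceq> w' \<Longrightarrow> P w' = Q w'"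
  shows "cover P w = cover Q w"
  using assms cover_map by metis

lemma sem_cong:
  shows "(\<And>x. x \<in> fvt t \<Longrightarrow> e x = e' x) \<Longrightarrow> (\<And>a. a \<in> part t \<Longrightarrow> \<rho> a = \<rho>' a) \<Longrightarrow>
      den t \<rho> e w u = den t \<rho>' e' w u"
    and "(\<And>x. x \<in> fvf A \<Longrightarrow> e x = e' x) \<Longrightarrow> (\<And>a. a \<in> parf A \<Longrightarrow> \<rho> a = \<rho>' a) \<Longrightarrow>
      sem A \<rho> e w = sem A \<rho>' e' w"
proof (induction t and A arbitrary: e e' w u and e e' w)
  case (Iota x F)
  have "sem F \<rho> (e(x := v)) w = sem F \<rho>' (e'(x := v)) w" for v w
    using Iota.prems by (intro Iota.IH) auto
  then show ?case by simp
next
  case (All x F)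
  have "sem F \<rho> (e(x := v)) w = sem F \<rho>' (e'(x := v)) w" for v w
    using All.prems by (intro All.IH) auto
  then show ?case by simp
next
  case (Exi x F)
  have "sem F \<rho> (e(x := v)) w = sem F \<rho>' (e'(x := v)) w" for v w
    using Exi.prems by (intro Exi.IH) auto
  then show ?case by simp
next
  case (Pred R ts)
  have d: "den t \<rho> e w u = den t \<rho>' e' w u" if "t \<in> set ts" for t w u
    using that Pred.prems by (intro Pred.IH) auto
  have "list_all2 (\<lambda>t u. atom_in w u \<and> den t \<rho> e w u) ts us =
      list_all2 (\<lambda>t u. atom_in w u \<and> den t \<rho>' e' w u) ts us" for w us
    by (intro list.rel_cong) (auto simp: d)
  then show ?case by simp
next
  case (Eq s t)
  have "den s \<rho> e w u = den s \<rho>' e' w u" "den t \<rho> e w u = den t \<rho>' e' w u" for w u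
    using Eq.prems by (auto intro!: Eq.IH)
  then show ?case by simp
next
  case (Ext t)
  have "den t \<rho> e w u = den t \<rho>' e' w u" for w u
    using Ext.prems by (auto intro!: Ext.IH)
  then show ?case by simp
next
  case (Con A B)
  have "sem A \<rho> e w = sem A \<rho>' e' w" "sem B \<rho> e w = sem B \<rho>' e' w" for w
    using Con.prems by (auto intro!: Con.IH)
  then show ?case by simp
next
  case (Dis A B)
  have "sem A \<rho> e w = sem A \<rho>' e' w" "sem B \<rho> e w = sem B \<rho>' e' w" for w
    using Dis.prems by (auto intro!: Dis.IH)
  then show ?case by simp
next
  case (Imp A B)
  have "sem A \<rho> e w = sem A \<rho>' e' w" "sem B \<rho> e w = sem B \<rho>' e' w" for w
    using Imp.prems by (auto intro!: Imp.IH)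
  then show ?case by simp
qed auto

section \<open>Substitution and replacement in the interpretation\<close>

lemma sem_subst:
  assumes "\<And>e w u. den t \<rho> e w u = equal_at w r u"
  shows "den (substt x t s) \<rho> e w u = den s \<rho> (e(x := r)) w u"
    and "sem (substf x t A) \<rho> e w = sem A \<rho> (e(x := r)) w"
proof (induction s and A arbitrary: e w u and e w)
  case (Pred R ts)
  then show ?case by (simp add: list_all2_map1 cong: list.rel_cong)
qed (use assms in \<open>auto simp: fun_upd_twist\<close>)

text \<open>The clauses look only at later worlds and at atomic terms of those worlds, so agreement
  of denotations there is enough. It is required for all variable environments because binders
  change them.\<close>

lemma sem_leibniz:
  assumes "\<And>e w u. v \<preceq> w \<Longrightarrow> atom_in w u \<Longrightarrow> den s \<rho> e w u = den t \<rho> e w u"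
  shows "v \<preceq> w \<Longrightarrow> atom_in w u \<Longrightarrow> den (substt x s r) \<rho> e w u = den (substt x t r) \<rho> e w u"
    and "v \<preceq> w \<Longrightarrow> sem (substf x s A) \<rho> e w = sem (substf x t A) \<rho> e w"
proof (induction r and A arbitrary: e w u and e w)
  case (Iota y F)
  show ?case
  proof (cases "y = x")
    case False
    have "sem (substf x s F) \<rho> e' w' = sem (substf x t F) \<rho> e' w'" if "w \<preceq> w'" for e' w'
      using Iota.IH Iota.prems(1) that wle_trans by blast
    then show ?thesis using False by auto
  qed simp
next
  case (Pred R ts)
  have d: "den (substt x s r) \<rho> e w' u = den (substt x t r) \<rho> e w' u"
    if "r \<in> set ts" "w \<preceq> w'" "atom_in w' u" for r w' u
    using that Pred wle_trans by blast
  have "list_all2 (\<lambda>r u. atom_in w' u \<and> den (substt x s r) \<rho> e w' u) ts us =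
      list_all2 (\<lambda>r u. atom_in w' u \<and> den (substt x t r) \<rho> e w' u) ts us"
    if "w \<preceq> w'" for w' us
    using that by (intro list.rel_cong) (auto simp: d)
  then show ?case
    using wle_wf[OF Pred.prems] by (auto simp: list_all2_map1 intro!: cover_cong)
next
  case (Eq r r')
  have "den (substt x s r) \<rho> e w' u = den (substt x t r) \<rho> e w' u"
    "den (substt x s r') \<rho> e w' u = den (substt x t r') \<rho> e w' u" if "w \<preceq> w'" "atom_in w' u" for w' u
    using that Eq wle_trans by blast+
  then show ?case
    using wle_wf[OF Eq.prems] by (auto intro!: cover_cong)
next
  case (Ext r)
  have "den (substt x s r) \<rho> e w' u = den (substt x t r) \<rho> e w' u" if "w \<preceq> w'" "atom_in w' u" for w' u
    using that Ext wle_trans by blast+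
  then show ?case
    using wle_wf[OF Ext.prems] by (auto intro!: cover_cong)
next
  case (Dis A B)
  have "sem (substf x s A) \<rho> e w' = sem (substf x t A) \<rho> e w'"
    "sem (substf x s B) \<rho> e w' = sem (substf x t B) \<rho> e w'" if "w \<preceq> w'" for w'
    using that Dis wle_trans by blast+
  then show ?case
    using wle_wf[OF Dis.prems] by (auto intro!: cover_cong)
next
  case (Imp A B)
  have "sem (substf x s A) \<rho> e w' = sem (substf x t A) \<rho> e w'"
    "sem (substf x s B) \<rho> e w' = sem (substf x t B) \<rho> e w'" if "w \<preceq> w'" for w'
    using that Imp wle_trans by blast+
  then show ?case by auto
next
  case (All y F)
  show ?case
  proof (cases "y = x")
    case False
    have "sem (substf x s F) \<rho> e' w' = sem (substf x t F) \<rho> e' w'" if "w \<preceq> w'" for e' w'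
      using All that wle_trans by blast
    then show ?thesis using False by auto
  qed simp
next
  case (Exi y F)
  show ?case
  proof (cases "y = x")
    case False
    have "sem (substf x s F) \<rho> e' w' = sem (substf x t F) \<rho> e' w'" if "w \<preceq> w'" for e' w'
      using Exi that wle_trans by blast
    then show ?thesis
      using False wle_wf[OF Exi.prems] by (auto intro!: cover_cong)
  qed simp
qed (use assms in auto)

section \<open>Reification and reflection\<close>

text \<open>All parameters, also those foreign to the world, take values among its atomic terms, so
  that every instantiated formula belongs to the world.\<close>

definition env :: "(param \<Rightarrow> ('c, 'p) trm) \<Rightarrow> (var \<Rightarrow> ('c, 'p) trm) \<Rightarrow> ('c, 'p) world \<Rightarrow> bool" where
  "env \<rho> e w \<longleftrightarrow> (\<forall>a. atom_in w (\<rho> a)) \<and> (\<forall>x. atom_in w (e x))"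

lemma env_mono: "env \<rho> e w \<Longrightarrow> w \<preceq> w' \<Longrightarrow> env \<rho> e w'"
  by (auto simp: env_def intro: atom_in_mono)

lemma env_upd: "env \<rho> e w \<Longrightarrow> atom_in w v \<Longrightarrow> env \<rho> (e(x := v)) w" "env \<rho> e w \<Longrightarrow> atom_in w v \<Longrightarrow> env (\<rho>(a := v)) e w"
  by (auto simp: env_def)

lemma atom_inD: "atom_in w u \<Longrightarrow> fvt u = {} \<and> arityt ar u \<and> part u \<subseteq> fst w \<and> atomic_trm u"
  by (auto simp: atom_in_def atomic_trm_simps)

lemma inst_formula:
  assumes "env \<rho> e w" "arityf ar A"
  shows "is_formula ar (instf A \<rho> e)" "parf (instf A \<rho> e) \<subseteq> fst w"
proof -
  have e: "atom_in w (e x)" and r: "atom_in w (\<rho> a)" for x a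
    using assms by (auto simp: env_def)
  have "fvf (instf A \<rho> e) = {}"
    using fv_inst(2)[of \<rho> A e] atom_inD[OF e] atom_inD[OF r] by auto
  then show "is_formula ar (instf A \<rho> e)"
    using assms(2) arity_inst(2)[of ar \<rho> e A] atom_inD[OF e] atom_inD[OF r] by (auto simp: is_formula_def)
  show "parf (instf A \<rho> e) \<subseteq> fst w"
    using par_inst(2)[of \<rho> "fst w" e A] atom_inD[OF e] atom_inD[OF r] by auto
qed

lemma subst_inst_env:
  assumes "env \<rho> e w"
  shows "substf x u (instf A \<rho> (e(x := Var x))) = instf A \<rho> (e(x := u))"
proof -
  have "fvt (e y) = {}" "fvt (\<rho> a) = {}" for y a
    using assms atom_inD unfolding env_def by blast+
  then show ?thesis
    by (intro subst_inst(2)) auto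
qed

text \<open>Reading back identities: the syntactic case of \<open>eq_or_ne\<close> is where
  reflexivity enters.\<close>

lemma cover_eq_or_ne_nf:
  assumes "cover (\<lambda>w. eq_or_ne w s t) w" "wf_world w" "nf w (Ext s)" "nf w (Ext t)"
  shows "nf w (Eq s t)"
proof (rule nf_cover_bind[OF assms(1,2)])
  fix w' assume w': "w \<preceq> w'" "eq_or_ne w' s t"
  have "nf w' (Eq s s)"
    using nf_refl[OF wle_wf[OF w'(1)] derivable_wle[OF assms(3) w'(1)]] .
  then show "nf w' (Eq s t)"
    using w'(2) nf_ne[of w' "Eq s t"] by (auto simp: eq_or_ne_def)
qed (use derivable_is_formula[OF assms(3,2)] derivable_is_formula[OF assms(4,2)] in \<open>auto simp: is_formula_def\<close>)

lemma equal_at_intro: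
  assumes "exists_at w u" "exists_at w v" "ne w (Eq u v)"
  shows "equal_at w u v"
  using assms cover_ret[of "\<lambda>w. eq_or_ne w u v" w] by (simp add: equal_at_def eq_or_ne_def)

lemma equal_at_nf:
  assumes "equal_at w u v" "atom_in w u" "atom_in w v" "wf_world w"
  shows "nf w (Eq u v)"
  using assms exists_at_nf[of w u] exists_at_nf[of w v] cover_eq_or_ne_nf[where s=u and t=v and w=w] by (simp add: equal_at_def)

section \<open>Worlds with a neutral deduction of \<open>Bot\<close>\<close>

lemma ne_Bot_prime: "wf_world w \<Longrightarrow> ne w Bot \<Longrightarrow> prime_fm C \<Longrightarrow> is_formula ar C \<Longrightarrow> parf C \<subseteq> fst w \<Longrightarrow> ne w C"
  using ne0_BotE ne_ne0 by blast

lemma Bot_exists_at: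
  assumes "wf_world w" "ne w Bot" "atom_in w u"
  shows "exists_at w u"
  using assms atom_inD[OF assms(3)] by (auto simp: is_formula_def intro!: nf_exists_at nf_ne ne_Bot_prime)

lemma Bot_equal_at:
  assumes "wf_world w" "ne w Bot" "atom_in w u" "atom_in w v"
  shows "equal_at w u v"
proof -
  have "ne w (Eq u v)"
    using assms atom_inD[OF assms(3)] atom_inD[OF assms(4)] by (auto simp: is_formula_def intro!: ne_Bot_prime)
  then show ?thesis
    using Bot_exists_at[OF assms(1,2,3)] Bot_exists_at[OF assms(1,2,4)] by (simp add: equal_at_def cover_ret eq_or_ne_def)
qed

lemma ex_atom_in:
  assumes "wf_world w"
  obtains u where "atom_in w u"
proof -
  obtain a where "a \<in> fst w"
    using assms by (auto simp: wf_world_def)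
  then show thesis
    using that[of "Par a"] by (simp add: atom_in_def atomic_trm_def)
qed

text \<open>\<open>BotE\<close> yields prime formulas, hence existence and identity of all
  individuals and all predications of them; the remaining clauses follow by induction, with an
  arbitrary individual as denotation or witness where one is needed.\<close>

lemma sem_explosion:
  shows "wf_world w \<Longrightarrow> ne w Bot \<Longrightarrow> env \<rho> e w \<Longrightarrow> arityt ar t \<Longrightarrow> atom_in w u \<Longrightarrow> den t \<rho> e w u"
    and "wf_world w \<Longrightarrow> ne w Bot \<Longrightarrow> env \<rho> e w \<Longrightarrow> arityf ar A \<Longrightarrow> sem A \<rho> e w"
proof (induction t and A arbitrary: e w u and e w)
  case (Cst c)
  then show ?case by (auto intro!: Bot_equal_at simp: atom_in_def atomic_trm_def)
next
  case (Iota x F)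
  have "equal_at w' v u \<and> exists_at w' v \<and> sem F \<rho> (e(x := v)) w'" if w': "w \<preceq> w'" "atom_in w' v" for w' v
  proof (intro conjI)
    note wf_world = wle_wf[OF w'(1)] and bot = derivable_wle[OF Iota.prems(2) w'(1)]
    show "equal_at w' v u" "exists_at w' v"
      using Bot_equal_at[OF wf_world bot w'(2)] Bot_exists_at[OF wf_world bot w'(2)] atom_in_mono[OF Iota.prems(5) w'(1)] by auto
    show "sem F \<rho> (e(x := v)) w'"
      by (rule Iota.IH[OF wf_world bot env_upd(1)[OF env_mono[OF Iota.prems(3) w'(1)] w'(2)]])
        (use Iota.prems(4) in simp)
  qed
  then show ?case
    using Iota.prems Bot_exists_at by simp
next
  case (Pred R ts)
  obtain u where u: "atom_in w u"
    using ex_atom_in Pred.prems(1) by blast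
  let ?us = "map (\<lambda>_. u) ts"
  have "den t \<rho> e w u" if "t \<in> set ts" for t
    by (rule Pred.IH[OF that Pred.prems(1-3) _ u])
      (use Pred.prems(4) that in \<open>simp add: list.pred_set list_all_iff\<close>)
  then have "list_all2 (\<lambda>t u. atom_in w u \<and> den t \<rho> e w u) ts ?us"
    using u unfolding list_all2_map2 by (intro list.rel_refl_strong) simp
  moreover have "ne w (Pred R ?us)"
    by (rule ne_Bot_prime[OF Pred.prems(1,2)])
      (use Pred.prems(4) atom_inD[OF u] in \<open>auto simp: is_formula_def list.pred_set list_all_iff\<close>)
  then have "nf w (Pred R ?us)"
    by (rule nf_ne)
  ultimately show ?case
    unfolding sem_Pred by (intro cover_ret exI[of _ ?us] conjI)
next
  case (Eq s t)
  obtain u where u: "atom_in w u"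
    using ex_atom_in Eq.prems(1) by blast
  have "den s \<rho> e w u" "den t \<rho> e w u"
    using Eq.IH[OF Eq.prems(1-3) _ u] Eq.prems(4) by simp_all
  then show ?case
    using u by (auto intro!: cover_ret)
next
  case (Ext t)
  obtain u where u: "atom_in w u"
    using ex_atom_in Ext.prems(1) by blast
  have "den t \<rho> e w u"
    using Ext.IH[OF Ext.prems(1-3) _ u] Ext.prems(4) by simp
  then show ?case
    using u by (auto intro!: cover_ret)
next
  case (Imp A B)
  have "sem B \<rho> e w'" if w': "w \<preceq> w'" for w'
    by (rule Imp.IH(2)[OF wle_wf[OF w'] derivable_wle[OF Imp.prems(2) w']
        env_mono[OF Imp.prems(3) w']]) (use Imp.prems(4) in simp)
  then show ?case by simp
next
  case (All x A)
  have "sem A \<rho> (e(x := u)) w'" if w': "w \<preceq> w'" "atom_in w' u" for w' u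
    by (rule All.IH[OF wle_wf[OF w'(1)] derivable_wle[OF All.prems(2) w'(1)]
        env_upd(1)[OF env_mono[OF All.prems(3) w'(1)] w'(2)]]) (use All.prems(4) in simp)
  then show ?case by simp
next
  case (Exi x A)
  obtain u where u: "atom_in w u"
    using ex_atom_in Exi.prems(1) by blast
  have "exists_at w u"
    using Bot_exists_at[OF Exi.prems(1,2) u] .
  moreover have "sem A \<rho> (e(x := u)) w"
    by (rule Exi.IH[OF Exi.prems(1,2) env_upd(1)[OF Exi.prems(3) u]]) (use Exi.prems(4) in simp)
  ultimately show ?case
    using u by (auto intro!: cover_ret)
qed (auto intro!: Bot_equal_at cover_ret simp: env_def)

text \<open>The arguments are exchanged one at a time from the left: \<open>us\<close> is the part
  already processed, and \<open>Var 0\<close> marks the current argument. The list \<open>us\<close>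
  is generalised so that the induction can move the boundary.\<close>

lemma nf_Pred_replace:
  assumes "list_all2 (\<lambda>s t. cover (\<lambda>w. eq_or_ne w s t) w) ss ts" "nf w (Pred R (us @ ss))" "wf_world w"
    "is_formula ar (Pred R (us @ ts))" "parf (Pred R (us @ ts)) \<subseteq> fst w"
  shows "nf w (Pred R (us @ ts))"
  using assms
proof (induction ss ts arbitrary: us rule: list_all2_induct)
  case (Cons s ss t ts)
  have f: "is_formula ar (Pred R (us @ t # ss))" "parf (Pred R (us @ t # ss)) \<subseteq> fst w"
    using derivable_is_formula[OF Cons.prems(1,2)] Cons.prems(3,4) by (auto simp: is_formula_def)
  have "nf w (Pred R (us @ t # ss))"
  proof (rule nf_cover_bind[OF Cons.hyps(1) Cons.prems(2) f])
    fix w' assume w': "w \<preceq> w'" "eq_or_ne w' s t"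
    note n = derivable_wle[OF Cons.prems(1) w'(1)]
    show "nf w' (Pred R (us @ t # ss))"
    proof (cases "s = t")
      case True
      then show ?thesis using n by simp
    next
      case False
      have "substt 0 r u = u" if "u \<in> set us \<union> set ss" for u r
        using that f(1) by (intro subst_closed(1)) (auto simp: is_formula_def)
      then have A: "substf 0 r (Pred R (us @ Var 0 # ss)) = Pred R (us @ r # ss)" for r
        by (simp add: map_idI)
      have "ne w' (Pred R (us @ t # ss))"
      proof (rule ne_EqE[where A="Pred R (us @ Var 0 # ss)" and x=0])
        show "ne w' (Eq s t)"
          using w' False by (simp add: eq_or_ne_def)
        show "parf (Pred R (us @ t # ss)) \<subseteq> fst w'"
          using f(2) w'(1) unfolding wle_def by blast
      qed (use wle_wf[OF w'(1)] f n A False in auto)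
      then show ?thesis by (rule nf_ne)
    qed
  qed
  then show ?case
    using Cons.IH[of "us @ [t]"] Cons.prems by simp
qed simp

lemma cover_list:
  assumes "\<And>t. t \<in> set ts \<Longrightarrow> cover (\<lambda>w. \<exists>u. Q t w u) w" "wf_world w"
    "\<And>t w w' u. Q t w u \<Longrightarrow> wf_world w \<Longrightarrow> w \<preceq> w' \<Longrightarrow> Q t w' u"
  shows "cover (\<lambda>w. \<exists>us. list_all2 (\<lambda>t u. Q t w u) ts us) w"
  using assms(1,2)
proof (induction ts arbitrary: w)
  case Nil
  then show ?case by (auto intro: cover_ret)
next
  case (Cons t ts)
  show ?case
  proof (rule cover_bind)
    show "cover (\<lambda>w. \<exists>u. Q t w u) w"
      using Cons.prems by simp
    fix w' assume w': "w \<preceq> w'" "\<exists>u. Q t w' u"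
    have "cover (\<lambda>w. \<exists>u. Q s w u) w'" if "s \<in> set ts" for s
      using Cons.prems that by (intro cover_mono_world[OF _ w'(1)]) (auto intro: assms(3))
    then have "cover (\<lambda>w. \<exists>us. list_all2 (\<lambda>t u. Q t w u) ts us) w'"
      using Cons.IH wle_wf[OF w'(1)] by blast
    then show "cover (\<lambda>w. \<exists>us. list_all2 (\<lambda>t u. Q t w u) (t # ts) us) w'"
    proof (rule cover_map[OF _ wle_wf[OF w'(1)]])
      fix v assume v: "w' \<preceq> v" "\<exists>us. list_all2 (\<lambda>t u. Q t v u) ts us"
      then show "\<exists>us. list_all2 (\<lambda>t u. Q t v u) (t # ts) us"
        using w'(2) assms(3)[OF _ wle_wf[OF w'(1)] v(1)] unfolding list_all2_Cons1 by blast
    qed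
  qed (rule Cons.prems)
qed

section \<open>The simultaneous induction on terms and formulas\<close>

lemma reify_reflect_atomic:
  assumes "wf_world w" "atom_in w r"
  shows "(\<forall>u. atom_in w u \<longrightarrow> equal_at w r u \<longrightarrow> cover (\<lambda>w. eq_or_ne w u r) w \<and> cover (\<lambda>w. eq_or_ne w r u) w \<and> nf w (Ext r)) \<and>
    (nf w (Ext r) \<longrightarrow> cover (\<lambda>w. \<exists>u. atom_in w u \<and> equal_at w r u) w)"
proof (intro conjI allI impI)
  fix u assume u: "atom_in w u" "equal_at w r u"
  show "cover (\<lambda>w. eq_or_ne w u r) w" "cover (\<lambda>w. eq_or_ne w r u) w"
    using equal_at_sym[OF u(2) assms(1)] u(2) by (auto simp: equal_at_def)
  show "nf w (Ext r)"
    using exists_at_nf[OF _ assms(2,1)] u by (simp add: equal_at_def)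
next
  assume "nf w (Ext r)"
  then have "equal_at w r r"
    by (intro equal_at_refl nf_exists_at)
  then show "cover (\<lambda>w. \<exists>u. atom_in w u \<and> equal_at w r u) w"
    using assms(2) by (intro cover_ret) blast
qed

text \<open>Russell's clause mirrors the description rules: its two directions supply the two
  subdeductions of \<open>IotaI\<close>, and \<open>IotaE1\<close> and \<open>IotaE2\<close> give
  the directions back. As these eliminations require an atomic right-hand side, the description is
  first named by a parameter \<open>c\<close>.\<close>

lemma reify_reflect_Iota:
  assumes IH: "\<And>e w. wf_world w \<Longrightarrow> env \<rho> e w \<Longrightarrow>
      (sem F \<rho> e w \<longrightarrow> nf w (instf F \<rho> e)) \<and> (ne0 w (instf F \<rho> e) \<longrightarrow> sem F \<rho> e w)"
    and ar: "arityf ar F" and w: "wf_world w" and e: "env \<rho> e w"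
    and I: "I = instt (Iota x F) \<rho> e"
  shows "atom_in w u \<Longrightarrow> den (Iota x F) \<rho> e w u \<Longrightarrow>
      cover (\<lambda>w. eq_or_ne w u I) w \<and> cover (\<lambda>w. eq_or_ne w I u) w \<and> nf w (Ext I)"
    and "nf w (Ext I) \<Longrightarrow> cover (\<lambda>w. \<exists>u. atom_in w u \<and> den (Iota x F) \<rho> e w u) w"
proof -
  define F' where "F' = instf F \<rho> (e(x := Var x))"
  have I: "I = Iota x F'"
    by (simp add: I F'_def)
  have sub: "substf x v F' = instf F \<rho> (e(x := v))" for v
    unfolding F'_def using e by (rule subst_inst_env)
  have fI: "is_formula ar (Ext I)" "parf F' \<subseteq> fst w"
    using inst_formula[OF e, of "Ext (Iota x F)"] ar by (auto simp: I F'_def)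
  have fF: "is_formula ar (substf x v F')" "parf (substf x v F') \<subseteq> fst w'"
    if "w \<preceq> w'" "atom_in w' v" for w' v
    using inst_formula[OF env_upd(1)[OF env_mono[OF e that(1)] that(2)] ar] sub by auto
  have up: "sem F \<rho> (e(x := v)) w' \<Longrightarrow> nf w' (substf x v F')"
    "ne0 w' (substf x v F') \<Longrightarrow> sem F \<rho> (e(x := v)) w'" if "w \<preceq> w'" "atom_in w' v" for w' v
    using IH[OF wle_wf[OF that(1)] env_upd(1)[OF env_mono[OF e that(1)] that(2)]] sub by auto
  \<comment> \<open>\<open>EqI\<close> provides \<open>c = I\<close>, but the description rules want
    the description on the left; \<open>EqE\<close> reverses it with the help of
    \<open>c = c\<close>.\<close>
  have swap: "ne w' (Eq I (Par c))" if "w' = new w c [(1, Eq (Par c) I)]" "c \<notin> fst w" "nf w (Ext I)" for w' c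
  proof -
    note wit = witness[OF w that(3,2,1)]
    show ?thesis
      using ne_EqE_left[OF wle_wf[OF wit(1)] wit(2) nf_refl[OF wle_wf[OF wit(1)] wit(3)]] wit(4) by simp
  qed
  show "cover (\<lambda>w. eq_or_ne w u I) w \<and> cover (\<lambda>w. eq_or_ne w I u) w \<and> nf w (Ext I)"
    if u: "atom_in w u" and den: "den (Iota x F) \<rho> e w u"
  proof -
    have ex: "exists_at w u"
      using den by simp
    have iff: "equal_at w' v u \<longleftrightarrow> exists_at w' v \<and> sem F \<rho> (e(x := v)) w'" if "w \<preceq> w'" "atom_in w' v" for w' v
      using den that by auto
    note exu = exists_at_nf[OF ex u w]
    note fu = atom_inD[OF u]
    have ext: "nf w (Ext I)"
      unfolding I
    proof (rule nf_Ext_Iota[of w u])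
      fix b assume b: "b \<notin> fst w"
      let ?w1 = "new w b [(0, Eq (Par b) u)]"
      have w1: "w \<preceq> ?w1"
        using fu w by (intro wle_new) (auto simp: is_formula_def)
      note wf1 = wle_wf[OF w1]
      have tb: "atom_in ?w1 (Par b)"
        by (simp add: atom_in_def atomic_trm_def new_def)
      \<comment> \<open>This assumption is to be discharged by \<open>IotaI\<close>, hence has label
        0, and \<open>AD\<close> may conclude the existence of both sides.\<close>
      have n: "ne0 ?w1 (Eq (Par b) u)"
        using wf1 by (rule ne0_Assm) (simp add: new_def)
      have "equal_at ?w1 (Par b) u"
        using nf_AD_Eq[OF wf1 n] ne_ne0[OF n] by (simp add: equal_at_def nf_exists_at cover_ret eq_or_ne_def)
      then show "nf ?w1 (substf x (Par b) F')"
        using iff[OF w1 tb] up(1)[OF w1 tb] by blast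
      let ?w2 = "new w b [(0, substf x (Par b) F'), (0, Ext (Par b))]"
      have w2: "w \<preceq> ?w2"
      proof (rule wle_new[OF w])
        have "is_formula ar (substf x (Par b) F')" "parf (substf x (Par b) F') \<subseteq> insert b (fst w)"
          using fF[OF w1 tb] by (auto simp: new_def)
        then show "is_formula ar (snd l) \<and> parf (snd l) \<subseteq> insert b (fst w)"
          if "l \<in> set [(0, substf x (Par b) F'), (0, Ext (Par b))]" for l
          using that by (auto simp: is_formula_def)
      qed
      note wf2 = wle_wf[OF w2]
      have tb2: "atom_in ?w2 (Par b)"
        by (simp add: atom_in_def atomic_trm_def new_def)
      have "ne0 ?w2 (substf x (Par b) F')" "ne0 ?w2 (Ext (Par b))"
        using wf2 by (auto intro!: ne0_Assm simp: new_def)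
      then have "equal_at ?w2 (Par b) u"
        using iff[OF w2 tb2] up(2)[OF w2 tb2] nf_exists_at nf_ne ne_ne0 by blast
      then show "nf ?w2 (Eq (Par b) u)"
        using equal_at_nf[OF _ tb2 atom_in_mono[OF u w2] wf2] by blast
    qed (use w fu exu fI I in auto)
    \<comment> \<open>Although \<open>u\<close> denotes the description, nothing neutral links the
      two yet. Above an \<open>EqI\<close> naming \<open>I\<close> by \<open>c\<close>,
      \<open>IotaE2\<close> proves \<open>u = c\<close>, which is chained with
      \<open>c = I\<close>.\<close>
    have cover: "cover (\<lambda>w. eq_or_ne w u I) w"
    proof (rule cover_eq[OF ext])
      fix c assume c: "c \<notin> fst w"
      let ?w1 = "new w c [(1, Eq (Par c) I)]"
      note wit = witness[OF w ext c refl]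
      note wf1 = wle_wf[OF wit(1)]
      have u1: "atom_in ?w1 u"
        using atom_in_mono[OF u wit(1)] .
      have "equal_at ?w1 u u"
        using equal_at_refl exists_at_mono[OF ex w wit(1)] by blast
      then have n: "nf ?w1 (substf x u F')"
        using iff[OF wit(1) u1] up(1)[OF wit(1) u1] by blast
      have "ne ?w1 (Eq (Iota x F') (Par c))"
        using swap[OF refl c ext] unfolding I .
      from ne0_IotaE2[OF wf1 this n derivable_wle[OF exu wit(1)]]
      have "ne0 ?w1 (Eq u (Par c))"
        using fu by (simp add: atomic_trm_def)
      then have "eq_or_ne ?w1 u (Par c)" "eq_or_ne ?w1 (Par c) I"
        using wit(2) by (simp_all add: eq_or_ne_def ne_ne0)
      then show "cover (\<lambda>w. eq_or_ne w u I) ?w1"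
        using eq_or_ne_trans[OF _ _ wf1] cover_ret by metis
    qed
    then show ?thesis
      using cover_eq_or_ne_sym[OF cover ex w] ext by blast
  qed
  show "cover (\<lambda>w. \<exists>u. atom_in w u \<and> den (Iota x F) \<rho> e w u) w" if ext: "nf w (Ext I)"
  proof (rule cover_eq[OF ext])
    fix c assume c: "c \<notin> fst w"
    let ?w1 = "new w c [(1, Eq (Par c) I)]"
    note wit = witness[OF w ext c refl]
    have tc: "atom_in ?w1 (Par c)"
      by (simp add: atom_in_def atomic_trm_def new_def)
    \<comment> \<open>The name introduced by \<open>EqI\<close> is itself the denotation.\<close>
    have "den (Iota x F) \<rho> e ?w1 (Par c)"
      unfolding den.simps
    proof (intro conjI allI impI)
      show "exists_at ?w1 (Par c)"
        using wit(3) by (rule nf_exists_at)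
      fix w' v assume w': "?w1 \<preceq> w'" and v: "atom_in w' v"
      note le = wle_trans[OF wit(1) w']
      note wf_world = wle_wf[OF w']
      have n: "ne w' (Eq (Iota x F') (Par c))"
        using derivable_wle[OF swap[OF refl c ext] w'] by (simp add: I)
      have at: "atomic_trm (Par c)" "atomic_trm v"
        using atom_inD[OF v] by (auto simp: atomic_trm_def)
      show "equal_at w' v (Par c) \<longleftrightarrow> exists_at w' v \<and> sem F \<rho> (e(x := v)) w'"
      proof
        assume eq: "equal_at w' v (Par c)"
        then have "ne0 w' (substf x v F')"
          using ne0_IotaE1[OF wf_world n equal_at_nf[OF eq v atom_in_mono[OF tc w'] wf_world] at fF[OF le v]] by blast
        then show "exists_at w' v \<and> sem F \<rho> (e(x := v)) w'"
          using up(2)[OF le v] eq by (simp add: equal_at_def)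
      next
        assume a: "exists_at w' v \<and> sem F \<rho> (e(x := v)) w'"
        then have "ne0 w' (Eq v (Par c))"
          using ne0_IotaE2[OF wf_world n up(1)[OF le v] exists_at_nf[OF _ v wf_world] at] by blast
        then show "equal_at w' v (Par c)"
          using equal_at_intro[OF _ nf_exists_at[OF derivable_wle[OF wit(3) w']] ne_ne0] a by blast
      qed
    qed
    then show "cover (\<lambda>w. \<exists>u. atom_in w u \<and> den (Iota x F) \<rho> e w u) ?w1"
      using tc by (intro cover_ret) blast
  qed
qed

text \<open>For terms, reification turns a denotation into identities and existence, and reflection
  turns existence into a denotation on a cover. The identities are kept in both directions:
  reification replaces individuals by terms, reflection terms by individuals. Reflection of formulas
  starts from strong deductions because of the use of \<open>AD\<close> on predications and
  identities.\<close>

lemma reify_reflect: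
  shows "arityt ar t \<Longrightarrow> wf_world w \<Longrightarrow> env \<rho> e w \<Longrightarrow>
      (\<forall>u. atom_in w u \<longrightarrow> den t \<rho> e w u \<longrightarrow>
        cover (\<lambda>w. eq_or_ne w u (instt t \<rho> e)) w \<and> cover (\<lambda>w. eq_or_ne w (instt t \<rho> e) u) w \<and> nf w (Ext (instt t \<rho> e))) \<and>
      (nf w (Ext (instt t \<rho> e)) \<longrightarrow> cover (\<lambda>w. \<exists>u. atom_in w u \<and> den t \<rho> e w u) w)"
    and "arityf ar A \<Longrightarrow> wf_world w \<Longrightarrow> env \<rho> e w \<Longrightarrow>
      (sem A \<rho> e w \<longrightarrow> nf w (instf A \<rho> e)) \<and> (ne0 w (instf A \<rho> e) \<longrightarrow> sem A \<rho> e w)"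
proof (induction t and A arbitrary: w e and w e)
  case (Var x)
  have "atom_in w (e x)"
    using Var.prems by (simp add: env_def)
  from reify_reflect_atomic[OF Var.prems(2) this] show ?case by simp
next
  case (Par a)
  have "atom_in w (\<rho> a)"
    using Par.prems by (simp add: env_def)
  from reify_reflect_atomic[OF Par.prems(2) this] show ?case by simp
next
  case (Cst c)
  have "atom_in w (Cst c)"
    by (simp add: atom_in_def atomic_trm_def)
  from reify_reflect_atomic[OF Cst.prems(2) this] show ?case by simp
next
  case (Iota x F)
  have ar: "arityf ar F"
    using Iota.prems by simp
  note I = reify_reflect_Iota[OF Iota.IH[OF ar] ar Iota.prems(2,3) refl]
  show ?case
    using I by blast
next
  case Bot
  show ?case
  proof (intro conjI impI)
    assume "sem Bot \<rho> e w"
    then have "cover (\<lambda>w. ne w Bot) w"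
      by simp
    then have "nf w Bot"
      using Bot.prems(2) by (rule nf_cover_bind) (auto simp: is_formula_def intro: nf_ne)
    then show "nf w (instf Bot \<rho> e)"
      by simp
  next
    assume "ne0 w (instf Bot \<rho> e)"
    then show "sem Bot \<rho> e w"
      using cover_ret[of "\<lambda>w. ne w Bot" w] by (simp add: ne_ne0)
  qed
next
  case (Pred R ts)
  have f: "is_formula ar (Pred R (map (\<lambda>t. instt t \<rho> e) ts))"
    "parf (Pred R (map (\<lambda>t. instt t \<rho> e) ts)) \<subseteq> fst w"
    using inst_formula[OF Pred.prems(3,1)] by (simp_all add: comp_def)
  have inst: "instf (Pred R ts) \<rho> e = Pred R (map (\<lambda>t. instt t \<rho> e) ts)"
    by simp
  have ar: "arityt ar t" if "t \<in> set ts" for t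
    using Pred.prems that by (simp add: list.pred_set list_all_iff)
  have a: "cover (\<lambda>w. eq_or_ne w u (instt t \<rho> e)) w'" "cover (\<lambda>w. eq_or_ne w (instt t \<rho> e) u) w'"
    if "t \<in> set ts" "w \<preceq> w'" "atom_in w' u" "den t \<rho> e w' u" for t w' u
    using Pred.IH[OF that(1) ar[OF that(1)] wle_wf[OF that(2)] env_mono[OF Pred.prems(3) that(2)]] that(3,4)
    by blast+
  show ?case
    unfolding inst
  proof (intro conjI impI)
    assume "sem (Pred R ts) \<rho> e w"
    then show "nf w (Pred R (map (\<lambda>t. instt t \<rho> e) ts))"
      unfolding sem_Pred
    proof (rule nf_cover_bind[OF _ Pred.prems(2) f])
      fix w' assume w': "w \<preceq> w'"
        "\<exists>us. list_all2 (\<lambda>t u. atom_in w' u \<and> den t \<rho> e w' u) ts us \<and> nf w' (Pred R us)"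
      then obtain us where us: "list_all2 (\<lambda>t u. atom_in w' u \<and> den t \<rho> e w' u) ts us" "nf w' (Pred R us)"
        by blast
      have "list_all2 (\<lambda>t u. cover (\<lambda>w. eq_or_ne w u (instt t \<rho> e)) w') ts us"
        using us(1) by (rule list.rel_mono_strong) (use a[OF _ w'(1)] in blast)
      then have "list_all2 (\<lambda>s t. cover (\<lambda>w. eq_or_ne w s t) w') us (map (\<lambda>t. instt t \<rho> e) ts)"
        unfolding list_all2_map2 by (simp add: list_all2_conv_all_nth)
      from nf_Pred_replace[of w' us "map (\<lambda>t. instt t \<rho> e) ts" R "[]", OF this]
      show "nf w' (Pred R (map (\<lambda>t. instt t \<rho> e) ts))"
        using us(2) wle_wf[OF w'(1)] f w'(1) by (auto simp: wle_def)
    qed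
  next
    assume n: "ne0 w (Pred R (map (\<lambda>t. instt t \<rho> e) ts))"
    have "cover (\<lambda>w. \<exists>u. atom_in w u \<and> den t \<rho> e w u) w" if t: "t \<in> set ts" for t
    proof -
      have "nf w (Ext (instt t \<rho> e))"
        using t by (intro nf_AD_Pred[OF Pred.prems(2) n]) simp
      then show ?thesis
        using Pred.IH[OF t ar[OF t] Pred.prems(2,3)] by blast
    qed
    \<comment> \<open>The covers of the single arguments are merged into one on which all of them
      denote.\<close>
    then have "cover (\<lambda>w. \<exists>us. list_all2 (\<lambda>t u. atom_in w u \<and> den t \<rho> e w u) ts us) w"
      using Pred.prems(2) by (rule cover_list) (use atom_in_mono sem_mono(1) in blast)+
    then show "sem (Pred R ts) \<rho> e w"
      unfolding sem_Pred
    proof (rule cover_map[OF _ Pred.prems(2)])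
      fix w' assume w': "w \<preceq> w'" "\<exists>us. list_all2 (\<lambda>t u. atom_in w' u \<and> den t \<rho> e w' u) ts us"
      then obtain us where us: "list_all2 (\<lambda>t u. atom_in w' u \<and> den t \<rho> e w' u) ts us"
        by blast
      have "list_all2 (\<lambda>t u. cover (\<lambda>w. eq_or_ne w (instt t \<rho> e) u) w') ts us"
        using us by (rule list.rel_mono_strong) (use a[OF _ w'(1)] in blast)
      then have cover: "list_all2 (\<lambda>s t. cover (\<lambda>w. eq_or_ne w s t) w') (map (\<lambda>t. instt t \<rho> e) ts) us"
        unfolding list_all2_map1 .
      have "atom_in w' u" if "u \<in> set us" for u
        using us that by (auto simp: list_all2_conv_all_nth in_set_conv_nth)
      then have "is_formula ar (Pred R us)" "parf (Pred R us) \<subseteq> fst w'"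
        using atom_inD list_all2_lengthD[OF us] f(1)
        by (auto simp: is_formula_def list.pred_set list_all_iff, blast+)
      then have "nf w' (Pred R us)"
        using nf_Pred_replace[OF cover, of R "[]"] wle_wf[OF w'(1)] derivable_wle[OF nf_ne[OF ne_ne0[OF n]] w'(1)]
        by simp
      then show "\<exists>us. list_all2 (\<lambda>t u. atom_in w' u \<and> den t \<rho> e w' u) ts us \<and> nf w' (Pred R us)"
        using us by blast
    qed
  qed
next
  case (Eq s t)
  let ?s = "instt s \<rho> e" and ?t = "instt t \<rho> e"
  have ar: "arityt ar s" "arityt ar t"
    using Eq.prems by auto
  have f: "is_formula ar (Eq ?s ?t)" "parf (Eq ?s ?t) \<subseteq> fst w"
    using inst_formula[OF Eq.prems(3,1)] by simp_all
  have a: "cover (\<lambda>w. eq_or_ne w u ?s) w' \<and> cover (\<lambda>w. eq_or_ne w ?s u) w' \<and> nf w' (Ext ?s)"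
    if "w \<preceq> w'" "atom_in w' u" "den s \<rho> e w' u" for w' u
    using Eq.IH(1)[OF ar(1) wle_wf[OF that(1)] env_mono[OF Eq.prems(3) that(1)]] that(2,3) by blast
  have b: "cover (\<lambda>w. eq_or_ne w u ?t) w' \<and> cover (\<lambda>w. eq_or_ne w ?t u) w' \<and> nf w' (Ext ?t)"
    if "w \<preceq> w'" "atom_in w' u" "den t \<rho> e w' u" for w' u
    using Eq.IH(2)[OF ar(2) wle_wf[OF that(1)] env_mono[OF Eq.prems(3) that(1)]] that(2,3) by blast
  show ?case
    unfolding instf.simps sem.simps
  proof (intro conjI impI)
    assume "cover (\<lambda>w. \<exists>u. atom_in w u \<and> den s \<rho> e w u \<and> den t \<rho> e w u) w"
    then show "nf w (Eq ?s ?t)"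
    proof (rule nf_cover_bind[OF _ Eq.prems(2) f])
      fix w' assume w': "w \<preceq> w'" "\<exists>u. atom_in w' u \<and> den s \<rho> e w' u \<and> den t \<rho> e w' u"
      then obtain u where "atom_in w' u" "den s \<rho> e w' u" "den t \<rho> e w' u"
        by blast
      then show "nf w' (Eq ?s ?t)"
        using cover_eq_or_ne_nf[OF cover_eq_or_ne_trans] wle_wf[OF w'(1)] a[OF w'(1)] b[OF w'(1)] by blast
    qed
  next
    assume n: "ne0 w (Eq ?s ?t)"
    have "cover (\<lambda>w. \<exists>u. atom_in w u \<and> den s \<rho> e w u) w"
      using Eq.IH(1)[OF ar(1) Eq.prems(2,3)] nf_AD_Eq(1)[OF Eq.prems(2) n] by blast
    then show "cover (\<lambda>w. \<exists>u. atom_in w u \<and> den s \<rho> e w u \<and> den t \<rho> e w u) w"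
    proof (rule cover_bind[OF _ Eq.prems(2)])
      fix w' assume w': "w \<preceq> w'" "\<exists>u. atom_in w' u \<and> den s \<rho> e w' u"
      then obtain u where u: "atom_in w' u" "den s \<rho> e w' u"
        by blast
      note wf' = wle_wf[OF w'(1)]
      note n' = derivable_wle[OF n w'(1)]
      have "cover (\<lambda>w. \<exists>u. atom_in w u \<and> den t \<rho> e w u) w'"
        using Eq.IH(2)[OF ar(2) wf' env_mono[OF Eq.prems(3) w'(1)]] nf_AD_Eq(2)[OF wf' n'] by blast
      then show "cover (\<lambda>w. \<exists>u. atom_in w u \<and> den s \<rho> e w u \<and> den t \<rho> e w u) w'"
      proof (rule cover_map[OF _ wf'])
        fix w'' assume w'': "w' \<preceq> w''" "\<exists>u. atom_in w'' u \<and> den t \<rho> e w'' u"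
        then obtain v where v: "atom_in w'' v" "den t \<rho> e w'' v"
          by blast
        note wf'' = wle_wf[OF w''(1)]
        note le = wle_trans[OF w'(1) w''(1)]
        have u': "atom_in w'' u" "den s \<rho> e w'' u"
          using atom_in_mono[OF u(1) w''(1)] sem_mono(1)[OF u(2) wf' w''(1)] .
        have "eq_or_ne w'' ?s ?t"
          using ne_ne0[OF derivable_wle[OF n' w''(1)]] by (simp add: eq_or_ne_def)
        then have "cover (\<lambda>w. eq_or_ne w ?s ?t) w''"
          by (rule cover_ret)
        \<comment> \<open>The chain \<open>u = ?s\<close>, \<open>?s = ?t\<close>,
          \<open>?t = v\<close> is composed and then reversed, so that the denotation
          \<open>v\<close> of \<open>t\<close> can be exchanged for \<open>u\<close>.\<close>
        then have "cover (\<lambda>w. eq_or_ne w v u) w''"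
          using cover_eq_or_ne_sym[OF cover_eq_or_ne_trans[OF cover_eq_or_ne_trans]] a[OF le u'] b[OF le v] wf'' den_exists_at[OF u'(2)] by blast
        then have "equal_at w'' v u"
          using den_exists_at[OF u'(2)] den_exists_at[OF v(2)] by (simp add: equal_at_def)
        then show "\<exists>u. atom_in w'' u \<and> den s \<rho> e w'' u \<and> den t \<rho> e w'' u"
          using u' den_equal_at[OF v(2) _ wf''] by blast
      qed
    qed
  qed
next
  case (Ext t)
  have ar: "arityt ar t"
    using Ext.prems by auto
  have f: "is_formula ar (Ext (instt t \<rho> e))" "parf (Ext (instt t \<rho> e)) \<subseteq> fst w"
    using inst_formula[OF Ext.prems(3,1)] by simp_all
  show ?case
    unfolding instf.simps sem.simps
  proof (intro conjI impI)
    assume "cover (\<lambda>w. \<exists>u. atom_in w u \<and> den t \<rho> e w u) w"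
    then show "nf w (Ext (instt t \<rho> e))"
    proof (rule nf_cover_bind[OF _ Ext.prems(2) f])
      fix w' assume w': "w \<preceq> w'" "\<exists>u. atom_in w' u \<and> den t \<rho> e w' u"
      then show "nf w' (Ext (instt t \<rho> e))"
        using Ext.IH[OF ar wle_wf[OF w'(1)] env_mono[OF Ext.prems(3) w'(1)]] by blast
    qed
  next
    assume "ne0 w (Ext (instt t \<rho> e))"
    then show "cover (\<lambda>w. \<exists>u. atom_in w u \<and> den t \<rho> e w u) w"
      using Ext.IH[OF ar Ext.prems(2,3)] nf_ne ne_ne0 by blast
  qed
next
  case (Con A B)
  have IH: "(sem A \<rho> e w \<longrightarrow> nf w (instf A \<rho> e)) \<and> (ne0 w (instf A \<rho> e) \<longrightarrow> sem A \<rho> e w)"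
    "(sem B \<rho> e w \<longrightarrow> nf w (instf B \<rho> e)) \<and> (ne0 w (instf B \<rho> e) \<longrightarrow> sem B \<rho> e w)"
    using Con.IH(1)[OF _ Con.prems(2,3)] Con.IH(2)[OF _ Con.prems(2,3)] Con.prems(1) by simp_all
  then show ?case
    using nf_ConI[OF Con.prems(2)] ne0_ConE[OF Con.prems(2) ne_ne0] unfolding instf.simps sem.simps by blast
next
  case (Dis A B)
  have ar: "arityf ar A" "arityf ar B"
    using Dis.prems by auto
  have f: "is_formula ar (instf A \<rho> e)" "parf (instf A \<rho> e) \<subseteq> fst w"
    "is_formula ar (instf B \<rho> e)" "parf (instf B \<rho> e) \<subseteq> fst w"
    "is_formula ar (instf (Dis A B) \<rho> e)" "parf (instf (Dis A B) \<rho> e) \<subseteq> fst w"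
    using inst_formula[OF Dis.prems(3)] Dis.prems(1) ar by blast+
  have IH: "(sem A \<rho> e w' \<longrightarrow> nf w' (instf A \<rho> e)) \<and> (ne0 w' (instf A \<rho> e) \<longrightarrow> sem A \<rho> e w')"
    "(sem B \<rho> e w' \<longrightarrow> nf w' (instf B \<rho> e)) \<and> (ne0 w' (instf B \<rho> e) \<longrightarrow> sem B \<rho> e w')" if "w \<preceq> w'" for w'
    using Dis.IH(1)[OF ar(1) wle_wf[OF that] env_mono[OF Dis.prems(3) that]]
      Dis.IH(2)[OF ar(2) wle_wf[OF that] env_mono[OF Dis.prems(3) that]] by blast+
  show ?case
  proof (intro conjI impI)
    assume "sem (Dis A B) \<rho> e w"
    then show "nf w (instf (Dis A B) \<rho> e)"
      unfolding sem.simps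
    proof (rule nf_cover_bind[OF _ Dis.prems(2) f(5,6)])
      fix w' assume w': "w \<preceq> w'" "sem A \<rho> e w' \<or> sem B \<rho> e w'"
      have "parf (instf A \<rho> e) \<subseteq> fst w'" "parf (instf B \<rho> e) \<subseteq> fst w'"
        using w'(1) f unfolding wle_def by blast+
      then show "nf w' (instf (Dis A B) \<rho> e)"
        using w'(2) IH[OF w'(1)] nf_DisI1[OF wle_wf[OF w'(1)] _ f(3)] nf_DisI2[OF wle_wf[OF w'(1)] _ f(1)]
        unfolding instf.simps by blast
    qed
  next
    assume "ne0 w (instf (Dis A B) \<rho> e)"
    then have n: "ne w (Dis (instf A \<rho> e) (instf B \<rho> e))"
      by (simp add: ne_ne0)
    let ?A = "add w [(0, instf A \<rho> e)]" and ?B = "add w [(0, instf B \<rho> e)]"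
    note le = wle_dis[OF Dis.prems(2) n, of 0]
    have "ne0 ?A (instf A \<rho> e)" "ne0 ?B (instf B \<rho> e)"
      using wle_wf[OF le(1)] wle_wf[OF le(2)] by (auto intro!: ne0_Assm simp: add_def)
    then have "sem A \<rho> e ?A \<or> sem B \<rho> e ?A" "sem A \<rho> e ?B \<or> sem B \<rho> e ?B"
      using IH(1)[OF le(1)] IH(2)[OF le(2)] by blast+
    then show "sem (Dis A B) \<rho> e w"
      unfolding sem.simps by (intro cover_dis[OF n] cover_ret)
  qed
next
  case (Imp A B)
  have ar: "arityf ar A" "arityf ar B"
    using Imp.prems by auto
  have f: "is_formula ar (instf A \<rho> e)" "parf (instf A \<rho> e) \<subseteq> fst w"
    using inst_formula[OF Imp.prems(3)] ar by blast+
  have IH: "(sem A \<rho> e w' \<longrightarrow> nf w' (instf A \<rho> e)) \<and> (ne0 w' (instf A \<rho> e) \<longrightarrow> sem A \<rho> e w')"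
    "(sem B \<rho> e w' \<longrightarrow> nf w' (instf B \<rho> e)) \<and> (ne0 w' (instf B \<rho> e) \<longrightarrow> sem B \<rho> e w')" if "w \<preceq> w'" for w'
    using Imp.IH(1)[OF ar(1) wle_wf[OF that] env_mono[OF Imp.prems(3) that]]
      Imp.IH(2)[OF ar(2) wle_wf[OF that] env_mono[OF Imp.prems(3) that]] by blast+
  show ?case
    unfolding instf.simps sem.simps
  proof (intro conjI impI allI)
    assume s: "\<forall>w'. w \<preceq> w' \<longrightarrow> sem A \<rho> e w' \<longrightarrow> sem B \<rho> e w'"
    let ?A = "add w [(0, instf A \<rho> e)]"
    note le = wle_add[OF Imp.prems(2) f, of 0]
    have "ne0 ?A (instf A \<rho> e)"
      using wle_wf[OF le] by (auto intro!: ne0_Assm simp: add_def)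
    then have "nf ?A (instf B \<rho> e)"
      using s IH[OF le] le by blast
    then show "nf w (Imp (instf A \<rho> e) (instf B \<rho> e))"
      by (rule nf_ImpI[OF Imp.prems(2) _ f])
  next
    fix w' assume "ne0 w (Imp (instf A \<rho> e) (instf B \<rho> e))" and w': "w \<preceq> w'" "sem A \<rho> e w'"
    then have "ne w' (Imp (instf A \<rho> e) (instf B \<rho> e))"
      using ne_ne0 derivable_wle by blast
    then show "sem B \<rho> e w'"
      using ne0_ImpE[OF wle_wf[OF w'(1)]] IH[OF w'(1)] w'(2) by blast
  qed
next
  case (All x F)
  define F' where "F' = instf F \<rho> (e(x := Var x))"
  have ar: "arityf ar F"
    using All.prems by simp
  have sub: "substf x v F' = instf F \<rho> (e(x := v))" for v
    unfolding F'_def using All.prems(3) by (rule subst_inst_env)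
  have inst: "instf (All x F) \<rho> e = All x F'"
    by (simp add: F'_def)
  have f: "is_formula ar (All x F')" "parf F' \<subseteq> fst w"
    using inst_formula[OF All.prems(3,1)] unfolding inst by simp_all
  have IH: "(sem F \<rho> (e(x := v)) w' \<longrightarrow> nf w' (substf x v F')) \<and>
      (ne0 w' (substf x v F') \<longrightarrow> sem F \<rho> (e(x := v)) w')" if "w \<preceq> w'" "atom_in w' v" for v w'
    unfolding sub using All.IH[OF ar wle_wf[OF that(1)] env_upd(1)[OF env_mono[OF All.prems(3) that(1)] that(2)]] .
  show ?case
    unfolding inst sem.simps
  proof (intro conjI impI allI)
    assume s: "\<forall>w' u. w \<preceq> w' \<longrightarrow> atom_in w' u \<longrightarrow> exists_at w' u \<longrightarrow> sem F \<rho> (e(x := u)) w'"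
    show "nf w (All x F')"
    proof (rule nf_AllI[OF All.prems(2) _ f])
      fix a assume "a \<notin> fst w"
      let ?w1 = "new w a [(0, Ext (Par a))]"
      have le: "w \<preceq> ?w1"
        using All.prems(2) by (intro wle_new) (auto simp: is_formula_def)
      have t: "atom_in ?w1 (Par a)"
        by (simp add: atom_in_def atomic_trm_def new_def)
      have "ne0 ?w1 (Ext (Par a))"
        using wle_wf[OF le] by (auto intro!: ne0_Assm simp: new_def)
      then have "exists_at ?w1 (Par a)"
        using nf_exists_at nf_ne ne_ne0 by blast
      then show "nf ?w1 (substf x (Par a) F')"
        using s IH[OF le t] le t by blast
    qed
  next
    fix w' u assume n: "ne0 w (All x F')" and w': "w \<preceq> w'" "atom_in w' u" "exists_at w' u"
    have "is_formula ar (substf x u F')" "parf (substf x u F') \<subseteq> fst w'"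
      unfolding sub using inst_formula[OF env_upd(1)[OF env_mono[OF All.prems(3) w'(1)] w'(2)] ar] by blast+
    moreover have "atomic_trm u"
      using atom_inD[OF w'(2)] by blast
    ultimately have "ne0 w' (substf x u F')"
      using ne0_AllE[OF wle_wf[OF w'(1)] ne_ne0[OF derivable_wle[OF n w'(1)]] exists_at_nf[OF w'(3,2) wle_wf[OF w'(1)]]]
      by blast
    then show "sem F \<rho> (e(x := u)) w'"
      using IH[OF w'(1,2)] by blast
  qed
next
  case (Exi x F)
  define F' where "F' = instf F \<rho> (e(x := Var x))"
  have ar: "arityf ar F"
    using Exi.prems by simp
  have sub: "substf x v F' = instf F \<rho> (e(x := v))" for v
    unfolding F'_def using Exi.prems(3) by (rule subst_inst_env)
  have inst: "instf (Exi x F) \<rho> e = Exi x F'"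
    by (simp add: F'_def)
  have f: "is_formula ar (Exi x F')" "parf F' \<subseteq> fst w" "parf (Exi x F') \<subseteq> fst w"
    using inst_formula[OF Exi.prems(3,1)] unfolding inst by simp_all
  have IH: "(sem F \<rho> (e(x := v)) w' \<longrightarrow> nf w' (substf x v F')) \<and>
      (ne0 w' (substf x v F') \<longrightarrow> sem F \<rho> (e(x := v)) w')" if "w \<preceq> w'" "atom_in w' v" for v w'
    unfolding sub using Exi.IH[OF ar wle_wf[OF that(1)] env_upd(1)[OF env_mono[OF Exi.prems(3) that(1)] that(2)]] .
  show ?case
    unfolding inst sem.simps
  proof (intro conjI impI)
    assume "cover (\<lambda>w. \<exists>u. atom_in w u \<and> exists_at w u \<and> sem F \<rho> (e(x := u)) w) w"
    then show "nf w (Exi x F')"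
    proof (rule nf_cover_bind[OF _ Exi.prems(2) f(1,3)])
      fix w' assume w': "w \<preceq> w'" "\<exists>u. atom_in w' u \<and> exists_at w' u \<and> sem F \<rho> (e(x := u)) w'"
      then obtain u where u: "atom_in w' u" "exists_at w' u" "sem F \<rho> (e(x := u)) w'"
        by blast
      note wf_world = wle_wf[OF w'(1)]
      have "parf F' \<subseteq> fst w'" "atomic_trm u"
        using f(2) w'(1) atom_inD[OF u(1)] unfolding wle_def by blast+
      then show "nf w' (Exi x F')"
        using nf_ExiI[OF wf_world _ exists_at_nf[OF u(2,1) wf_world] _ f(1)] IH[OF w'(1) u(1)] u(3) by blast
    qed
  next
    assume "ne0 w (Exi x F')"
    then have n: "ne w (Exi x F')"
      by (rule ne_ne0)
    show "cover (\<lambda>w. \<exists>u. atom_in w u \<and> exists_at w u \<and> sem F \<rho> (e(x := u)) w) w"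
    proof (rule cover_exi[OF n])
      fix a
      let ?w1 = "new w a [(0, substf x (Par a) F'), (0, Ext (Par a))]"
      note le = wle_exi[OF Exi.prems(2) n, of a]
      have t: "atom_in ?w1 (Par a)"
        by (simp add: atom_in_def atomic_trm_def new_def)
      have "ne0 ?w1 (Ext (Par a))" "ne0 ?w1 (substf x (Par a) F')"
        using wle_wf[OF le] by (auto intro!: ne0_Assm simp: new_def)
      then have "\<exists>u. atom_in ?w1 u \<and> exists_at ?w1 u \<and> sem F \<rho> (e(x := u)) ?w1"
        using nf_exists_at nf_ne ne_ne0 IH[OF le t] t by blast
      then show "cover (\<lambda>w. \<exists>u. atom_in w u \<and> exists_at w u \<and> sem F \<rho> (e(x := u)) w) ?w1"
        by (rule cover_ret)
    qed
  qed
qed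

section \<open>Soundness\<close>

definition sem_assms where
  "sem_assms \<Gamma> \<rho> e w \<longleftrightarrow> (\<forall>l\<in>\<Gamma>. sem (snd l) \<rho> e w)"

lemma sem_assms_mono: "sem_assms \<Gamma> \<rho> e w \<Longrightarrow> wf_world w \<Longrightarrow> w \<preceq> w' \<Longrightarrow> sem_assms \<Gamma> \<rho> e w'"
  unfolding sem_assms_def using sem_mono(2) by blast

lemma sem_assms_Un: "sem_assms (\<Gamma> \<union> \<Delta>) \<rho> e w \<longleftrightarrow> sem_assms \<Gamma> \<rho> e w \<and> sem_assms \<Delta> \<rho> e w"
  by (auto simp: sem_assms_def)

lemma sem_assms_insert:
  "sem_assms (insert l \<Gamma>) \<rho> e w \<longleftrightarrow> sem (snd l) \<rho> e w \<and> sem_assms \<Gamma> \<rho> e w"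
  by (auto simp: sem_assms_def)

lemma sem_assms_empty: "sem_assms {} \<rho> e w"
  by (simp add: sem_assms_def)

lemma sem_assms_fresh:
  assumes "fresh a \<Gamma>" "sem_assms \<Gamma> \<rho> e w"
  shows "sem_assms \<Gamma> (\<rho>(a := v)) e w"
  unfolding sem_assms_def
proof
  fix l assume l: "l \<in> \<Gamma>"
  then have "a \<notin> parf (snd l)"
    using assms(1) by (auto simp: fresh_def)
  then have "sem (snd l) (\<rho>(a := v)) e w = sem (snd l) \<rho> e w"
    by (intro sem_cong(2)) auto
  then show "sem (snd l) (\<rho>(a := v)) e w"
    using assms(2) l by (simp add: sem_assms_def)
qed

definition valid :: "('c, 'p) assm list \<Rightarrow> ('c, 'p) assm set \<Rightarrow> ('c, 'p) fm \<Rightarrow> bool" where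
  "valid \<Delta> \<Gamma> B \<longleftrightarrow> (\<forall>\<rho> e w. wf_world w \<longrightarrow> env \<rho> e w \<longrightarrow> sem_assms (set \<Delta> \<union> \<Gamma>) \<rho> e w \<longrightarrow> sem B \<rho> e w)"

lemma validD:
  "valid \<Delta> \<Gamma> B \<Longrightarrow> wf_world w \<Longrightarrow> env \<rho> e w \<Longrightarrow> sem_assms \<Gamma> \<rho> e w \<Longrightarrow>
    sem_assms (set \<Delta>) \<rho> e w \<Longrightarrow> sem B \<rho> e w"
  by (auto simp: valid_def sem_assms_Un)

lemma validD0: "valid [] \<Gamma> B \<Longrightarrow> wf_world w \<Longrightarrow> env \<rho> e w \<Longrightarrow> sem_assms \<Gamma> \<rho> e w \<Longrightarrow> sem B \<rho> e w"
  by (auto simp: valid_def)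

definition val :: "(param \<Rightarrow> ('c, 'p) trm) \<Rightarrow> ('c, 'p) trm \<Rightarrow> ('c, 'p) trm" where
  "val \<rho> t = (case t of Par a \<Rightarrow> \<rho> a | _ \<Rightarrow> t)"

lemma den_val: "atomic_trm t \<Longrightarrow> den t \<rho> e w u = equal_at w (val \<rho> t) u"
  by (auto simp: val_def atomic_trm_def)

lemma atom_in_val: "atomic_trm t \<Longrightarrow> env \<rho> e w \<Longrightarrow> atom_in w (val \<rho> t)"
  unfolding atomic_trm_def by (elim disjE exE) (simp_all add: val_def env_def atom_in_def atomic_trm_def)

lemma sem_subst_val: "atomic_trm t \<Longrightarrow> sem (substf x t A) \<rho> e w = sem A \<rho> (e(x := val \<rho> t)) w"
  by (rule sem_subst(2)) (rule den_val)

lemma sem_subst_par: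
  assumes "a \<notin> parf A"
  shows "sem (substf x (Par a) A) (\<rho>(a := v)) e w = sem A \<rho> (e(x := v)) w"
proof -
  have "sem (substf x (Par a) A) (\<rho>(a := v)) e w = sem A (\<rho>(a := v)) (e(x := v)) w"
    using sem_subst_val[of "Par a" x A "\<rho>(a := v)" e w] by (simp add: atomic_trm_def val_def)
  also have "\<dots> = sem A \<rho> (e(x := v)) w"
    using assms by (intro sem_cong(2)) auto
  finally show ?thesis .
qed

lemma sem_Ext_atomic:
  assumes "atomic_trm t" "env \<rho> e w" "wf_world w"
  shows "sem (Ext t) \<rho> e w \<longleftrightarrow> exists_at w (val \<rho> t)"
proof
  assume "sem (Ext t) \<rho> e w"
  then have "cover (\<lambda>w. exists_at w (val \<rho> t)) w"
    unfolding sem.simps den_val[OF assms(1)] by (rule cover_map[OF _ assms(3)]) (auto simp: equal_at_def)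
  then show "exists_at w (val \<rho> t)"
    using assms(3) by (rule exists_at_cover)
next
  assume "exists_at w (val \<rho> t)"
  then have "\<exists>u. atom_in w u \<and> equal_at w (val \<rho> t) u"
    using equal_at_refl atom_in_val[OF assms(1,2)] by blast
  then show "sem (Ext t) \<rho> e w"
    unfolding sem.simps den_val[OF assms(1)] by (rule cover_ret)
qed

text \<open>The common denotation can be moved to the individual named by \<open>t\<close>; being
  then the same on the whole cover, it can be glued.\<close>

lemma sem_Eq_atomic:
  assumes "atomic_trm t" "env \<rho> e w" "wf_world w"
  shows "sem (Eq s t) \<rho> e w \<longleftrightarrow> den s \<rho> e w (val \<rho> t)"
proof
  assume "sem (Eq s t) \<rho> e w"
  then have "cover (\<lambda>w. den s \<rho> e w (val \<rho> t)) w"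
    unfolding sem.simps den_val[OF assms(1)]
  proof (rule cover_map[OF _ assms(3)])
    fix w' assume "w \<preceq> w'" "\<exists>u. atom_in w' u \<and> den s \<rho> e w' u \<and> equal_at w' (val \<rho> t) u"
    then show "den s \<rho> e w' (val \<rho> t)"
      using den_equal_at equal_at_sym wle_wf by blast
  qed
  then show "den s \<rho> e w (val \<rho> t)"
    using assms(3) by (rule sem_cover(1))
next
  assume "den s \<rho> e w (val \<rho> t)"
  then have "\<exists>u. atom_in w u \<and> den s \<rho> e w u \<and> equal_at w (val \<rho> t) u"
    using equal_at_refl den_exists_at atom_in_val[OF assms(1,2)] by blast
  then show "sem (Eq s t) \<rho> e w"
    unfolding sem.simps den_val[OF assms(1)] by (rule cover_ret)
qed

text \<open>On a cover both terms denote a common individual. By uniqueness of denotations they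
  agree from then on, and being closed they do so for every variable environment, as
  \<open>sem_leibniz\<close> requires.\<close>

lemma sem_Eq_replace:
  assumes "sem (Eq s t) \<rho> e w" "sem (substf x s A) \<rho> e w" "wf_world w" "fvt s = {}" "fvt t = {}"
  shows "sem (substf x t A) \<rho> e w"
  using assms(1) unfolding sem.simps
proof (rule sem_cover_bind[OF _ assms(3)])
  fix w' assume w': "w \<preceq> w'" "\<exists>u. atom_in w' u \<and> den s \<rho> e w' u \<and> den t \<rho> e w' u"
  then obtain u where u: "atom_in w' u" "den s \<rho> e w' u" "den t \<rho> e w' u"
    by blast
  note wf' = wle_wf[OF w'(1)]
  have "den s \<rho> e' w'' z = den t \<rho> e' w'' z" if "w' \<preceq> w''" "atom_in w'' z" for e' w'' z
  proof -
    have "den s \<rho> e' w'' z = den s \<rho> e w'' z" "den t \<rho> e' w'' z = den t \<rho> e w'' z"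
      using assms(4,5) by (auto intro!: sem_cong(1))
    moreover have "den s \<rho> e w'' u" "den t \<rho> e w'' u" "atom_in w'' u"
      using u sem_mono(1)[OF _ wf' that(1)] atom_in_mono[OF _ that(1)] by blast+
    ultimately show ?thesis
      using den_unique[OF _ _ _ wle_wf[OF that(1)]] den_equal_at[OF _ _ wle_wf[OF that(1)]] by blast
  qed
  then have "sem (substf x s A) \<rho> e w' = sem (substf x t A) \<rho> e w'"
    using wle_refl[OF wf'] by (rule sem_leibniz(2)[where v=w'])
  then show "sem (substf x t A) \<rho> e w'"
    using sem_mono(2)[OF assms(2,3) w'(1)] by blast
qed

text \<open>In rules with an eigenparameter, \<open>\<rho>\<close> is changed at that parameter to
  the individual in question. Freshness preserves the truth of the remaining assumptions and of a
  conclusion free of the parameter. Rules with a cover as major premise are applied at the worlds of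
  the cover and glued.\<close>

lemma inference_sound:
  assumes "inference r Ps C" "\<forall>(\<Delta>, \<Gamma>, B)\<in>set Ps. valid \<Delta> \<Gamma> B \<and> is_formula ar B" "is_formula ar C"
    and w: "wf_world w" and e: "env \<rho> e w" and \<Gamma>: "\<forall>(\<Delta>, \<Gamma>, B)\<in>set Ps. sem_assms \<Gamma> \<rho> e w"
  shows "sem C \<rho> e w"
proof -
  have prem: "\<forall>(\<Delta>, \<Gamma>, B)\<in>set Ps. \<Delta> = [] \<longrightarrow> sem B \<rho> e w"
    using assms(2) \<Gamma> validD0[OF _ w e] by blast
  from assms(1) show ?thesis
  proof cases
    case (ConI \<Gamma>\<^sub>1 A \<Gamma>\<^sub>2 B)
    then show ?thesis
      using prem by simp_all
  next
    case (ConE1 \<Gamma> B)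
    then have "sem (Con C B) \<rho> e w"
      using prem by simp_all
    then show ?thesis by simp
  next
    case (ConE2 \<Gamma> A)
    then have "sem (Con A C) \<rho> e w"
      using prem by simp_all
    then show ?thesis by simp
  next
    case (ImpI n A \<Gamma>' B)
    have "sem B \<rho> e w'" if w': "w \<preceq> w'" "sem A \<rho> e w'" for w'
    proof -
      have "sem_assms \<Gamma>' \<rho> e w'"
        using ImpI \<Gamma> sem_assms_mono[OF _ w w'(1)] by auto
      then show ?thesis
        using ImpI assms(2) validD[OF _ wle_wf[OF w'(1)] env_mono[OF e w'(1)], of "[(n, A)]" \<Gamma>' B] w'(2)
        by (simp add: sem_assms_def)
    qed
    then show ?thesis
      using ImpI by simp
  next
    case (ImpE \<Gamma>\<^sub>1 A \<Gamma>\<^sub>2)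
    then have "sem (Imp A C) \<rho> e w" "sem A \<rho> e w"
      using prem by simp_all
    then show ?thesis
      using wle_refl[OF w] by simp
  next
    case (DisI1 \<Gamma>' A B)
    then have "sem A \<rho> e w"
      using prem by simp_all
    then have "sem A \<rho> e w \<or> sem B \<rho> e w" ..
    then show ?thesis
      unfolding DisI1 sem.simps by (rule cover_ret)
  next
    case (DisI2 \<Gamma>' B A)
    then have "sem B \<rho> e w"
      using prem by simp_all
    then have "sem A \<rho> e w \<or> sem B \<rho> e w" ..
    then show ?thesis
      unfolding DisI2 sem.simps by (rule cover_ret)
  next
    case (DisE \<Gamma>\<^sub>1 A B m \<Gamma>\<^sub>2 n \<Gamma>\<^sub>3)
    then have "sem (Dis A B) \<rho> e w"
      using prem by simp_all
    then show ?thesis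
      unfolding sem.simps
    proof (rule sem_cover_bind[OF _ w])
      fix w' assume w': "w \<preceq> w'" "sem A \<rho> e w' \<or> sem B \<rho> e w'"
      have "sem_assms \<Gamma>\<^sub>2 \<rho> e w'" "sem_assms \<Gamma>\<^sub>3 \<rho> e w'"
        using DisE \<Gamma> sem_assms_mono[OF _ w w'(1)] by auto
      then show "sem C \<rho> e w'"
        using DisE assms(2) validD[OF _ wle_wf[OF w'(1)] env_mono[OF e w'(1)], of "[(m, A)]" \<Gamma>\<^sub>2 C]
          validD[OF _ wle_wf[OF w'(1)] env_mono[OF e w'(1)], of "[(n, B)]" \<Gamma>\<^sub>3 C] w'(2)
        by (auto simp: sem_assms_def)
    qed
  next
    case (BotE \<Gamma>')
    then have "sem Bot \<rho> e w"
      using prem by simp_all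
    then show ?thesis
      unfolding sem.simps
    proof (rule sem_cover_bind[OF _ w])
      fix w' assume w': "w \<preceq> w'" "ne w' Bot"
      show "sem C \<rho> e w'"
        using assms(3) by (intro sem_explosion(2) wle_wf[OF w'(1)] w'(2) env_mono[OF e w'(1)])
          (simp add: is_formula_def)
    qed
  next
    case (AllI a x A \<Gamma>' n)
    have "sem A \<rho> (e(x := v)) w'" if w': "w \<preceq> w'" "atom_in w' v" "exists_at w' v" for w' v
    proof -
      let ?\<rho> = "\<rho>(a := v)"
      have e': "env ?\<rho> e w'"
        using env_upd(2)[OF env_mono[OF e w'(1)] w'(2)] .
      have "sem_assms \<Gamma>' \<rho> e w'"
        using AllI \<Gamma> sem_assms_mono[OF _ w w'(1)] by auto
      then have "sem_assms \<Gamma>' ?\<rho> e w'"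
        using AllI by (intro sem_assms_fresh)
      moreover have "sem (Ext (Par a)) ?\<rho> e w'"
        using w'(3) sem_Ext_atomic[OF _ e' wle_wf[OF w'(1)], of "Par a"] by (simp add: val_def atomic_trm_def)
      moreover have "valid [(n, Ext (Par a))] \<Gamma>' (substf x (Par a) A)"
        using AllI assms(2) by simp
      ultimately have "sem (substf x (Par a) A) ?\<rho> e w'"
        using validD[OF _ wle_wf[OF w'(1)] e', of "[(n, Ext (Par a))]" \<Gamma>'] by (simp add: sem_assms_insert sem_assms_empty del: sem.simps)
      then show ?thesis
        using AllI by (simp add: sem_subst_par)
    qed
    then show ?thesis
      using AllI by simp
  next
    case (AllE t \<Gamma>\<^sub>1 x A \<Gamma>\<^sub>2)
    then have "sem (All x A) \<rho> e w" "sem (Ext t) \<rho> e w"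
      using prem by simp_all
    then have "sem A \<rho> (e(x := val \<rho> t)) w"
      using sem_Ext_atomic[OF _ e w] atom_in_val[OF _ e] AllE wle_refl[OF w] by auto
    then show ?thesis
      using AllE by (simp add: sem_subst_val)
  next
    case (ExiI t \<Gamma>\<^sub>1 x A \<Gamma>\<^sub>2)
    then have "sem (substf x t A) \<rho> e w" "sem (Ext t) \<rho> e w"
      using prem by simp_all
    then have "exists_at w (val \<rho> t)" "sem A \<rho> (e(x := val \<rho> t)) w"
      using sem_Ext_atomic[OF _ e w] sem_subst_val[of t x A \<rho> e w] ExiI by auto
    then have "\<exists>u. atom_in w u \<and> exists_at w u \<and> sem A \<rho> (e(x := u)) w"
      using atom_in_val[OF _ e] ExiI by blast
    then show ?thesis
      unfolding ExiI sem.simps by (rule cover_ret)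
  next
    case (ExiE a x A \<Gamma>\<^sub>2 \<Gamma>\<^sub>1 m n)
    then have "sem (Exi x A) \<rho> e w"
      using prem by simp_all
    then show ?thesis
      unfolding sem.simps
    proof (rule sem_cover_bind[OF _ w])
      fix w' assume w': "w \<preceq> w'" "\<exists>u. atom_in w' u \<and> exists_at w' u \<and> sem A \<rho> (e(x := u)) w'"
      then obtain v where v: "atom_in w' v" "exists_at w' v" "sem A \<rho> (e(x := v)) w'"
        by blast
      let ?\<rho> = "\<rho>(a := v)"
      let ?\<Delta> = "[(m, substf x (Par a) A), (n, Ext (Par a))]"
      have e': "env ?\<rho> e w'"
        using env_upd(2)[OF env_mono[OF e w'(1)] v(1)] .
      have "sem_assms \<Gamma>\<^sub>2 \<rho> e w'"
        using ExiE \<Gamma> sem_assms_mono[OF _ w w'(1)] by auto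
      then have "sem_assms \<Gamma>\<^sub>2 ?\<rho> e w'"
        using ExiE by (intro sem_assms_fresh)
      moreover have "sem (Ext (Par a)) ?\<rho> e w'"
        using v(2) sem_Ext_atomic[OF _ e' wle_wf[OF w'(1)], of "Par a"] by (simp add: val_def atomic_trm_def)
      moreover have "sem (substf x (Par a) A) ?\<rho> e w'"
        using v(3) ExiE by (simp add: sem_subst_par)
      moreover have "valid ?\<Delta> \<Gamma>\<^sub>2 C"
        using ExiE assms(2) by simp
      ultimately have "sem C ?\<rho> e w'"
        using validD[OF _ wle_wf[OF w'(1)] e', of ?\<Delta> \<Gamma>\<^sub>2] by (simp add: sem_assms_insert sem_assms_empty del: sem.simps)
      moreover have "sem C ?\<rho> e w' = sem C \<rho> e w'"
        using ExiE by (intro sem_cong(2)) auto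
      ultimately show "sem C \<rho> e w'" by simp
    qed
  next
    case (EqI a t \<Gamma>\<^sub>2 \<Gamma>\<^sub>1 n)
    then have "sem (Ext t) \<rho> e w"
      using prem by simp_all
    then show ?thesis
      unfolding sem.simps
    proof (rule sem_cover_bind[OF _ w])
      fix w' assume w': "w \<preceq> w'" "\<exists>u. atom_in w' u \<and> den t \<rho> e w' u"
      then obtain v where v: "atom_in w' v" "den t \<rho> e w' v"
        by blast
      let ?\<rho> = "\<rho>(a := v)"
      let ?\<Delta> = "[(n, Eq (Par a) t)]"
      have e': "env ?\<rho> e w'"
        using env_upd(2)[OF env_mono[OF e w'(1)] v(1)] .
      have "sem_assms \<Gamma>\<^sub>2 \<rho> e w'"
        using EqI \<Gamma> sem_assms_mono[OF _ w w'(1)] by auto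
      then have "sem_assms \<Gamma>\<^sub>2 ?\<rho> e w'"
        using EqI by (intro sem_assms_fresh)
      moreover have "sem (Eq (Par a) t) ?\<rho> e w'"
      proof -
        have "den t ?\<rho> e w' v = den t \<rho> e w' v"
          using EqI by (intro sem_cong(1)) auto
        then have "\<exists>u. atom_in w' u \<and> den (Par a) ?\<rho> e w' u \<and> den t ?\<rho> e w' u"
          using v equal_at_refl[OF den_exists_at[OF v(2)]] by (intro exI[of _ v]) simp
        then show ?thesis
          unfolding sem.simps by (rule cover_ret)
      qed
      moreover have "valid ?\<Delta> \<Gamma>\<^sub>2 C"
        using EqI assms(2) by simp
      ultimately have "sem C ?\<rho> e w'"
        using validD[OF _ wle_wf[OF w'(1)] e', of ?\<Delta> \<Gamma>\<^sub>2] by (simp add: sem_assms_insert sem_assms_empty del: sem.simps)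
      moreover have "sem C ?\<rho> e w' = sem C \<rho> e w'"
        using EqI by (intro sem_cong(2)) auto
      ultimately show "sem C \<rho> e w'" by simp
    qed
  next
    case (EqE \<Gamma>\<^sub>1 s t \<Gamma>\<^sub>2 x A)
    then have "sem (Eq s t) \<rho> e w" "sem (substf x s A) \<rho> e w"
      using prem by simp_all
    moreover have "fvt s = {}" "fvt t = {}"
      using EqE assms(2) by (auto simp: is_formula_def)
    ultimately show ?thesis
      using sem_Eq_replace w EqE by blast
  next
    case (AD_Pred t ts \<Gamma>' R)
    then have "sem (Pred R ts) \<rho> e w"
      using prem by simp_all
    then show ?thesis
      unfolding AD_Pred sem_Pred sem.simps(4)
    proof (rule cover_map[OF _ w])
      fix w' assume "\<exists>us. list_all2 (\<lambda>t u. atom_in w' u \<and> den t \<rho> e w' u) ts us \<and> nf w' (Pred R us)"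
      then show "\<exists>u. atom_in w' u \<and> den t \<rho> e w' u"
        using AD_Pred by (auto simp: list_all2_conv_all_nth in_set_conv_nth)
    qed
  next
    case (AD_Eq1 \<Gamma>' s t)
    then have "sem (Eq s t) \<rho> e w"
      using prem by simp_all
    then show ?thesis
      unfolding AD_Eq1 sem.simps by (rule cover_map[OF _ w]) blast
  next
    case (AD_Eq2 \<Gamma>' s t)
    then have "sem (Eq s t) \<rho> e w"
      using prem by simp_all
    then show ?thesis
      unfolding AD_Eq2 sem.simps by (rule cover_map[OF _ w]) blast
  next
    case (IotaI t a x F \<Gamma>\<^sub>2 \<Gamma>\<^sub>3 \<Gamma>\<^sub>1 k m n)
    let ?t = "val \<rho> t"
    let ?\<Delta> = "[(k, Eq (Par a) t)]" and ?\<Delta>' = "[(m, substf x (Par a) F), (n, Ext (Par a))]"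
    have "sem (Ext t) \<rho> e w"
      using IotaI prem by simp_all
    then have ext: "exists_at w ?t"
      using sem_Ext_atomic[OF _ e w] IotaI by blast
    \<comment> \<open>The two subdeductions of \<open>IotaI\<close>, read with \<open>a\<close>
      denoting \<open>v\<close>, are the two directions of Russell's clause.\<close>
    have "equal_at w' v ?t \<longleftrightarrow> exists_at w' v \<and> sem F \<rho> (e(x := v)) w'" if w': "w \<preceq> w'" "atom_in w' v" for w' v
    proof -
      let ?\<rho> = "\<rho>(a := v)"
      note wf' = wle_wf[OF w'(1)]
      have e': "env ?\<rho> e w'"
        using env_upd(2)[OF env_mono[OF e w'(1)] w'(2)] .
      have "sem_assms \<Gamma>\<^sub>2 \<rho> e w'" "sem_assms \<Gamma>\<^sub>3 \<rho> e w'"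
        using IotaI \<Gamma> sem_assms_mono[OF _ w w'(1)] by auto
      moreover have "fresh a \<Gamma>\<^sub>2" "fresh a \<Gamma>\<^sub>3"
        using IotaI by (auto simp: fresh_def)
      ultimately have G: "sem_assms \<Gamma>\<^sub>2 ?\<rho> e w'" "sem_assms \<Gamma>\<^sub>3 ?\<rho> e w'"
        by (auto intro: sem_assms_fresh)
      have vt: "val ?\<rho> t = ?t"
        using IotaI by (auto simp: val_def atomic_trm_def)
      have eq: "sem (Eq (Par a) t) ?\<rho> e w' \<longleftrightarrow> equal_at w' v ?t"
        using sem_Eq_atomic[OF _ e' wf', of t "Par a"] IotaI vt by simp
      have F: "sem (substf x (Par a) F) ?\<rho> e w' \<longleftrightarrow> sem F \<rho> (e(x := v)) w'"
        using IotaI by (simp add: sem_subst_par)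
      have ex: "sem (Ext (Par a)) ?\<rho> e w' \<longleftrightarrow> exists_at w' v"
        using sem_Ext_atomic[OF _ e' wf', of "Par a"] by (simp add: val_def atomic_trm_def)
      have "valid ?\<Delta> \<Gamma>\<^sub>2 (substf x (Par a) F)" "valid ?\<Delta>' \<Gamma>\<^sub>3 (Eq (Par a) t)"
        using IotaI assms(2) by simp_all
      note valid = this
      have "sem F \<rho> (e(x := v)) w'" if "equal_at w' v ?t"
        using validD[OF valid(1) wf' e' G(1)] that
        unfolding list.set sem_assms_insert snd_conv eq F by (simp add: sem_assms_empty)
      moreover have "equal_at w' v ?t" if "exists_at w' v" "sem F \<rho> (e(x := v)) w'"
        using validD[OF valid(2) wf' e' G(2)] that
        unfolding list.set sem_assms_insert snd_conv eq F ex by (simp add: sem_assms_empty)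
      moreover have "exists_at w' v" if "equal_at w' v ?t"
        using that by (simp add: equal_at_def)
      ultimately show ?thesis by blast
    qed
    then have "den (Iota x F) \<rho> e w ?t"
      using ext by simp
    then show ?thesis
      using sem_Eq_atomic[OF _ e w] IotaI by blast
  next
    case (IotaE1 t u \<Gamma>\<^sub>1 x F \<Gamma>\<^sub>2)
    then have "sem (Eq (Iota x F) t) \<rho> e w" "sem (Eq u t) \<rho> e w"
      using prem by simp_all
    then have "den (Iota x F) \<rho> e w (val \<rho> t)" "equal_at w (val \<rho> u) (val \<rho> t)"
      using sem_Eq_atomic[OF _ e w] den_val[of u \<rho> e w] IotaE1 by blast+
    then have "sem F \<rho> (e(x := val \<rho> u)) w"
      using wle_refl[OF w] atom_in_val[OF _ e] IotaE1 by auto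
    then show ?thesis
      using IotaE1 by (simp add: sem_subst_val)
  next
    case (IotaE2 t u \<Gamma>\<^sub>1 x F \<Gamma>\<^sub>2 \<Gamma>\<^sub>3)
    then have "sem (Eq (Iota x F) t) \<rho> e w" "sem (substf x u F) \<rho> e w" "sem (Ext u) \<rho> e w"
      using prem by simp_all
    then have "den (Iota x F) \<rho> e w (val \<rho> t)" "sem F \<rho> (e(x := val \<rho> u)) w" "exists_at w (val \<rho> u)"
      using sem_Eq_atomic[OF _ e w] sem_Ext_atomic[OF _ e w] sem_subst_val[of u x F \<rho> e w] IotaE2 by blast+
    then have "equal_at w (val \<rho> u) (val \<rho> t)"
      using wle_refl[OF w] atom_in_val[OF _ e] IotaE2 by auto
    then show ?thesis
      using sem_Eq_atomic[OF _ e w] den_val[of u \<rho> e w] IotaE2 by blast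
  next
    case (IotaE3 \<Gamma>' x F t)
    then have "sem (Eq (Iota x F) t) \<rho> e w"
      using prem by simp_all
    then show ?thesis
      unfolding IotaE3 sem.simps(3,4) by (rule cover_map[OF _ w]) blast
  qed
qed

lemma by_rules_sound: "by_rules ar D \<Longrightarrow> valid [] (open_assms D) (concl D)"
proof (induction rule: by_rules.induct)
  case (1 B n)
  then show ?case by (simp add: valid_def sem_assms_def)
next
  case (2 C Ds r)
  note form = \<open>is_formula ar C\<close> and inf = \<open>inference r _ C\<close>
  let ?Ps = "map (\<lambda>(\<Delta>, E). (\<Delta>, open_assms E - set \<Delta>, concl E)) Ds"
  have P: "valid \<Delta> \<Gamma> B \<and> is_formula ar B" if p: "(\<Delta>, \<Gamma>, B) \<in> set ?Ps" for \<Delta> \<Gamma> B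
  proof -
    obtain E where "(\<Delta>, E) \<in> set Ds" and [simp]: "\<Gamma> = open_assms E - set \<Delta>" "B = concl E"
      using p by auto
    then have "by_rules ar E" "valid [] (open_assms E) (concl E)"
      using 2 by auto
    then show ?thesis
      using by_rules_formula by (auto simp: valid_def sem_assms_def)
  qed
  show ?case
    unfolding valid_def
  proof (intro allI impI)
    fix \<rho> e w assume w: "wf_world w" "env \<rho> e w" "sem_assms (set [] \<union> open_assms (Infer r C Ds)) \<rho> e w"
    have G: "sem_assms \<Gamma> \<rho> e w" if "(\<Delta>, \<Gamma>, B) \<in> set ?Ps" for \<Delta> \<Gamma> B
      using w(3) that by (fastforce simp: sem_assms_def)
    have "sem C \<rho> e w"
      by (rule inference_sound[OF inf _ form w(1,2)]) (use P G in blast)+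
    then show "sem (concl (Infer r C Ds)) \<rho> e w"
      by simp
  qed
qed

lemma by_rules_open_formula: "by_rules ar D \<Longrightarrow> l \<in> open_assms D \<Longrightarrow> is_formula ar (snd l)"
  by (induction rule: by_rules.induct) auto

theorem normalization:
  fixes D :: "('c, 'p) ded"
  assumes "deduction ar D \<Gamma> A"
  shows "\<exists>D'. deduction ar D' \<Gamma> A \<and> normal D'"
proof -
  have D: "by_rules ar D" "concl D = A" "snd ` open_assms D \<subseteq> \<Gamma>"
    using assms by (auto simp: deduction_def)
  \<comment> \<open>The element 0 keeps \<open>V\<close> nonempty and serves as default value for
    \<open>\<rho>\<close> and \<open>e\<close>.\<close>
  define V where "V = insert 0 (parf A \<union> (\<Union>l\<in>open_assms D. parf (snd l)))"
  \<comment> \<open>All open assumptions are relabelled with 0, which makes them strong and thus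
    subject to reflection.\<close>
  define w where "w = (V, (\<lambda>l. (0::nat, snd l)) ` open_assms D)"
  \<comment> \<open>The identity on the parameters that matter; other parameters are sent into the
    world, as \<open>env\<close> demands.\<close>
  define \<rho> :: "param \<Rightarrow> ('c, 'p) trm" where "\<rho> a = Par (if a \<in> V then a else 0)" for a
  define e :: "var \<Rightarrow> ('c, 'p) trm" where "e x = Par 0" for x
  have "finite V"
    by (simp add: V_def finite_par finite_open_assms)
  then have w: "wf_world w"
    using by_rules_open_formula[OF D(1)] by (auto simp: wf_world_def w_def V_def)
  have e: "env \<rho> e w"
    by (auto simp: env_def atom_in_def atomic_trm_def w_def \<rho>_def e_def V_def)
  have inst: "instf B \<rho> e = B" if "is_formula ar B" "parf B \<subseteq> V" for B
    using that by (intro inst_id(2)) (auto simp: is_formula_def \<rho>_def)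
  have "sem (snd l) \<rho> e w" if l: "l \<in> open_assms D" for l
  proof -
    have f: "is_formula ar (snd l)" "parf (snd l) \<subseteq> V"
      using by_rules_open_formula[OF D(1) l] l by (auto simp: V_def)
    have "ne0 w (snd l)"
      using w by (rule ne0_Assm) (use l in \<open>auto simp: w_def\<close>)
    then show ?thesis
      using reify_reflect(2)[OF _ w e, of "snd l"] inst[OF f] f(1) by (simp add: is_formula_def)
  qed
  then have "sem A \<rho> e w"
    using validD0[OF by_rules_sound[OF D(1)] w e] D(2) by (simp add: sem_assms_def)
  moreover have "is_formula ar A" "parf A \<subseteq> V"
    using by_rules_formula[OF D(1)] D(2) by (auto simp: V_def)
  ultimately have "nf w A"
    using reify_reflect(2)[OF _ w e, of A] inst by (simp add: is_formula_def)
  then obtain D' where D': "proof_of (\<lambda>_. True) w A D'"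
    unfolding derivable_def by blast
  then have "open_assms D' \<subseteq> (\<lambda>l. (0, snd l)) ` open_assms D"
    by (simp add: proof_of_def w_def)
  \<comment> \<open>The relabelling does no harm, since \<open>\<Gamma>\<close> records formulas
    without labels.\<close>
  then have "snd ` open_assms D' \<subseteq> \<Gamma>"
    using D(3) by fastforce
  then show ?thesis
    using D' standing_conventions normal_of_locally_normal
    unfolding deduction_def proof_of_def by blast
qed

end

theorem theorem4:
  fixes ar :: "'p \<Rightarrow> nat"
    and D :: "('c, 'p) ded"
    and \<Gamma> :: "('c, 'p) fm set"
    and A :: "('c, 'p) fm"
  assumes "deduction ar D \<Gamma> A"
  shows "\<exists>D' :: ('c, 'p) ded. deduction ar D' \<Gamma> A \<and> normal D'"
  using assms by (rule language.normalization)

end
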